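(* Let $\sigma$ be a measurable function on $\mathbb{R}^n$ with the following properties: (a) $\sigma\in L^1(\mathbb{R}^n)$ and $\sigma\geq0$; (b) $\sigma(A^*\xi)\leq\sigma(\xi)$ for a.e. $\xi\in\mathbb{R}^n$; (c) if $K$ is the support of $\xi\mapsto\sigma((A^* )^{-1}\xi)-\sigma(\xi)$, then $\mathrm{Per}(\chi_K)$ is bounded; (d) $\lim_{J\rightarrow\infty}\sigma((A^* )^{-J}\xi)=1$ for a.e. $\xi\in\mathbb{R}^n$; (e) $\lim_{J\rightarrow\infty}\sigma((A^* )^{J}\xi)=0$ for a.e. $\xi\in\mathbb{R}^n$. Then there is a finite measurable partition $K_1,\dots,K_p$ of $K$ such that no $K_i$ contains both $\xi$ and $\xi+2k\pi$ for some $\xi\in\mathbb{R}^n$ and some $k\in\mathbb{Z}^n\setminus\{0\}$. Moreover, for any such partition, define $\varphi_k$ ($k\in\mathbb{Z}^n$) by $$\widehat{\varphi}_k(\xi)=\begin{cases}\sqrt{\sigma(\xi)}&\text{if }\xi\in[-\pi,\pi]^n+2k\pi,\\0&\text{otherwise,}\end{cases}$$ and let $\psi_1,\dots,\psi_p$ be such that each $\widehat{\psi}_i$ is measurable with $$|\widehat{\psi}_i|^2(\xi)=\begin{cases}\sigma((A^* )^{-1}\xi)-\sigma(\xi)&\text{if }\xi\in K_i,\\0&\text{otherwise.}\end{cases}$$ Then all $\varphi_k$ and $\psi_i$ belong to $L^2(\mathbb{R}^n)$, $$\sigma(\xi)=\sum_{k\in\mathbb{Z}^n}|\widehat{\varphi}_k|^2(\xi)=\sum_{j\geq1}\sum_{i=1}^p|\widehat{\psi}_i((A^*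 )^j\xi)|^2\quad\text{for a.e. }\xi\in\mathbb{R}^n,$$ and $\{\psi_1,\dots,\psi_p\}$ (with any $\psi_i$ that is identically $0$ discarded) is a NTF multiwavelet, i.e. $\{D_A^jT_k\psi_i\,|\,j\in\mathbb{Z},k\in\mathbb{Z}^n,i\in\{1,\dots,p\}\}$ is a normalized tight frame for $L^2(\mathbb{R}^n)$.
   Context: $A$ is a fixed $n\times n$ matrix, all of whose eigenvalues $\lambda$ satisfy $|\lambda|>1$, with $A\mathbb{Z}^n\subset\mathbb{Z}^n$; $A^*$ is its adjoint (transpose). On $L^2(\mathbb{R}^n)$ put $T_kf(\xi)=f(\xi-k)$ for $k\in\mathbb{Z}^n$ and $D_Af(\xi)=|\det A|^{1/2}f(A\xi)$. The Fourier transform is $\widehat f(\xi)=\int_{\mathbb{R}^n}f(x)e^{-i\langle x\,|\,\xi\rangle}\,dx$ (extended to $L^2(\mathbb{R}^n)$). A family $\{e_i\}_{i\in I}$ in a Hilbert space $H$ is a normalized tight frame (NTF) for $H$ if $\sum_{i\in I}|\langle f\,|\,e_i\rangle|^2=\|f\|^2$ for all $f\in H$. For a nonnegative measurable (or $L^1$) function $f$, $\mathrm{Per}(f)(\xi):=\sum_{k\in\mathbb{Z}^n}f(\xi+2k\pi)$. The support of a function means the set of points where it is nonzero; $\chi_K$ is the characteristic function of $K$. *)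

theory Defs
  imports "HOL-Analysis.Analysis"
begin

text \<open>
  ``Measurable'' means Lebesgue measurable throughout. Elements of \<open>L\<^sup>2\<close> are represented by
  functions; equality in \<open>L\<^sup>2\<close> is equality almost everywhere.
\<close>

definition L2 :: "(real^'n \<Rightarrow> complex) set" where
  "L2 = {f. f \<in> borel_measurable lebesgue \<and> integrable lebesgue (\<lambda>x. (cmod (f x))\<^sup>2)}"

definition L2_inner :: "(real^'n \<Rightarrow> complex) \<Rightarrow> (real^'n \<Rightarrow> complex) \<Rightarrow> complex" where
  "L2_inner f g = (LINT x|lebesgue. f x * cnj (g x))"

definition L2_norm :: "(real^'n \<Rightarrow> complex) \<Rightarrow> real" where
  "L2_norm f = sqrt (LINT x|lebesgue. (cmod (f x))\<^sup>2)"

text \<open>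
  Convergence in \<open>L\<^sup>2\<close>. The nonnegative integral is used because it is infinite, and not \<open>0\<close>,
  when a difference is not square integrable.
\<close>

definition L2_tendsto :: "(nat \<Rightarrow> real^'n \<Rightarrow> complex) \<Rightarrow> (real^'n \<Rightarrow> complex) \<Rightarrow> bool" where
  "L2_tendsto F f \<longleftrightarrow>
     (\<lambda>m. \<integral>\<^sup>+x. ennreal ((cmod (F m x - f x))\<^sup>2) \<partial>lebesgue) \<longlonglongrightarrow> 0"

definition normalized_tight_frame :: "'i set \<Rightarrow> ('i \<Rightarrow> real^'n \<Rightarrow> complex) \<Rightarrow> bool" where
  "normalized_tight_frame I e \<longleftrightarrow>
     (\<forall>i\<in>I. e i \<in> L2) \<and>
     (\<forall>f\<in>L2. ((\<lambda>i. (cmod (L2_inner f (e i)))\<^sup>2) has_sum (L2_norm f)\<^sup>2) I)"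

definition fourier_L1 :: "(real^'n \<Rightarrow> complex) \<Rightarrow> real^'n \<Rightarrow> complex" where
  "fourier_L1 f \<xi> = (LINT x|lebesgue. f x * exp (- (\<i> * complex_of_real (x \<bullet> \<xi>))))"

text \<open>
  \<open>has_fourier f g\<close>: the function \<open>g\<close> represents the Fourier transform of \<open>f \<in> L\<^sup>2\<close>, i.e. the
  value at \<open>f\<close> of the continuous extension of \<^const>\<open>fourier_L1\<close> from \<open>L\<^sup>1 \<inter> L\<^sup>2\<close> to \<open>L\<^sup>2\<close>.
  This is a relation since \<open>g\<close> is only determined almost everywhere.
\<close>

definition has_fourier :: "(real^'n \<Rightarrow> complex) \<Rightarrow> (real^'n \<Rightarrow> complex) \<Rightarrow> bool" where
  "has_fourier f g \<longleftrightarrow> f \<in> L2 \<and> g \<in> L2 \<and>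
     (\<exists>F. (\<forall>m. F m \<in> L2 \<and> integrable lebesgue (F m)) \<and>
          L2_tendsto F f \<and> L2_tendsto (\<lambda>m. fourier_L1 (F m)) g)"

definition complex_eigenvalue :: "real^'n^'n \<Rightarrow> complex \<Rightarrow> bool" where
  "complex_eigenvalue A l \<longleftrightarrow>
     (\<exists>v::complex^'n. v \<noteq> 0 \<and> (\<chi> i j. complex_of_real (A $ i $ j)) *v v = l *s v)"

text \<open>Power for the matrix product; \<open>(^)\<close> on \<open>real^'n^'n\<close> would be entrywise.\<close>

primrec mat_pow :: "real^'n^'n \<Rightarrow> nat \<Rightarrow> real^'n^'n" where
  "mat_pow M 0 = mat 1"
| "mat_pow M (Suc j) = M ** mat_pow M j"

text \<open>\<open>\<int>\<^sup>n\<close> as a subset of \<open>\<real>\<^sup>n\<close>.\<close>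

definition int_lattice :: "(real^'n) set" where
  "int_lattice = {k. \<forall>i. k $ i \<in> \<int>}"

definition translation :: "real^'n \<Rightarrow> (real^'n \<Rightarrow> complex) \<Rightarrow> real^'n \<Rightarrow> complex" where
  "translation k f = (\<lambda>\<xi>. f (\<xi> - k))"

definition dilation :: "real^'n^'n \<Rightarrow> (real^'n \<Rightarrow> complex) \<Rightarrow> real^'n \<Rightarrow> complex" where
  "dilation A f = (\<lambda>\<xi>. complex_of_real (sqrt \<bar>det A\<bar>) * f (A *v \<xi>))"

text \<open>For invertible \<open>A\<close> the operator \<^term>\<open>dilation A\<close> is a bijection, so that \<^const>\<open>inv\<close> is
  its inverse.\<close>

definition dilation_pow :: "real^'n^'n \<Rightarrow> int \<Rightarrow> (real^'n \<Rightarrow> complex) \<Rightarrow> real^'n \<Rightarrow> complex" where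
  "dilation_pow A j =
     (if 0 \<le> j then dilation A ^^ nat j else inv (dilation A) ^^ nat (- j))"

definition NTF_multiwavelet :: "real^'n^'n \<Rightarrow> 'i set \<Rightarrow> ('i \<Rightarrow> real^'n \<Rightarrow> complex) \<Rightarrow> bool" where
  "NTF_multiwavelet A I \<psi> \<longleftrightarrow>
     normalized_tight_frame ((UNIV :: int set) \<times> int_lattice \<times> I)
       (\<lambda>(j, k, i). dilation_pow A j (translation k (\<psi> i)))"

definition Per :: "(real^'n \<Rightarrow> ennreal) \<Rightarrow> real^'n \<Rightarrow> ennreal" where
  "Per f \<xi> = (\<Sum>\<^sub>\<infinity>k\<in>int_lattice. f (\<xi> + (2 * pi) *\<^sub>R k))"

definition translation_free :: "(real^'n) set \<Rightarrow> bool" where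
  "translation_free S \<longleftrightarrow>
     \<not> (\<exists>\<xi>. \<exists>k\<in>int_lattice - {0}. \<xi> \<in> S \<and> \<xi> + (2 * pi) *\<^sub>R k \<in> S)"

text \<open>The pieces \<open>Ks 1, \<dots>, Ks p\<close> of the partition may be empty.\<close>

definition translation_free_partition ::
  "(real^'n) set \<Rightarrow> nat \<Rightarrow> (nat \<Rightarrow> (real^'n) set) \<Rightarrow> bool" where
  "translation_free_partition K p Ks \<longleftrightarrow>
     (\<forall>i\<in>{1..p}. Ks i \<in> sets lebesgue) \<and>
     disjoint_family_on Ks {1..p} \<and> (\<Union>i\<in>{1..p}. Ks i) = K \<and>
     (\<forall>i\<in>{1..p}. translation_free (Ks i))"

end

theory Submission
  imports Defs
begin

text \<open>
  Let \<open>\<tau> \<xi> = \<sigma> ((A\<^sup>T)\<^sup>-\<^sup>1 \<xi>) - \<sigma> \<xi>\<close>, which is nonnegative almost everywhere by (b). The transforms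
  of the \<open>\<psi>\<^sub>i\<close> are supported on the pieces of the support \<open>K\<close> of \<open>\<tau>\<close>, so that
  their squared absolute values add up to \<open>\<tau>\<close>. Along an orbit of \<open>A\<^sup>T\<close> the values of \<open>\<tau>\<close>
  telescope: summed over the powers \<open>j \<ge> 1\<close> they give \<open>\<sigma> \<xi>\<close> by (e), and over all integers \<open>j\<close> they give
  1 by (d) and (e). This last fact is the Calderon condition, and it yields the frame property
  (\<open>multiwavelet_criterion\<close>): for fixed \<open>j\<close> and \<open>i\<close> the inner products of \<open>f\<close> with
  \<open>D\<^sub>A\<^sup>j T\<^sub>k \<psi>\<^sub>i\<close> are, up to constants, the Fourier coefficients of a function that vanishes off
  \<open>K\<^sub>i\<close>. As \<open>K\<^sub>i\<close> meets each coset of \<open>2 \<pi> \<int>\<^sup>n\<close> at most once, folding it into the torus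
  loses nothing, and the Parseval identity sums the squares over \<open>k\<close> (\<open>lattice_translates_sum\<close>).
  It remains to add over \<open>i\<close> and \<open>j\<close> under the integral.

  The partition exists because bounded periodization bounds the number of points of \<open>K\<close> in a coset:
  the points of a coset are ranked along a fixed enumeration of the cells, and the pieces are the
  level sets of the rank (\<open>translation_free_partition_exists\<close>).

  The Fourier analysis rests on the Parseval identity for translation-free sets
  (\<open>Parseval_translation_free\<close>). On the torus it says that trigonometric polynomials are dense, which
  follows from the Weierstrass theorem applied to cosines and a Dynkin argument. The
  \<open>Plancherel\<close> theorem is obtained from it by averaging over shifts of the sampling
  lattice. The existence of the \<open>\<phi>\<^sub>k\<close> and \<open>\<psi>\<^sub>i\<close>
  (\<open>fourier_surjective\<close>) follows from the Plancherel theorem and the multiplication formula, since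
  the prescribed transforms live on sets of finite measure and are therefore integrable. The frame
  identity is first proved for \<open>f\<close> in \<open>L\<^sup>1 \<inter> L\<^sup>2\<close>, whose transform is a bounded function given by an
  integral, and then extended by truncation (\<open>tight_frame_from_dense\<close>).
\<close>

section \<open>Affine changes of variables for Lebesgue measure\<close>

lemma matrix_inv:
  fixes B :: "'a::field^'n^'n"
  assumes "invertible B"
  shows matrix_inv_right: "B ** matrix_inv B = mat 1" and matrix_inv_left: "matrix_inv B ** B = mat 1"
proof -
  have "\<exists>C. B ** C = mat 1 \<and> C ** B = mat 1" using assms by (simp add: invertible_def)
  from someI_ex[OF this] show "B ** matrix_inv B = mat 1" "matrix_inv B ** B = mat 1"
    by (simp_all add: matrix_inv_def)
qed

text \<open>
  Elementary matrices suffice. A shear has determinant 1 because it arises from the identity matrix by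
  a row operation, an argument valid for every finite index type. It preserves the content of a box whose
  lower corner has been moved so that the coordinate that is added is nonnegative.
\<close>

lemma measure_matrix_image:
  fixes A :: "real^'n^'n"
  shows "\<forall>S\<in>lmeasurable. (*v) A ` S \<in> lmeasurable \<and>
           measure lebesgue ((*v) A ` S) = \<bar>det A\<bar> * measure lebesgue S" (is "?P A")
proof (induct A rule: induct_matrix_elementary_alt)
  fix A B :: "real^'n^'n" assume A: "?P A" and B: "?P B"
  have "(*v) (A ** B) ` S = (*v) A ` ((*v) B ` S)" for S
    by (simp add: image_comp matrix_vector_mult_matrix_matrix_mult_compose)
  with A B show "?P (A ** B)" by (auto simp: det_mul abs_mult)
next
  fix A :: "real^'n^'n" and i assume z: "row i A = 0"
  have d: "det A = 0" using z det_zero_row(2) by blast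
  then have "\<not> inj ((*v) A)"
    using det_nz_iff_inj[of "(*v) A"] by simp
  then have "negligible ((*v) A ` S)" for S
    by (intro negligible_linear_singular_image) auto
  then show "?P A"
    by (simp add: d negligible_iff_measure)
next
  fix A :: "real^'n^'n" assume D: "\<And>i j. i \<noteq> j \<Longrightarrow> A $ i $ j = 0"
  have "(*v) A x = (\<chi> k. A $ k $ k * x $ k)" for x
  proof -
    have "(\<Sum>j\<in>UNIV. A $ k $ j * x $ j) = A $ k $ k * x $ k" for k
      by (subst sum.remove[of _ k]) (auto intro!: sum.neutral simp: D)
    then show ?thesis by (simp add: matrix_vector_mult_def)
  qed
  then have eq: "(*v) A = (\<lambda>x. \<chi> k. A $ k $ k * x $ k)" by auto
  show "?P A"
    using measurable_stretch[of _ "\<lambda>k. A $ k $ k"] measure_stretch[of _ "\<lambda>k. A $ k $ k"]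
    by (auto simp: eq det_diagonal[OF D])
next
  fix m n :: 'n assume mn: "m \<noteq> n"
  let ?t = "Transposition.transpose m n"
  let ?A = "(\<chi> i j. mat 1 $ i $ ?t j) :: real^'n^'n"
  have d: "\<bar>det ?A\<bar> = 1"
    by (simp add: det_permute_columns permutes_swap_id sign_swap_id abs_mult)
  have eq: "?A *v x = (\<chi> i. x $ ?t i)" for x
  proof -
    have "(\<Sum>j\<in>UNIV. (if i = ?t j then 1 else 0) * x $ j) = x $ ?t i" for i
    proof -
      have "(i = ?t j) = (j = ?t i)" for j by (metis transpose_involutory)
      then show ?thesis by (simp add: if_distrib[of "\<lambda>u. u * _"] cong: if_cong)
    qed
    then show ?thesis by (simp add: matrix_vector_mult_def mat_def)
  qed
  have im: "(*v) ?A ` cbox a b = cbox (?A *v a) (?A *v b)" for a b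
  proof -
    have "?A *v (?A *v x) = x" for x by (simp add: eq vec_eq_iff)
    moreover have "?A *v x \<in> cbox (?A *v a) (?A *v b) \<longleftrightarrow> x \<in> cbox a b" for x a b
      unfolding eq mem_box_cart by (auto) (metis transpose_involutory)+
    ultimately show ?thesis by (auto simp: image_iff) metis
  qed
  have me: "measure lebesgue ((*v) ?A ` cbox a b) = 1 * measure lebesgue (cbox a b)" for a b
  proof (cases "cbox a b = {}")
    case False
    then have "cbox (?A *v a) (?A *v b) \<noteq> {}" using im[of a b] by blast
    then have "measure lebesgue (cbox (?A *v a) (?A *v b)) = (\<Prod>i\<in>UNIV. (b - a) $ ?t i)"
      by (simp add: content_cbox_cart eq)
    also have "\<dots> = (\<Prod>i\<in>UNIV. (b - a) $ i)"
      using prod.permute[OF permutes_swap_id[of m UNIV n], of "\<lambda>i. (b - a) $ i"] by (simp add: o_def)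
    finally show ?thesis using False unfolding im by (simp add: content_cbox_cart)
  qed simp
  show "?P ?A"
  proof
    fix S :: "(real^'n) set" assume "S \<in> lmeasurable"
    from measure_linear_sufficient[OF matrix_vector_mul_linear this me] d
    show "(*v) ?A ` S \<in> lmeasurable \<and> measure lebesgue ((*v) ?A ` S) = \<bar>det ?A\<bar> * measure lebesgue S"
      by auto
  qed
next
  fix m n :: 'n assume mn: "m \<noteq> n"
  let ?A = "(\<chi> i j. of_bool (i = m \<and> j = n \<or> i = j)) :: real^'n^'n"
  have eq: "?A *v x = (\<chi> i. if i = m then x $ m + x $ n else x $ i)" for x
  proof -
    have "(\<Sum>j\<in>UNIV. of_bool (m = m \<and> j = n \<or> m = j) * x $ j) = x $ m + x $ n"
      using mn by (subst sum.remove[of _ m], simp, simp, subst sum.remove[of _ n]) (auto intro!: sum.neutral)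
    moreover have "(\<Sum>j\<in>UNIV. of_bool (i = m \<and> j = n \<or> i = j) * x $ j) = x $ i" if "i \<noteq> m" for i
      using that by (subst sum.remove[of _ i]) (auto intro!: sum.neutral)
    ultimately show ?thesis by (auto simp: matrix_vector_mult_def vec_eq_iff)
  qed
  have "?A = (\<chi> k. if k = m then row m (mat 1) + 1 *s row n (mat 1) else row k (mat 1))"
    using mn by (auto simp: vec_eq_iff row_def mat_def)
  then have d: "det ?A = 1" by (simp only: det_row_operation[OF mn] det_I)
  have me: "measure lebesgue ((*v) ?A ` cbox a b) = 1 * measure lebesgue (cbox a b)" for a b
  proof (cases "cbox a b = {}")
    case False
    define v where "v = axis n (a $ n)"
    have sh: "cbox a b = (+) v ` cbox (a - v) (b - v)"
      by (simp flip: cbox_translation)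
    have im: "(*v) ?A ` cbox a b = (+) (?A *v v) ` ((*v) ?A ` cbox (a - v) (b - v))"
      unfolding sh image_image by (simp add: matrix_vector_right_distrib)
    have "measure lebesgue ((*v) ?A ` cbox (a - v) (b - v)) = measure lebesgue (cbox (a - v) (b - v))"
    proof -
      have "cbox (a - v) (b - v) \<noteq> {}" using False sh by auto
      moreover have "(*v) ?A = (\<lambda>x. \<chi> i. if i = m then x $ m + x $ n else x $ i)" using eq by (rule ext)
      moreover have "0 \<le> (a - v) $ n" by (simp add: v_def)
      ultimately show ?thesis using measure_shear_interval[OF mn, of "a - v" "b - v"] by metis
    qed
    then show ?thesis unfolding im measure_translation by (subst sh) (simp only: measure_translation mult_1)
  qed simp
  show "?P ?A"
  proof
    fix S :: "(real^'n) set" assume "S \<in> lmeasurable"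
    from measure_linear_sufficient[OF matrix_vector_mul_linear this me] d
    show "(*v) ?A ` S \<in> lmeasurable \<and> measure lebesgue ((*v) ?A ` S) = \<bar>det ?A\<bar> * measure lebesgue S"
      by auto
  qed
qed

lemma lborel_affine_matrix:
  fixes B :: "real^'n^'n"
  assumes B: "det B \<noteq> 0"
  shows "lborel = density (distr lborel borel (\<lambda>x. B *v x + v)) (\<lambda>_. ennreal \<bar>det B\<bar>)"
proof (rule lborel_eqI)
  fix l u :: "real^'n" assume le: "\<And>b. b \<in> Basis \<Longrightarrow> l \<bullet> b \<le> u \<bullet> b"
  have inv: "invertible B" using B by (simp add: invertible_det_nz)
  let ?C = "matrix_inv B"
  have CB: "?C *v (B *v x) = x" "B *v (?C *v x) = x" for x
    using matrix_inv_left[OF inv] matrix_inv_right[OF inv] by (simp_all add: matrix_vector_mul_assoc)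
  have dC: "\<bar>det B\<bar> * \<bar>det ?C\<bar> = 1"
    by (metis abs_mult abs_one det_I det_mul matrix_inv_right[OF inv])
  have pre: "(\<lambda>x. B *v x + v) -` box l u = (*v) ?C ` ((\<lambda>x. x - v) ` box l u)"
  proof safe
    fix x assume "B *v x + v \<in> box l u"
    moreover have "x = ?C *v ((B *v x + v) - v)" by (simp add: CB)
    ultimately show "x \<in> (*v) ?C ` ((\<lambda>x. x - v) ` box l u)" by blast
  qed (simp add: CB)
  have lm: "(\<lambda>x. x - v) ` box l u \<in> lmeasurable"
    by (intro measurable_translation_subtract) auto
  have [measurable]: "(\<lambda>x. B *v x + v) \<in> borel_measurable borel"
    by (intro borel_measurable_continuous_onI continuous_intros matrix_vector_mult_linear_continuous_on)
  have mb: "(\<lambda>x. B *v x + v) -` box l u \<in> sets borel"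
    using measurable_sets_borel[of "\<lambda>x. B *v x + v" borel "box l u"] by simp
  have "emeasure lborel ((\<lambda>x. B *v x + v) -` box l u) = emeasure lebesgue ((*v) ?C ` ((\<lambda>x. x - v) ` box l u))"
    using mb by (simp add: pre)
  also have "\<dots> = ennreal (measure lebesgue ((*v) ?C ` ((\<lambda>x. x - v) ` box l u)))"
    using measure_matrix_image lm by (intro emeasure_eq_measure2) auto
  also have "\<dots> = ennreal (\<bar>det ?C\<bar> * measure lebesgue (box l u))"
    using measure_matrix_image[of ?C] lm by (simp add: measure_translation_subtract)
  also have "\<dots> = ennreal (\<bar>det ?C\<bar> * (\<Prod>b\<in>Basis. (u - l) \<bullet> b))"
    using le by simp
  finally show "emeasure (density (distr lborel borel (\<lambda>x. B *v x + v)) (\<lambda>_. ennreal \<bar>det B\<bar>)) (box l u)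
      = ennreal (\<Prod>b\<in>Basis. (u - l) \<bullet> b)"
    using dC mb by (simp add: emeasure_density nn_integral_cmult emeasure_distr flip: ennreal_mult' mult.assoc)
qed simp

text \<open>
  By the density formula on Borel sets the map preserves and reflects null sets; this is what
  carries the formula over to the completion.
\<close>

lemma lebesgue_affine_matrix:
  fixes B :: "real^'n^'n"
  assumes B: "det B \<noteq> 0"
  shows lebesgue_affine_matrix_eq:
      "lebesgue = density (distr lebesgue lebesgue (\<lambda>x. B *v x + v)) (\<lambda>_. ennreal \<bar>det B\<bar>)"
    and lebesgue_affine_matrix_measurable: "(\<lambda>x. B *v x + v) \<in> lebesgue \<rightarrow>\<^sub>M lebesgue"
proof -
  let ?T = "\<lambda>x. B *v x + v"
  have T[measurable]: "?T \<in> borel \<rightarrow>\<^sub>M borel"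
    by (intro borel_measurable_continuous_onI continuous_intros matrix_vector_mult_linear_continuous_on)
  have eq: "null_sets lborel = null_sets (distr lebesgue lborel ?T)"
  proof -
    have "emeasure lborel X = 0 \<longleftrightarrow> emeasure (distr lebesgue lborel ?T) X = 0" if "X \<in> sets borel" for X
    proof -
      have "emeasure lborel X = emeasure (density (distr lborel borel ?T) (\<lambda>_. ennreal \<bar>det B\<bar>)) X"
        using lborel_affine_matrix[OF B, of v] by simp
      also have "\<dots> = ennreal \<bar>det B\<bar> * emeasure (distr lebesgue lborel ?T) X"
        using that by (simp add: distr_completion emeasure_density nn_integral_cmult cong: distr_cong)
      finally show ?thesis using B by simp
    qed
    then show ?thesis by (auto simp: null_sets_def)
  qed
  show "?T \<in> lebesgue \<rightarrow>\<^sub>M lebesgue"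
    by (simp add: completion.measurable_completion2 eq measurable_completion)
  have "lebesgue = completion (density (distr lborel borel ?T) (\<lambda>_. ennreal \<bar>det B\<bar>))"
    by (subst lborel_affine_matrix[OF B, of v]) simp
  also have "\<dots> = density (completion (distr lebesgue lborel ?T)) (\<lambda>_. ennreal \<bar>det B\<bar>)"
    using B by (subst completion_density_eq) (auto simp: distr_completion cong: distr_cong)
  also have "\<dots> = density (distr lebesgue lebesgue ?T) (\<lambda>_. ennreal \<bar>det B\<bar>)"
    by (subst completion.completion_distr_eq) (auto simp: eq measurable_completion)
  finally show "lebesgue = density (distr lebesgue lebesgue ?T) (\<lambda>_. ennreal \<bar>det B\<bar>)" .
qed

lemma measurable_lebesgue_affine:
  fixes B :: "real^'n^'n"
  assumes "det B \<noteq> 0" "f \<in> measurable lebesgue N"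
  shows "(\<lambda>x. f (B *v x + v)) \<in> measurable lebesgue N"
  using measurable_compose[OF lebesgue_affine_matrix_measurable[OF assms(1)] assms(2)] .

lemma nn_integral_lebesgue_affine:
  fixes B :: "real^'n^'n"
  assumes B: "det B \<noteq> 0" and [measurable]: "f \<in> borel_measurable lebesgue"
  shows "(\<integral>\<^sup>+x. f x \<partial>lebesgue) = ennreal \<bar>det B\<bar> * (\<integral>\<^sup>+x. f (B *v x + v) \<partial>lebesgue)"
proof -
  note [measurable] = lebesgue_affine_matrix_measurable[OF B, of v]
  have "(\<integral>\<^sup>+x. f x \<partial>lebesgue) = (\<integral>\<^sup>+x. f x \<partial>density (distr lebesgue lebesgue (\<lambda>x. B *v x + v)) (\<lambda>_. ennreal \<bar>det B\<bar>))"
    using lebesgue_affine_matrix_eq[OF B, of v] by simp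
  also have "\<dots> = ennreal \<bar>det B\<bar> * (\<integral>\<^sup>+x. f (B *v x + v) \<partial>lebesgue)"
    by (simp add: nn_integral_density nn_integral_distr nn_integral_cmult)
  finally show ?thesis .
qed

lemma integrable_lebesgue_affine_iff:
  fixes B :: "real^'n^'n" and f :: "_ \<Rightarrow> 'b::{banach, second_countable_topology}"
  assumes B: "det B \<noteq> 0" and [measurable]: "f \<in> borel_measurable lebesgue"
  shows "integrable lebesgue (\<lambda>x. f (B *v x + v)) \<longleftrightarrow> integrable lebesgue f"
proof -
  note [measurable] = measurable_lebesgue_affine[OF B assms(2), of v]
  have "(\<integral>\<^sup>+x. norm (f x) \<partial>lebesgue) = ennreal \<bar>det B\<bar> * (\<integral>\<^sup>+x. norm (f (B *v x + v)) \<partial>lebesgue)"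
    by (rule nn_integral_lebesgue_affine[OF B]) measurable
  then show ?thesis
    using B by (auto simp: integrable_iff_bounded ennreal_mult_less_top)
qed

lemma integral_lebesgue_affine:
  fixes B :: "real^'n^'n" and f :: "_ \<Rightarrow> 'b::{banach, second_countable_topology}"
  assumes B: "det B \<noteq> 0" and [measurable]: "f \<in> borel_measurable lebesgue"
  shows "(LINT x|lebesgue. f x) = \<bar>det B\<bar> *\<^sub>R (LINT x|lebesgue. f (B *v x + v))"
proof -
  note [measurable] = lebesgue_affine_matrix_measurable[OF B, of v]
  have "(LINT x|lebesgue. f x) = (LINT x|density (distr lebesgue lebesgue (\<lambda>x. B *v x + v)) (\<lambda>_. ennreal \<bar>det B\<bar>). f x)"
    using lebesgue_affine_matrix_eq[OF B, of v] by simp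
  also have "\<dots> = \<bar>det B\<bar> *\<^sub>R (LINT x|lebesgue. f (B *v x + v))"
    by (simp add: integral_density integral_distr)
  finally show ?thesis .
qed

lemma AE_lebesgue_affine:
  fixes B :: "real^'n^'n"
  assumes B: "det B \<noteq> 0" and P: "AE x in lebesgue. P x"
  shows "AE x in lebesgue. P (B *v x + v)"
proof -
  note [measurable] = lebesgue_affine_matrix_measurable[OF B, of v]
  from P have "AE x in density (distr lebesgue lebesgue (\<lambda>x. B *v x + v)) (\<lambda>_. ennreal \<bar>det B\<bar>). P x"
    by (subst (asm) lebesgue_affine_matrix_eq[OF B, of v])
  then have "AE x in distr lebesgue lebesgue (\<lambda>x. B *v x + v). P x"
    using B by (simp add: AE_density)
  then show ?thesis by (rule AE_distrD[rotated]) measurable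
qed

section \<open>The space \<open>L\<^sup>2\<close>\<close>

lemma borel_measurable_cnj [measurable (raw)]:
  "f \<in> borel_measurable M \<Longrightarrow> (\<lambda>x. cnj (f x)) \<in> borel_measurable M"
  by (rule borel_measurable_continuous_on[where f = cnj]) (auto intro: continuous_intros)

text \<open>Kept extended nonnegative, so that it can be estimated before square integrability is known.\<close>

abbreviation sq_integral :: "(real^'n \<Rightarrow> complex) \<Rightarrow> ennreal" where
  "sq_integral f \<equiv> (\<integral>\<^sup>+x. ennreal ((cmod (f x))\<^sup>2) \<partial>lebesgue)"

lemma L2D:
  assumes "f \<in> L2"
  shows L2_measurable: "f \<in> borel_measurable lebesgue"
    and L2_integrable: "integrable lebesgue (\<lambda>x. (cmod (f x))\<^sup>2)"
  using assms by (auto simp: L2_def)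

lemma L2I_nn:
  assumes [measurable]: "f \<in> borel_measurable lebesgue"
    and fin: "sq_integral f < \<infinity>"
  shows "f \<in> L2"
  using fin by (auto simp: L2_def integrable_iff_bounded)

lemma L2_bound:
  assumes [measurable]: "f \<in> borel_measurable lebesgue" and g: "g \<in> L2"
    and le: "AE x in lebesgue. cmod (f x) \<le> c * cmod (g x)"
  shows "f \<in> L2"
proof -
  have "integrable lebesgue (\<lambda>x. c\<^sup>2 * (cmod (g x))\<^sup>2)"
    using L2_integrable[OF g] by auto
  then have "integrable lebesgue (\<lambda>x. (cmod (f x))\<^sup>2)"
    by (rule Bochner_Integration.integrable_bound)
       (use le in \<open>auto elim!: eventually_mono intro: power_mono simp flip: power_mult_distrib\<close>)
  then show ?thesis by (simp add: L2_def)
qed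

lemma norm_add_square_le: "(norm (a + b :: 'a::real_normed_vector))\<^sup>2 \<le> 2 * (norm a)\<^sup>2 + 2 * (norm b)\<^sup>2"
proof -
  have "(norm (a + b))\<^sup>2 \<le> (norm a + norm b)\<^sup>2"
    by (intro power_mono norm_triangle_ineq norm_ge_zero)
  also have "\<dots> \<le> 2 * (norm a)\<^sup>2 + 2 * (norm b)\<^sup>2"
    using sum_squares_bound[of "norm a" "norm b"] by (simp add: power2_sum)
  finally show ?thesis .
qed

lemma L2_add:
  assumes f: "f \<in> L2" and g: "g \<in> L2"
  shows "(\<lambda>x. f x + g x) \<in> L2"
proof -
  note [measurable] = L2_measurable[OF f] L2_measurable[OF g]
  have "integrable lebesgue (\<lambda>x. 2 * (cmod (f x))\<^sup>2 + 2 * (cmod (g x))\<^sup>2)"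
    using L2_integrable[OF f] L2_integrable[OF g] by auto
  then have "integrable lebesgue (\<lambda>x. (cmod (f x + g x))\<^sup>2)"
    by (rule Bochner_Integration.integrable_bound) (auto simp: norm_add_square_le)
  then show ?thesis by (simp add: L2_def)
qed

lemma L2_cmult: "f \<in> L2 \<Longrightarrow> (\<lambda>x. c * f x) \<in> L2"
  by (rule L2_bound[of _ f "cmod c"]) (auto simp: norm_mult L2_def)

lemma L2_diff: "f \<in> L2 \<Longrightarrow> g \<in> L2 \<Longrightarrow> (\<lambda>x. f x - g x) \<in> L2"
  using L2_add[of f "\<lambda>x. - 1 * g x"] L2_cmult[of g "- 1"] by simp

lemma L2_mult_indicator:
  "f \<in> L2 \<Longrightarrow> S \<in> sets lebesgue \<Longrightarrow> (\<lambda>x. indicator S x * f x) \<in> L2"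
  by (rule L2_bound[of _ f 1]) (auto simp: L2_def indicator_def)

lemma L2_prod_integrable:
  assumes f: "f \<in> L2" and g: "g \<in> L2"
  shows "integrable lebesgue (\<lambda>x. cmod (f x) * cmod (g x))"
proof -
  note [measurable] = L2_measurable[OF f] L2_measurable[OF g]
  have "integrable lebesgue (\<lambda>x. (cmod (f x))\<^sup>2 + (cmod (g x))\<^sup>2)"
    using L2_integrable[OF f] L2_integrable[OF g] by auto
  then show ?thesis
  proof (rule Bochner_Integration.integrable_bound)
    have "a * b \<le> a\<^sup>2 + b\<^sup>2" if "0 \<le> a" "0 \<le> b" for a b :: real
      using sum_squares_bound[of a b] mult_nonneg_nonneg[OF that] by linarith
    then show "AE x in lebesgue. norm (cmod (f x) * cmod (g x)) \<le> norm ((cmod (f x))\<^sup>2 + (cmod (g x))\<^sup>2)"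
      by auto
  qed measurable
qed

lemma L2_inner_integrable:
  assumes f: "f \<in> L2" and g: "g \<in> L2"
  shows "integrable lebesgue (\<lambda>x. f x * cnj (g x))"
proof -
  note [measurable] = L2_measurable[OF f] L2_measurable[OF g]
  show ?thesis
    by (rule Bochner_Integration.integrable_bound[OF L2_prod_integrable[OF f g]]) (auto simp: norm_mult)
qed

lemma L2_inner_diff: "f \<in> L2 \<Longrightarrow> g \<in> L2 \<Longrightarrow> h \<in> L2 \<Longrightarrow>
    L2_inner (\<lambda>x. f x - g x) h = L2_inner f h - L2_inner g h"
  by (simp add: L2_inner_def left_diff_distrib L2_inner_integrable)

lemma L2_inner_cmult: "L2_inner (\<lambda>x. c * f x) h = c * L2_inner f h"
  by (simp add: L2_inner_def mult.assoc)

lemma L2_inner_cnj: "L2_inner g f = cnj (L2_inner f g)"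
  unfolding L2_inner_def by (subst Bochner_Integration.integral_cnj[symmetric]) (simp add: mult.commute)

lemma L2_norm_square: "(L2_norm f)\<^sup>2 = (LINT x|lebesgue. (cmod (f x))\<^sup>2)"
  by (simp add: L2_norm_def)

lemma L2_norm_nonneg [simp]: "0 \<le> L2_norm f"
  by (simp add: L2_norm_def)

lemma L2_inner_self: "L2_inner f f = complex_of_real ((L2_norm f)\<^sup>2)"
proof -
  have "L2_inner f f = (LINT x|lebesgue. complex_of_real ((cmod (f x))\<^sup>2))"
    by (simp add: L2_inner_def complex_norm_square del: of_real_power)
  then show ?thesis by (simp only: integral_complex_of_real L2_norm_square)
qed

lemma nn_integral_L2:
  assumes "f \<in> L2"
  shows "sq_integral f = ennreal ((L2_norm f)\<^sup>2)"
  using L2_integrable[OF assms] by (simp add: nn_integral_eq_integral L2_norm_square)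

lemma L2_norm_cmult: "L2_norm (\<lambda>x. c * f x) = cmod c * L2_norm f"
  by (simp add: L2_norm_def norm_mult power_mult_distrib real_sqrt_mult)

lemma L2_norm_square_add:
  assumes f: "f \<in> L2" and g: "g \<in> L2"
  shows "(L2_norm (\<lambda>x. f x + g x))\<^sup>2 = (L2_norm f)\<^sup>2 + (L2_norm g)\<^sup>2 + 2 * Re (L2_inner f g)"
proof -
  have "(cmod (a + b))\<^sup>2 = (cmod a)\<^sup>2 + (cmod b)\<^sup>2 + 2 * Re (a * cnj b)" for a b
    by (simp only: cmod_power2) (simp add: power2_sum algebra_simps)
  then have "(L2_norm (\<lambda>x. f x + g x))\<^sup>2 =
      (LINT x|lebesgue. (cmod (f x))\<^sup>2 + (cmod (g x))\<^sup>2 + 2 * Re (f x * cnj (g x)))"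
    by (simp only: L2_norm_square)
  also have "\<dots> = (L2_norm f)\<^sup>2 + (L2_norm g)\<^sup>2 + 2 * Re (L2_inner f g)"
    using L2_integrable[OF f] L2_integrable[OF g] L2_inner_integrable[OF f g]
    by (simp add: L2_norm_square L2_inner_def integral_Re del: times_complex.sel)
  finally show ?thesis .
qed

lemma L2_norm_square_diff:
  assumes f: "f \<in> L2" and g: "g \<in> L2"
  shows "(L2_norm (\<lambda>x. f x - g x))\<^sup>2 = (L2_norm f)\<^sup>2 + (L2_norm g)\<^sup>2 - 2 * Re (L2_inner f g)"
  using L2_norm_square_add[OF f L2_cmult[OF g, of "-1"]] L2_inner_cmult[of "-1" g f] 
    L2_norm_cmult[of "-1" g]
  by (simp add: L2_inner_cnj[of f])

text \<open>
  The quadratic \<open>\<integral> (t \<bar>f\<bar> - \<bar>g\<bar>)\<^sup>2\<close> in \<open>t\<close> is nonnegative; its minimum gives the bound.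
\<close>

lemma L2_Cauchy_Schwarz:
  assumes f: "f \<in> L2" and g: "g \<in> L2"
  shows "cmod (L2_inner f g) \<le> L2_norm f * L2_norm g"
proof -
  define a where "a = (L2_norm f)\<^sup>2"
  define c where "c = (L2_norm g)\<^sup>2"
  define b where "b = (LINT x|lebesgue. cmod (f x) * cmod (g x))"
  have q: "0 \<le> a * t\<^sup>2 - 2 * b * t + c" for t
  proof -
    have "0 \<le> (LINT x|lebesgue. (t * cmod (f x) - cmod (g x))\<^sup>2)" by simp
    also have "\<dots> = (LINT x|lebesgue. t\<^sup>2 * (cmod (f x))\<^sup>2 + (cmod (g x))\<^sup>2 - 2 * t * (cmod (f x) * cmod (g x)))"
      by (intro Bochner_Integration.integral_cong) (auto simp: power2_eq_square algebra_simps)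
    also have "\<dots> = a * t\<^sup>2 - 2 * b * t + c"
      using L2_integrable[OF f] L2_integrable[OF g] L2_prod_integrable[OF f g]
      by (simp add: a_def b_def c_def L2_norm_square)
    finally show ?thesis .
  qed
  have "b\<^sup>2 \<le> a * c"
  proof (cases "a = 0")
    case True
    have "b = 0"
    proof (rule ccontr)
      assume "b \<noteq> 0"
      then show False using q[of "(c + 1) / (2 * b)"] True by (simp add: field_simps)
    qed
    then show ?thesis using True by simp
  next
    case False
    then have "a > 0" by (simp add: a_def less_le)
    then show ?thesis using q[of "b / a"] by (simp add: power2_eq_square field_simps)
  qed
  moreover have "cmod (L2_inner f g) \<le> b"
    unfolding L2_inner_def b_def
    using integral_norm_bound[of lebesgue "\<lambda>x. f x * cnj (g x)"] by (simp add: norm_mult)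
  ultimately have "(cmod (L2_inner f g))\<^sup>2 \<le> (L2_norm f * L2_norm g)\<^sup>2"
    unfolding a_def c_def power_mult_distrib by (meson norm_ge_zero order_trans power_mono)
  then show ?thesis by (rule power2_le_imp_le) simp
qed

lemma L2_norm_triangle:
  assumes f: "f \<in> L2" and g: "g \<in> L2"
  shows "L2_norm (\<lambda>x. f x + g x) \<le> L2_norm f + L2_norm g"
proof (rule power2_le_imp_le)
  have "Re (L2_inner f g) \<le> L2_norm f * L2_norm g"
    using L2_Cauchy_Schwarz[OF f g] complex_Re_le_cmod order_trans by blast
  then show "(L2_norm (\<lambda>x. f x + g x))\<^sup>2 \<le> (L2_norm f + L2_norm g)\<^sup>2"
    unfolding L2_norm_square_add[OF f g] by (simp add: power2_sum)
qed simp

lemma L2_norm_diff_le: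
  assumes f: "f \<in> L2" and g: "g \<in> L2"
  shows "\<bar>L2_norm f - L2_norm g\<bar> \<le> L2_norm (\<lambda>x. f x - g x)"
proof -
  have "L2_norm f \<le> L2_norm (\<lambda>x. f x - g x) + L2_norm g"
    using L2_norm_triangle[OF L2_diff[OF f g] g] by simp
  moreover have "L2_norm g \<le> L2_norm (\<lambda>x. f x - g x) + L2_norm f"
    using L2_norm_triangle[OF L2_diff[OF g f] f] L2_norm_cmult[of "-1" "\<lambda>x. f x - g x"] by simp
  ultimately show ?thesis by linarith
qed

lemma L2_tendsto_norm_diff:
  assumes F: "\<And>m. F m \<in> L2" and f: "f \<in> L2" and lim: "L2_tendsto F f"
  shows "(\<lambda>m. L2_norm (\<lambda>x. F m x - f x)) \<longlonglongrightarrow> 0"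
proof -
  have "(\<lambda>m. ennreal ((L2_norm (\<lambda>x. F m x - f x))\<^sup>2)) \<longlonglongrightarrow> ennreal 0"
    using lim unfolding L2_tendsto_def by (simp add: nn_integral_L2 L2_diff F f)
  then have "(\<lambda>m. (L2_norm (\<lambda>x. F m x - f x))\<^sup>2) \<longlonglongrightarrow> 0"
    by (subst (asm) tendsto_ennreal_iff) auto
  then have "(\<lambda>m. sqrt ((L2_norm (\<lambda>x. F m x - f x))\<^sup>2)) \<longlonglongrightarrow> sqrt 0"
    by (rule tendsto_real_sqrt)
  then show ?thesis by simp
qed

lemma L2_tendsto_norm:
  assumes F: "\<And>m. F m \<in> L2" and f: "f \<in> L2" and lim: "L2_tendsto F f"
  shows "(\<lambda>m. L2_norm (F m)) \<longlonglongrightarrow> L2_norm f"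
proof (rule LIM_zero_cancel, rule Lim_null_comparison[OF _ L2_tendsto_norm_diff[OF assms]])
  show "\<forall>\<^sub>F m in sequentially. norm (L2_norm (F m) - L2_norm f) \<le> L2_norm (\<lambda>x. F m x - f x)"
    using L2_norm_diff_le[OF F f] by auto
qed

lemma L2_tendsto_inner:
  assumes F: "\<And>m. F m \<in> L2" and f: "f \<in> L2" and lim: "L2_tendsto F f" and h: "h \<in> L2"
  shows "(\<lambda>m. L2_inner (F m) h) \<longlonglongrightarrow> L2_inner f h"
proof (rule LIM_zero_cancel, rule Lim_null_comparison)
  show "\<forall>\<^sub>F m in sequentially. norm (L2_inner (F m) h - L2_inner f h) \<le> L2_norm (\<lambda>x. F m x - f x) * L2_norm h"
    using L2_Cauchy_Schwarz[OF L2_diff[OF F f] h] by (simp add: L2_inner_diff F f h)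
  show "(\<lambda>m. L2_norm (\<lambda>x. F m x - f x) * L2_norm h) \<longlonglongrightarrow> 0"
    using tendsto_mult_right[OF L2_tendsto_norm_diff[OF F f lim], of "L2_norm h"] by simp
qed

lemma L2_tendsto_dominated:
  fixes F :: "nat \<Rightarrow> real^'n \<Rightarrow> complex"
  assumes F[measurable]: "\<And>m. F m \<in> borel_measurable lebesgue" and f[measurable]: "f \<in> borel_measurable lebesgue"
    and g: "g \<in> L2"
    and conv: "AE x in lebesgue. (\<lambda>m. F m x) \<longlonglongrightarrow> f x"
    and bound: "\<And>m. AE x in lebesgue. cmod (F m x - f x) \<le> c * cmod (g x)"
  shows "L2_tendsto F f"
proof -
  note [measurable] = L2_measurable[OF g]
  have "(\<lambda>m. \<integral>\<^sup>+x. ennreal ((cmod (F m x - f x))\<^sup>2) \<partial>lebesgue) \<longlonglongrightarrow> (\<integral>\<^sup>+x. 0 \<partial>(lebesgue :: (real^'n) measure))"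
  proof (rule nn_integral_dominated_convergence[where w = "\<lambda>x. ennreal ((cmod (c * g x))\<^sup>2)"])
    show "sq_integral (\<lambda>x. c * g x) < \<infinity>"
      using nn_integral_L2[OF L2_cmult[OF g, of c]] by simp
    show "AE x in lebesgue. ennreal ((cmod (F m x - f x))\<^sup>2) \<le> ennreal ((cmod (c * g x))\<^sup>2)" for m
      using bound[of m]
    proof eventually_elim
      case (elim x)
      then have "cmod (F m x - f x) \<le> cmod (c * g x)"
        by (simp add: norm_mult) (meson abs_ge_self mult_right_mono norm_ge_zero order_trans)
      then show ?case by (intro ennreal_leI power_mono) auto
    qed
    show "AE x in lebesgue. (\<lambda>m. ennreal ((cmod (F m x - f x))\<^sup>2)) \<longlonglongrightarrow> 0"
      using conv
    proof eventually_elim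
      case (elim x)
      then have "(\<lambda>m. (cmod (F m x - f x))\<^sup>2) \<longlonglongrightarrow> (cmod (f x - f x))\<^sup>2"
        by (intro tendsto_intros)
      then show ?case using tendsto_ennrealI by fastforce
    qed
  qed measurable
  then show ?thesis by (simp add: L2_tendsto_def)
qed

section \<open>Lattice tilings and folding into the torus\<close>

definition cube :: "real \<Rightarrow> (real^'n) set" where
  "cube c = {x. \<forall>i. 0 \<le> x $ i \<and> x $ i < c}"

definition cell :: "real \<Rightarrow> real^'n \<Rightarrow> real^'n" where
  "cell c x = (\<chi> i. of_int \<lfloor>x $ i / c\<rfloor>)"

lemma cell_lattice [simp]: "cell c x \<in> int_lattice"
  by (simp add: cell_def int_lattice_def)

lemma lattice_diff: "k \<in> int_lattice \<Longrightarrow> l \<in> int_lattice \<Longrightarrow> k - l \<in> int_lattice"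
  and lattice_add: "k \<in> int_lattice \<Longrightarrow> l \<in> int_lattice \<Longrightarrow> k + l \<in> int_lattice"
  and lattice_minus: "k \<in> int_lattice \<Longrightarrow> - k \<in> int_lattice"
  and lattice_zero [simp]: "0 \<in> int_lattice"
  by (simp_all add: int_lattice_def)

text \<open>
  The translates of a half-open cube tile space: the floors of the coordinates pick out the only
  translate that contains a given point.
\<close>

lemma mem_cube_shift_iff:
  assumes c: "c > 0" and k: "k \<in> int_lattice"
  shows "x - c *\<^sub>R k \<in> cube c \<longleftrightarrow> k = cell c x"
proof -
  have "(0 \<le> x $ i - c * k $ i \<and> x $ i - c * k $ i < c) \<longleftrightarrow> k $ i = of_int \<lfloor>x $ i / c\<rfloor>" for i
  proof -
    obtain z where z: "k $ i = of_int z" using k by (auto simp: int_lattice_def elim: Ints_cases)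
    have "(0 \<le> x $ i - c * k $ i \<and> x $ i - c * k $ i < c) \<longleftrightarrow> of_int z \<le> x $ i / c \<and> x $ i / c < of_int z + 1"
      using c by (auto simp: z field_simps)
    also have "\<dots> \<longleftrightarrow> \<lfloor>x $ i / c\<rfloor> = z" by (simp add: floor_eq_iff)
    finally show ?thesis by (auto simp: z)
  qed
  then show ?thesis by (simp add: cube_def cell_def vec_eq_iff)
qed

lemma cell_add: "c > 0 \<Longrightarrow> k \<in> int_lattice \<Longrightarrow> cell c (x + c *\<^sub>R k) = cell c x + k"
  using mem_cube_shift_iff[of c "cell c x + k" "x + c *\<^sub>R k"] mem_cube_shift_iff[of c "cell c x" x]
  by (simp add: lattice_add scaleR_add_right)

lemma countable_lattice: "countable (int_lattice :: (real^'n) set)"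
proof -
  have "int_lattice \<subseteq> range (\<lambda>f :: 'n \<Rightarrow> int. \<chi> i. real_of_int (f i))"
  proof
    fix k :: "real^'n" assume "k \<in> int_lattice"
    then have "k = (\<chi> i. real_of_int (\<lfloor>k $ i\<rfloor>))" by (simp add: int_lattice_def vec_eq_iff)
    then show "k \<in> range (\<lambda>f :: 'n \<Rightarrow> int. \<chi> i. real_of_int (f i))" by (metis rangeI)
  qed
  then show ?thesis by (rule countable_subset) auto
qed

lemma infinite_lattice: "infinite (int_lattice :: (real^'n) set)"
proof
  assume "finite (int_lattice :: (real^'n) set)"
  moreover have "range (\<lambda>m::nat. vec (real m) :: real^'n) \<subseteq> int_lattice"
    by (auto simp: int_lattice_def)
  ultimately have "finite (range (\<lambda>m::nat. vec (real m) :: real^'n))" by (rule finite_subset[rotated])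
  moreover have "inj (\<lambda>m::nat. vec (real m) :: real^'n)" by (auto simp: inj_def vec_eq_iff)
  ultimately show False using finite_imageD by auto
qed

lemma cube_borel [measurable]: "cube c \<in> sets borel"
proof -
  have "cube c = (\<Inter>i. {x. 0 \<le> x $ i \<and> x $ i < c})" by (auto simp: cube_def)
  also have "\<dots> \<in> sets borel" by (intro sets.countable_INT' ) auto
  finally show ?thesis .
qed

lemma cube_lebesgue [measurable]: "cube c \<in> sets lebesgue"
  by (simp add: sets_completionI_sets)

lemma cube_subset: "cube c \<subseteq> cbox 0 (vec c)"
  by (auto simp: cube_def mem_box_cart less_imp_le)

lemma box_subset_cube: "box 0 (vec c) \<subseteq> cube c"
  by (auto simp: cube_def mem_box_cart less_imp_le)

lemma emeasure_cube:
  assumes "c \<ge> 0"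
  shows "emeasure lebesgue (cube c :: (real^'n) set) = ennreal (c ^ CARD('n))"
proof (rule antisym)
  have p: "(\<Prod>b\<in>Basis. (vec c - 0 :: real^'n) \<bullet> b) = c ^ CARD('n)"
  proof -
    have "(\<Prod>b\<in>Basis. (vec c - 0 :: real^'n) \<bullet> b) = (\<Prod>b\<in>(Basis :: (real^'n) set). c)"
      by (intro prod.cong) (auto simp: Basis_vec_def inner_axis)
    then show ?thesis by (simp only: DIM_cart DIM_real mult_1_right prod_constant)
  qed
  have le: "b \<in> Basis \<Longrightarrow> 0 \<bullet> b \<le> vec c \<bullet> b" for b :: "real^'n"
    using assms by (auto simp: Basis_vec_def inner_axis)
  have "emeasure lebesgue (cube c :: (real^'n) set) \<le> emeasure lebesgue (cbox 0 (vec c :: real^'n))"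
    by (intro emeasure_mono cube_subset) auto
  also have "\<dots> = ennreal (c ^ CARD('n))" using le p by (simp add: emeasure_lborel_cbox_eq)
  finally show "emeasure lebesgue (cube c :: (real^'n) set) \<le> ennreal (c ^ CARD('n))" .
  have "ennreal (c ^ CARD('n)) = emeasure lebesgue (box 0 (vec c :: real^'n))"
    using le p by (simp add: emeasure_lborel_box_eq)
  also have "\<dots> \<le> emeasure lebesgue (cube c :: (real^'n) set)"
    by (intro emeasure_mono box_subset_cube) auto
  finally show "ennreal (c ^ CARD('n)) \<le> emeasure lebesgue (cube c :: (real^'n) set)" .
qed

lemma measurable_lebesgue_shift:
  fixes f :: "real^'n \<Rightarrow> _"
  assumes "f \<in> measurable lebesgue N"
  shows "(\<lambda>x. f (x + v)) \<in> measurable lebesgue N" "(\<lambda>x. f (x - v)) \<in> measurable lebesgue N"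
  using measurable_lebesgue_affine[of "mat 1 :: real^'n^'n" f N v]
    measurable_lebesgue_affine[of "mat 1 :: real^'n^'n" f N "- v"] assms by simp_all

lemma nn_integral_lebesgue_shift:
  fixes f :: "real^'n \<Rightarrow> _"
  assumes "f \<in> borel_measurable lebesgue"
  shows "(\<integral>\<^sup>+x. f (x + v) \<partial>lebesgue) = (\<integral>\<^sup>+x. f x \<partial>lebesgue)"
  using nn_integral_lebesgue_affine[of "mat 1 :: real^'n^'n" f v] assms by simp

lemma integral_lebesgue_shift:
  fixes f :: "real^'n \<Rightarrow> 'b::{banach, second_countable_topology}"
  assumes "f \<in> borel_measurable lebesgue"
  shows "(LINT x|lebesgue. f (x + v)) = (LINT x|lebesgue. f x)"
  using integral_lebesgue_affine[of "mat 1 :: real^'n^'n" f v] assms by simp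

lemma nn_integral_lattice_tiling:
  fixes u :: "real^'n \<Rightarrow> ennreal"
  assumes c: "c > 0" and [measurable]: "u \<in> borel_measurable lebesgue"
  shows "(\<integral>\<^sup>+x. u x \<partial>lebesgue) =
    (\<integral>\<^sup>+x. (\<integral>\<^sup>+k. u (x + c *\<^sub>R k) \<partial>count_space int_lattice) * indicator (cube c) x \<partial>lebesgue)"
proof -
  have m1: "(\<lambda>x. u x * indicator (cube c) (x - c *\<^sub>R k)) \<in> borel_measurable lebesgue" for k
    by (intro borel_measurable_times_ennreal assms measurable_lebesgue_shift(2)) simp
  have m2: "(\<lambda>x. u (x + c *\<^sub>R k) * indicator (cube c) x) \<in> borel_measurable lebesgue" for k
    by (intro borel_measurable_times_ennreal assms measurable_lebesgue_shift(1)) simp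
  have "(\<integral>\<^sup>+x. u x \<partial>lebesgue) =
      (\<integral>\<^sup>+x. (\<integral>\<^sup>+k. u x * indicator (cube c) (x - c *\<^sub>R k) \<partial>count_space int_lattice) \<partial>lebesgue)"
  proof (intro nn_integral_cong)
    fix x :: "real^'n"
    have "(\<integral>\<^sup>+k. u x * indicator (cube c) (x - c *\<^sub>R k) \<partial>count_space int_lattice)
        = (\<Sum>k\<in>{cell c x}. u x * indicator (cube c) (x - c *\<^sub>R k))"
      by (rule nn_integral_count_space') (auto simp: mem_cube_shift_iff[OF c])
    also have "\<dots> = u x" using mem_cube_shift_iff[OF c cell_lattice[of c x], of x] by simp
    finally show "u x = (\<integral>\<^sup>+k. u x * indicator (cube c) (x - c *\<^sub>R k) \<partial>count_space int_lattice)" by simp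
  qed
  also have "\<dots> = (\<integral>\<^sup>+k. (\<integral>\<^sup>+x. u x * indicator (cube c) (x - c *\<^sub>R k) \<partial>lebesgue) \<partial>count_space int_lattice)"
    by (rule nn_integral_count_space_nn_integral[OF countable_lattice]) (rule m1)
  also have "\<dots> = (\<integral>\<^sup>+k. (\<integral>\<^sup>+x. u (x + c *\<^sub>R k) * indicator (cube c) x \<partial>lebesgue) \<partial>count_space int_lattice)"
  proof (rule nn_integral_cong)
    fix k :: "real^'n"
    show "(\<integral>\<^sup>+x. u x * indicator (cube c) (x - c *\<^sub>R k) \<partial>lebesgue) =
        (\<integral>\<^sup>+x. u (x + c *\<^sub>R k) * indicator (cube c) x \<partial>lebesgue)"
      using nn_integral_lebesgue_shift[OF m1[of k], of "c *\<^sub>R k"] by simp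
  qed
  also have "\<dots> = (\<integral>\<^sup>+x. (\<integral>\<^sup>+k. u (x + c *\<^sub>R k) * indicator (cube c) x \<partial>count_space int_lattice) \<partial>lebesgue)"
    by (rule nn_integral_count_space_nn_integral[OF countable_lattice, symmetric]) (rule m2)
  also have "\<dots> = (\<integral>\<^sup>+x. (\<integral>\<^sup>+k. u (x + c *\<^sub>R k) \<partial>count_space int_lattice) * indicator (cube c) x \<partial>lebesgue)"
    by (intro nn_integral_cong) (auto simp: nn_integral_multc)
  finally show ?thesis .
qed

text \<open>
  An enumeration of the lattice: sums over it become series, which commute with Bochner integrals.
\<close>

definition lat :: "nat \<Rightarrow> real^'n" where "lat = from_nat_into int_lattice"

lemma bij_lat: "bij_betw lat UNIV int_lattice"
  unfolding lat_def by (rule bij_betw_from_nat_into[OF countable_lattice infinite_lattice])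

lemma lat_in [simp]: "lat m \<in> int_lattice"
  using bij_lat bij_betwE by blast

lemma nn_integral_lat: "(\<integral>\<^sup>+k. f k \<partial>count_space int_lattice) = (\<Sum>m. f (lat m))"
  using nn_integral_bij_count_space[OF bij_lat, of f] by (simp add: nn_integral_count_space_nat)

text \<open>
  Folding into the torus. The series has at most one nonzero term at each point when the support is
  translation free, so that its convergence is no issue there.
\<close>

definition periodize :: "(real^'n \<Rightarrow> complex) \<Rightarrow> real^'n \<Rightarrow> complex" where
  "periodize u x = (\<Sum>m. indicator (cube (2*pi)) x * u (x + (2*pi) *\<^sub>R lat m))"

lemma measurable_periodize [measurable]:
  assumes [measurable]: "u \<in> borel_measurable lebesgue"
  shows "periodize u \<in> borel_measurable lebesgue"
proof -
  note [measurable] = measurable_lebesgue_shift(1)[OF assms]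
  have "(\<lambda>x. \<Sum>m. indicator (cube (2*pi)) x * u (x + (2*pi) *\<^sub>R lat m)) \<in> borel_measurable lebesgue"
    by measurable
  then show ?thesis by (simp add: periodize_def[abs_def])
qed

lemma translation_free_single:
  fixes u :: "real^'n \<Rightarrow> complex"
  assumes E: "translation_free E" and off: "\<And>x. x \<notin> E \<Longrightarrow> u x = 0"
  obtains m0 where "\<And>m. m \<noteq> m0 \<Longrightarrow> u (x + (2*pi) *\<^sub>R lat m) = 0"
proof (cases "\<exists>m. u (x + (2*pi) *\<^sub>R lat m) \<noteq> 0")
  case True
  then obtain m0 where m0: "u (x + (2*pi) *\<^sub>R lat m0) \<noteq> 0" by auto
  have "u (x + (2*pi) *\<^sub>R lat m) = 0" if "m \<noteq> m0" for m
  proof (rule ccontr)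
    assume "u (x + (2*pi) *\<^sub>R lat m) \<noteq> 0"
    then have "x + (2*pi) *\<^sub>R lat m \<in> E" "x + (2*pi) *\<^sub>R lat m0 \<in> E" using m0 off by auto
    moreover have "lat m - lat m0 \<in> int_lattice - {0 :: real^'n}"
      using that bij_lat by (auto simp: lattice_diff bij_betw_def dest: injD)
    moreover have "x + (2*pi) *\<^sub>R lat m = (x + (2*pi) *\<^sub>R lat m0) + (2*pi) *\<^sub>R (lat m - lat m0)"
      by (simp add: scaleR_diff_right)
    ultimately show False using E unfolding translation_free_def by metis
  qed
  then show ?thesis using that by blast
qed (use that in auto)

lemma suminf_single: "(\<And>m. m \<noteq> m0 \<Longrightarrow> f m = 0) \<Longrightarrow> (\<Sum>m. f m) = (f m0 :: 'a::{comm_monoid_add, t2_space})"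
  using suminf_finite[of "{m0}" f] by auto

lemma periodize_norm_square:
  assumes E: "translation_free E" and off: "\<And>x. x \<notin> E \<Longrightarrow> u x = 0"
  shows "ennreal ((cmod (periodize u x))\<^sup>2) =
     (\<integral>\<^sup>+k. ennreal ((cmod (u (x + (2*pi) *\<^sub>R k)))\<^sup>2) \<partial>count_space int_lattice) * indicator (cube (2*pi)) x"
proof -
  obtain m0 where m0: "\<And>m. m \<noteq> m0 \<Longrightarrow> u (x + (2*pi) *\<^sub>R lat m) = 0"
    using translation_free_single[of E u, OF E off] by blast
  have "periodize u x = indicator (cube (2*pi)) x * u (x + (2*pi) *\<^sub>R lat m0)"
    unfolding periodize_def by (rule suminf_single) (simp add: m0)
  moreover have "(\<Sum>m. ennreal ((cmod (u (x + (2*pi) *\<^sub>R lat m)))\<^sup>2)) = ennreal ((cmod (u (x + (2*pi) *\<^sub>R lat m0)))\<^sup>2)"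
    by (rule suminf_single) (simp add: m0)
  ultimately show ?thesis by (auto simp: nn_integral_lat indicator_def)
qed

text \<open>
  The part of \<open>u\<close> in each cell and its translate into the torus have the same integral, and
  the norms of all these parts add up to the integrable function \<open>\<bar>u\<bar>\<close>; hence both series
  of functions may be integrated termwise.
\<close>

lemma integral_periodize:
  assumes E: "translation_free E" and off: "\<And>x. x \<notin> E \<Longrightarrow> u x = 0"
    and u: "integrable lebesgue u"
  shows "(LINT x|lebesgue. periodize u x) = (LINT x|lebesgue. u x)"
proof -
  have [measurable]: "u \<in> borel_measurable lebesgue" using u by auto
  let ?H = "cube (2*pi) :: (real^'a) set"
  define v where "v m x = indicator ?H x * u (x + (2*pi) *\<^sub>R lat m)" for m x
  define w where "w m x = indicator ?H (x - (2*pi) *\<^sub>R lat m) * u x" for m x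
  have [measurable]: "v m \<in> borel_measurable lebesgue" "w m \<in> borel_measurable lebesgue" for m
  proof -
    have "(\<lambda>x. indicator ?H (x - (2*pi) *\<^sub>R lat m) :: complex) \<in> borel_measurable lebesgue"
      by (rule measurable_lebesgue_shift) measurable
    then show "v m \<in> borel_measurable lebesgue" "w m \<in> borel_measurable lebesgue"
      unfolding v_def[abs_def] w_def[abs_def]
      by (auto intro!: borel_measurable_times measurable_lebesgue_shift(1) borel_measurable_indicator)
  qed
  have vw: "v m x = w m (x + (2*pi) *\<^sub>R lat m)" for m x by (simp add: v_def w_def)
  have iw: "integrable lebesgue (w m)" for m
    by (rule Bochner_Integration.integrable_bound[OF u]) (auto simp: w_def indicator_def)
  have iv: "integrable lebesgue (v m)" for m
    using integrable_lebesgue_affine_iff[of "mat 1 :: real^'a^'a" "w m" "(2*pi) *\<^sub>R lat m"] iw[of m]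
    by (simp add: vw[abs_def])
  have eq: "(LINT x|lebesgue. v m x) = (LINT x|lebesgue. w m x)"
    "(LINT x|lebesgue. norm (v m x)) = (LINT x|lebesgue. norm (w m x))" for m
    unfolding vw by (rule integral_lebesgue_shift, measurable)+
  have single: "w m x = 0" if "lat m \<noteq> cell (2*pi) x" for m x
    using mem_cube_shift_iff[of "2*pi" "lat m" x] that by (auto simp: w_def)
  define ix where "ix x = inv_into UNIV lat (cell (2*pi) x)" for x :: "real^'a"
  have inj: "inj (lat :: nat \<Rightarrow> real^'a)" and rng: "range lat = (int_lattice :: (real^'a) set)"
    using bij_lat by (auto simp: bij_betw_def)
  have ix: "lat (ix x) = cell (2*pi) x" for x
    unfolding ix_def by (rule f_inv_into_f) (simp add: rng)
  have single': "w m x = 0" if "m \<noteq> ix x" for m x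
    using single[of m x] that ix[of x] injD[OF inj] by metis
  have wx: "w (ix x) x = u x" for x
    using mem_cube_shift_iff[of "2*pi" "cell (2*pi) x" x] by (simp add: w_def ix)
  have sumw: "(\<Sum>m. w m x) = u x" for x
  proof -
    have "(\<Sum>m. w m x) = w (ix x) x" by (rule suminf_single) (rule single')
    then show ?thesis by (simp only: wx)
  qed
  have sumnw: "(\<Sum>m. ennreal (norm (w m x))) = ennreal (norm (u x))" for x
  proof -
    have "(\<Sum>m. ennreal (norm (w m x))) = ennreal (norm (w (ix x) x))"
      by (rule suminf_single) (simp add: single')
    then show ?thesis by (simp only: wx)
  qed
  have "ennreal (LINT x|lebesgue. norm (w m x)) = (\<integral>\<^sup>+x. ennreal (norm (w m x)) \<partial>lebesgue)" for m
    by (rule nn_integral_eq_integral[symmetric]) (intro integrable_norm iw, simp)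
  then have "(\<Sum>m. ennreal (LINT x|lebesgue. norm (w m x))) = (\<Sum>m. \<integral>\<^sup>+x. ennreal (norm (w m x)) \<partial>lebesgue)"
    by (simp only:)
  also have "\<dots> = (\<integral>\<^sup>+x. (\<Sum>m. ennreal (norm (w m x))) \<partial>lebesgue)"
    by (rule nn_integral_suminf[symmetric]) measurable
  also have "\<dots> < \<infinity>" using u by (simp add: sumnw integrable_iff_bounded)
  finally have "(\<Sum>m. ennreal (LINT x|lebesgue. norm (w m x))) \<noteq> top" by simp
  then have summ: "summable (\<lambda>m. LINT x|lebesgue. norm (w m x))"
    by (intro summable_suminf_not_top) (auto intro: integral_nonneg_AE)
  have sw: "summable (\<lambda>m. norm (w m x))" for x
    by (rule summable_finite[of "{ix x}"]) (auto simp: single')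
  have sv: "summable (\<lambda>m. norm (v m x))" for x
  proof -
    obtain m0 where m0: "\<And>m. m \<noteq> m0 \<Longrightarrow> u (x + (2*pi) *\<^sub>R lat m) = 0"
      using translation_free_single[of E u, OF E off] by blast
    show ?thesis by (rule summable_finite[of "{m0}"]) (auto simp: v_def m0)
  qed
  have "(LINT x|lebesgue. periodize u x) = (LINT x|lebesgue. (\<Sum>m. v m x))"
    by (simp add: periodize_def v_def)
  also have "\<dots> = (\<Sum>m. LINT x|lebesgue. v m x)"
    by (rule integral_suminf) (simp_all only: iv sv eq(2) summ AE_I2)
  also have "\<dots> = (\<Sum>m. LINT x|lebesgue. w m x)" by (simp add: eq)
  also have "\<dots> = (LINT x|lebesgue. (\<Sum>m. w m x))"
    by (rule integral_suminf[symmetric]) (simp_all only: iw sw summ AE_I2)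
  finally show ?thesis by (simp add: sumw)
qed

section \<open>Characters and trigonometric polynomials\<close>

definition wave :: "real^'n \<Rightarrow> real^'n \<Rightarrow> complex" where
  "wave k x = exp (\<i> * complex_of_real (x \<bullet> k))"

lemma norm_wave [simp]: "cmod (wave k x) = 1"
  by (simp add: wave_def)

lemma wave_add: "wave k (x + y) = wave k x * wave k y"
  and wave_add_freq: "wave (k + l) x = wave k x * wave l x"
  and cnj_wave: "cnj (wave k x) = wave (- k) x"
  and wave_minus: "wave k (- x) = wave (- k) x"
  and wave_zero [simp]: "wave 0 x = 1"
  and wave_commute: "wave k x = wave x k"
  by (simp_all add: wave_def exp_add inner_simps ring_distribs exp_cnj inner_commute)

lemma wave_cnj_cancel: "wave k x * cnj (wave k x) = 1"
  by (simp add: complex_norm_square[symmetric])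

lemma measurable_wave [measurable]: "wave k \<in> borel_measurable lebesgue"
  unfolding wave_def[abs_def]
  by (rule borel_measurable_subalgebra[of borel]) 
    (auto intro!: borel_measurable_continuous_onI continuous_intros sets_completionI_sets)

lemma fourier_L1_wave: "fourier_L1 f \<xi> = (LINT x|lebesgue. f x * cnj (wave \<xi> x))"
  by (simp add: fourier_L1_def wave_def exp_cnj)

lemma wave_periodic:
  assumes "k \<in> int_lattice" "l \<in> int_lattice"
  shows "wave k (x + (2*pi) *\<^sub>R l) = wave k x"
proof -
  have "l \<bullet> k \<in> \<int>"
    using assms by (auto simp: inner_vec_def int_lattice_def intro!: Ints_sum Ints_mult)
  then have "exp ((2 * (l \<bullet> k) * pi) * \<i>) = 1" by (rule exp_integer_2pi)
  then have "wave k ((2*pi) *\<^sub>R l) = 1" by (simp add: wave_def mult_ac)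
  then show ?thesis by (simp add: wave_add)
qed

lemma emeasure_lborel_cube:
  "c \<ge> 0 \<Longrightarrow> emeasure lborel (cube c :: (real^'n) set) = ennreal (c ^ CARD('n))"
  using emeasure_cube[of c, where 'n = 'n] by simp

abbreviation torus :: "(real^'n) set" where "torus \<equiv> cube (2*pi)"

lemma indicator_torus_L2: "(\<lambda>x. indicator torus x :: complex) \<in> L2"
proof -
  have "integrable lebesgue (\<lambda>x::real^'a. indicator torus x :: real)"
    by (rule integrable_real_indicator) (auto simp: emeasure_lborel_cube)
  moreover have "(cmod (indicator torus x))\<^sup>2 = indicator torus x" for x :: "real^'a"
    by (simp add: indicator_def)
  ultimately show ?thesis by (simp add: L2_def)
qed

lemma bounded_torus_L2:
  assumes [measurable]: "f \<in> borel_measurable lebesgue" and "\<And>x. cmod (f x) \<le> c"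
  shows "(\<lambda>x. indicator torus x * f x) \<in> L2"
  by (rule L2_bound[OF _ indicator_torus_L2, of _ c]) (use assms in \<open>auto simp: indicator_def\<close>)

definition mode :: "real^'n \<Rightarrow> real^'n \<Rightarrow> complex" where
  "mode k x = indicator torus x * wave k x"

lemma mode_L2: "mode k \<in> L2"
  unfolding mode_def[abs_def] by (rule bounded_torus_L2[of _ 1]) auto

text \<open>
  For \<open>k \<noteq> 0\<close>: moving the torus by \<open>t\<close> multiplies the integral of \<open>wave k\<close> by
  \<open>wave k t\<close>, whereas folding the moved torus back shows that the integral is unchanged. A suitable
  \<open>t\<close> has \<open>wave k t = - 1\<close>.
\<close>

lemma integral_mode:
  fixes k :: "real^'n"
  assumes k: "k \<in> int_lattice"
  shows "(LINT x|lebesgue. mode k x) = (if k = 0 then of_real ((2*pi) ^ CARD('n)) else 0)"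
proof (cases "k = 0")
  case True
  have "(LINT x|lebesgue. mode k x) = (LINT x|lebesgue. indicator (torus :: (real^'n) set) x *\<^sub>R (1::complex))"
    by (intro Bochner_Integration.integral_cong) (auto simp: mode_def True indicator_def)
  also have "\<dots> = (LINT x|lebesgue. indicator (torus :: (real^'n) set) x) *\<^sub>R (1::complex)"
    by (rule integral_scaleR_left) (rule integrable_real_indicator, auto simp: emeasure_lborel_cube)
  also have "\<dots> = of_real (measure lebesgue (torus :: (real^'n) set))"
    by (simp add: scaleR_conv_of_real)
  finally show ?thesis using True by (simp add: measure_def emeasure_lborel_cube)
next
  case False
  then obtain i where i: "k $ i \<noteq> 0" by (auto simp: vec_eq_iff)
  \<comment> \<open>Half a period of \<open>wave k\<close> in a direction in which it is not constant.\<close>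
  define t :: "real^'n" where "t = axis i (pi / k $ i)"
  have tk: "wave k t = -1" using i by (simp add: wave_def t_def inner_axis' )
  define E where "E = {x. x - t \<in> torus}"
  define u where "u x = indicator torus (x - t) * wave k x" for x
  have E: "translation_free E"
    unfolding translation_free_def
  proof safe
    fix x l :: "real^'n" assume x: "x \<in> E" and xl: "x + (2*pi) *\<^sub>R l \<in> E" and l: "l \<in> int_lattice" "l \<notin> {}"
    have "0 = cell (2*pi) (x - t)"
      using x mem_cube_shift_iff[of "2*pi" 0 "x - t"] by (simp add: E_def)
    moreover have "- l = cell (2*pi) (x - t)"
      using xl mem_cube_shift_iff[of "2*pi" "- l" "x - t"] l by (simp add: E_def lattice_minus algebra_simps)
    ultimately show "l = 0" by simp
  qed
  have off: "x \<notin> E \<Longrightarrow> u x = 0" for x by (simp add: u_def E_def)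
  have us: "u x = mode k (x - t) * wave k t" for x
    by (simp add: u_def mode_def mult.assoc flip: wave_add)
  have im: "integrable lebesgue (mode k)"
    using L2_inner_integrable[OF mode_L2[of k] indicator_torus_L2]
    by (rule Bochner_Integration.integrable_cong[THEN iffD1, rotated -1]) (auto simp: mode_def indicator_def)
  then have [measurable]: "mode k \<in> borel_measurable lebesgue" by auto
  have iu: "integrable lebesgue u"
    using integrable_lebesgue_affine_iff[of "mat 1 :: real^'n^'n" "mode k" "- t"] im by (simp add: us[abs_def])
  have "periodize u x = mode k x" for x
  proof -
    obtain m0 where m0: "lat m0 = - cell (2*pi) (x - t)"
      using bij_lat lattice_minus[OF cell_lattice] unfolding bij_betw_def by (metis imageE)
    have *: "(x + (2*pi) *\<^sub>R lat m) - t \<in> torus \<longleftrightarrow> m = m0" for m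
    proof -
      have "(x + (2*pi) *\<^sub>R lat m) - t \<in> torus \<longleftrightarrow> - lat m = cell (2*pi) (x - t)"
        using mem_cube_shift_iff[of "2*pi" "- lat m" "x - t"] by (simp add: lattice_minus algebra_simps)
      also have "\<dots> \<longleftrightarrow> lat m = (lat m0 :: real^'n)" unfolding m0 by (metis minus_minus)
      also have "\<dots> \<longleftrightarrow> m = m0" using bij_lat by (auto simp: bij_betw_def dest: injD)
      finally show ?thesis .
    qed
    have "periodize u x = indicator torus x * u (x + (2*pi) *\<^sub>R lat m0)"
      unfolding periodize_def by (rule suminf_single) (simp add: u_def *)
    then show ?thesis by (simp add: u_def * mode_def wave_periodic[OF k])
  qed
  then have "(LINT x|lebesgue. mode k x) = (LINT x|lebesgue. u x)"
    using integral_periodize[OF E off iu] by (simp cong: Bochner_Integration.integral_cong)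
  also have "\<dots> = (LINT x|lebesgue. mode k (x - t)) * wave k t" by (simp add: us)
  also have "(LINT x|lebesgue. mode k (x - t)) = (LINT x|lebesgue. mode k x)"
    using integral_lebesgue_shift[of "mode k" "- t"] by simp
  finally show ?thesis using False by (simp add: tk)
qed

lemma mode_orthogonal:
  fixes k l :: "real^'n"
  assumes "k \<in> int_lattice" "l \<in> int_lattice"
  shows "L2_inner (mode k) (mode l) = (if k = l then of_real ((2*pi) ^ CARD('n)) else 0)"
proof -
  have "L2_inner (mode k) (mode l) = (LINT x|lebesgue. mode (k - l) x)"
    unfolding L2_inner_def
    by (intro Bochner_Integration.integral_cong)
      (auto simp: mode_def indicator_def cnj_wave simp flip: wave_add_freq)
  then show ?thesis using integral_mode[OF lattice_diff[OF assms]] by auto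
qed

lemma fourier_torus:
  assumes off: "\<And>x. x \<notin> torus \<Longrightarrow> g x = 0"
  shows "fourier_L1 g k = L2_inner g (mode k)"
  unfolding fourier_L1_wave L2_inner_def
  by (intro Bochner_Integration.integral_cong) (auto simp: mode_def indicator_def off)

text \<open>
  Completing the square. With \<open>c k\<close> the Fourier coefficients the last sum vanishes and Bessel's
  inequality results; for other \<open>c\<close> it is nonnegative, so that the approximation error bounds the
  defect in Bessel's inequality.
\<close>

lemma Bessel_identity:
  fixes S :: "(real^'n) set"
  defines "N \<equiv> (2*pi) ^ CARD('n)"
  assumes "finite S" "S \<subseteq> int_lattice" "g \<in> L2"
  shows "(\<lambda>x. g x - (\<Sum>k\<in>S. c k * mode k x)) \<in> L2 \<and>
    (L2_norm (\<lambda>x. g x - (\<Sum>k\<in>S. c k * mode k x)))\<^sup>2 =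
      (L2_norm g)\<^sup>2 - (\<Sum>k\<in>S. (cmod (L2_inner g (mode k)))\<^sup>2) / N
      + N * (\<Sum>k\<in>S. (cmod (c k - L2_inner g (mode k) / N))\<^sup>2)"
  using assms(2-)
proof (induction S arbitrary: g rule: finite_induct)
  case empty
  then show ?case by simp
next
  case (insert l S)
  have N: "N > 0" by (simp add: N_def)
  let ?cm = "\<lambda>x. c l * mode l x"
  define g' where "g' x = g x - ?cm x" for x
  have cm: "?cm \<in> L2" by (intro L2_cmult mode_L2)
  have g': "g' \<in> L2" unfolding g'_def[abs_def] using insert.prems cm by (intro L2_diff) auto
  have l: "l \<in> int_lattice" using insert.prems by auto
  have co: "L2_inner g' (mode k) = L2_inner g (mode k)" if "k \<in> S" for k
  proof -
    have "k \<in> int_lattice" "k \<noteq> l" using that insert by auto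
    then show ?thesis
      unfolding g'_def[abs_def] using insert.prems cm mode_orthogonal[OF l, of k]
      by (subst L2_inner_diff) (auto simp: mode_L2 L2_inner_cmult)
  qed
  define a where "a = L2_inner g (mode l)"
  have mn: "(L2_norm (mode l))\<^sup>2 = N"
  proof -
    have "complex_of_real ((L2_norm (mode l))\<^sup>2) = complex_of_real N"
      by (simp only: L2_inner_self[symmetric] mode_orthogonal[OF l l] N_def simp_thms if_True)
    then show ?thesis by (simp only: of_real_eq_iff)
  qed
  have "(L2_norm g')\<^sup>2 = (L2_norm g)\<^sup>2 + (cmod (c l))\<^sup>2 * N - 2 * Re (cnj (c l) * a)"
    unfolding g'_def[abs_def] L2_norm_square_diff[OF insert.prems(2) cm] L2_norm_cmult power_mult_distrib mn
    by (subst L2_inner_cnj) (simp add: L2_inner_cmult a_def L2_inner_cnj[of "mode l"] del: times_complex.sel)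
  also have "\<dots> = (L2_norm g)\<^sup>2 - (cmod a)\<^sup>2 / N + N * (cmod (c l - a / N))\<^sup>2"
  proof -
    have "N * (cmod (c l - a / N))\<^sup>2 = N * (cmod (c l))\<^sup>2 - 2 * Re (cnj (c l) * a) + (cmod a)\<^sup>2 / N"
      using N unfolding cmod_power2 by (simp add: field_simps power2_eq_square)
    then show ?thesis by simp
  qed
  finally have n: "(L2_norm g')\<^sup>2 = (L2_norm g)\<^sup>2 - (cmod a)\<^sup>2 / N + N * (cmod (c l - a / N))\<^sup>2" .
  have eq: "(\<lambda>x. g x - (\<Sum>k\<in>insert l S. c k * mode k x)) = (\<lambda>x. g' x - (\<Sum>k\<in>S. c k * mode k x))"
    using insert by (auto simp: g'_def)
  have S: "S \<subseteq> int_lattice" using insert.prems by auto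
  have sc: "(\<Sum>k\<in>S. (cmod (L2_inner g' (mode k)))\<^sup>2) = (\<Sum>k\<in>S. (cmod (L2_inner g (mode k)))\<^sup>2)"
    "(\<Sum>k\<in>S. (cmod (c k - L2_inner g' (mode k) / N))\<^sup>2) = (\<Sum>k\<in>S. (cmod (c k - L2_inner g (mode k) / N))\<^sup>2)"
    by (intro sum.cong; simp add: co)+
  show ?case
    using insert.IH[OF S g'] insert.hyps unfolding eq sc n
    by (simp add: a_def add_divide_distrib ring_distribs)
qed

text \<open>
  The span of the characters, presented by its closure properties because these are what the
  approximation argument uses.
\<close>

inductive trig_poly :: "(real^'n \<Rightarrow> complex) \<Rightarrow> bool" where
  wave: "k \<in> int_lattice \<Longrightarrow> trig_poly (\<lambda>x. c * wave k x)"
| add: "trig_poly f \<Longrightarrow> trig_poly g \<Longrightarrow> trig_poly (\<lambda>x. f x + g x)"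

lemma trig_poly_const: "trig_poly (\<lambda>x. c)"
  using trig_poly.wave[of 0 c] by simp

lemma trig_poly_cmult: "trig_poly f \<Longrightarrow> trig_poly (\<lambda>x. c * f x)"
proof (induction rule: trig_poly.induct)
  case (wave k d)
  then show ?case using trig_poly.wave[of k "c * d"] by (simp add: mult.assoc)
qed (simp add: ring_distribs trig_poly.add)

lemma trig_poly_mult: "trig_poly f \<Longrightarrow> trig_poly g \<Longrightarrow> trig_poly (\<lambda>x. f x * g x)"
proof (induction rule: trig_poly.induct)
  case (wave k c)
  have "trig_poly (\<lambda>x. (c * wave k x) * g x)" if "trig_poly g" for g
    using that
  proof (induction rule: trig_poly.induct)
    case (wave l d)
    then show ?case using trig_poly.wave[of "k + l" "c * d"] \<open>k \<in> int_lattice\<close>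
      by (simp add: lattice_add wave_add_freq mult_ac)
  qed (simp add: ring_distribs trig_poly.add)
  then show ?case using wave by blast
qed (simp add: ring_distribs trig_poly.add)

lemma trig_poly_sum: "finite S \<Longrightarrow> (\<And>i. i \<in> S \<Longrightarrow> trig_poly (f i)) \<Longrightarrow> trig_poly (\<lambda>x. \<Sum>i\<in>S. f i x)"
  by (induction S rule: finite_induct) (auto intro: trig_poly_const[of 0] trig_poly.add)

lemma trig_poly_cos: "trig_poly (\<lambda>x. complex_of_real (cos (x $ i - m)))"
proof -
  have k: "axis i 1 \<in> int_lattice" by (auto simp: int_lattice_def axis_def)
  have eq: "complex_of_real (cos (x $ i - m)) =
      (exp (- (\<i> * of_real m)) / 2) * wave (axis i 1) x + (exp (\<i> * of_real m) / 2) * wave (- axis i 1) x" for x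
    unfolding cos_of_real[symmetric] cos_exp_eq
    by (simp add: wave_def inner_axis exp_diff exp_minus ring_distribs field_simps)
  show ?thesis
    unfolding eq by (intro trig_poly.add trig_poly.wave k lattice_minus)
qed

lemma trig_poly_real_polynomial:
  assumes "real_polynomial_function p"
  shows "trig_poly (\<lambda>x. complex_of_real (p (\<chi> i. cos (x $ i - m $ i))))"
  using assms
proof (induction rule: real_polynomial_function.induct)
  case (linear f)
  have fy: "f y = (\<Sum>i\<in>UNIV. f (axis i 1) * y $ i)" for y
  proof -
    interpret f: bounded_linear f by fact
    have "f y = f (\<Sum>i\<in>UNIV. y $ i *\<^sub>R axis i 1)"
      using basis_expansion[of y] by (simp add: scalar_mult_eq_scaleR)
    then show ?thesis by (simp add: f.sum f.scaleR mult.commute)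
  qed
  have "complex_of_real (f (\<chi> i. cos (x $ i - m $ i))) =
     (\<Sum>i\<in>UNIV. complex_of_real (f (axis i 1)) * complex_of_real (cos (x $ i - m $ i)))" for x
    by (subst fy) simp
  then show ?case by (simp only:) (intro trig_poly_sum trig_poly_cmult trig_poly_cos finite)
qed (auto intro: trig_poly_const trig_poly.add trig_poly_mult)

lemma trig_poly_sum_modes:
  assumes "trig_poly t"
  shows "\<exists>S c. finite S \<and> S \<subseteq> int_lattice \<and>
     (\<forall>x. indicator torus x * t x = (\<Sum>k\<in>S. c k * mode k x))"
  using assms
proof (induction rule: trig_poly.induct)
  case (wave k c)
  then show ?case by (intro exI[of _ "{k}"] exI[of _ "\<lambda>_. c"]) (auto simp: mode_def)
next
  case (add f g)
  from add.IH(1) obtain S c where S1: "finite S" "S \<subseteq> int_lattice"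
    and e1: "\<And>x. indicator torus x * f x = (\<Sum>k\<in>S. c k * mode k x)" by blast
  from add.IH(2) obtain T d where S2: "finite T" "T \<subseteq> int_lattice"
    and e2: "\<And>x. indicator torus x * g x = (\<Sum>k\<in>T. d k * mode k x)" by blast
  note S = S1 S2 and eq = e1 e2
  define c' where "c' k = (if k \<in> S then c k else 0) + (if k \<in> T then d k else 0)" for k
  have "indicator torus x * (f x + g x) = (\<Sum>k\<in>S \<union> T. c' k * mode k x)" for x
  proof -
    have "(\<Sum>k\<in>S. c k * mode k x) = (\<Sum>k\<in>S \<union> T. (if k \<in> S then c k else 0) * mode k x)"
      "(\<Sum>k\<in>T. d k * mode k x) = (\<Sum>k\<in>S \<union> T. (if k \<in> T then d k else 0) * mode k x)"
      using S by (intro sum.mono_neutral_cong_left; auto)+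
    then show ?thesis by (simp add: ring_distribs eq c'_def sum.distrib)
  qed
  then show ?case using S by (intro exI[of _ "S \<union> T"] exI[of _ c']) auto
qed

lemma trig_poly_torus_L2: "trig_poly t \<Longrightarrow> (\<lambda>x. indicator torus x * t x) \<in> L2"
  by (induction rule: trig_poly.induct)
    (auto simp: ring_distribs mult.left_commute intro: L2_add bounded_torus_L2[of _ "cmod _"] 
      simp: norm_mult intro!: L2_cmult[OF mode_L2, unfolded mode_def])

section \<open>Density of trigonometric polynomials and the Parseval identity\<close>

text \<open>
  Membership in the closure of the trigonometric polynomials in \<open>L\<^sup>2\<close> of the torus.
\<close>

definition torus_approx :: "(real^'n \<Rightarrow> complex) \<Rightarrow> bool" where
  "torus_approx f \<longleftrightarrow> f \<in> L2 \<and>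
     (\<forall>e>0. \<exists>t. trig_poly t \<and> L2_norm (\<lambda>x. f x - indicator torus x * t x) < e)"

lemma torus_approx_trig: "trig_poly t \<Longrightarrow> torus_approx (\<lambda>x. indicator torus x * t x)"
  by (auto simp: torus_approx_def trig_poly_torus_L2 L2_norm_def)

lemma torus_approx_add:
  assumes "torus_approx f" "torus_approx g"
  shows "torus_approx (\<lambda>x. f x + g x)"
  unfolding torus_approx_def
proof (intro conjI allI impI)
  have f: "f \<in> L2" and g: "g \<in> L2" using assms by (auto simp: torus_approx_def)
  then show "(\<lambda>x. f x + g x) \<in> L2" by (rule L2_add)
  fix e :: real assume "e > 0"
  then have "e / 2 > 0" by simp
  then obtain s t where s: "trig_poly s" "L2_norm (\<lambda>x. f x - indicator torus x * s x) < e / 2"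
    and t: "trig_poly t" "L2_norm (\<lambda>x. g x - indicator torus x * t x) < e / 2"
    using assms unfolding torus_approx_def by blast
  have "L2_norm (\<lambda>x. (f x - indicator torus x * s x) + (g x - indicator torus x * t x)) < e"
    using L2_norm_triangle[OF L2_diff[OF f trig_poly_torus_L2[OF s(1)]] L2_diff[OF g trig_poly_torus_L2[OF t(1)]]]
      s(2) t(2) by linarith
  then have "L2_norm (\<lambda>x. f x + g x - indicator torus x * (s x + t x)) < e"
    by (simp add: ring_distribs algebra_simps)
  then show "\<exists>t. trig_poly t \<and> L2_norm (\<lambda>x. f x + g x - indicator torus x * t x) < e"
    using trig_poly.add[OF s(1) t(1)] by blast
qed

lemma torus_approx_cmult:
  assumes "torus_approx f"
  shows "torus_approx (\<lambda>x. c * f x)"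
proof (cases "c = 0")
  case True
  then show ?thesis using torus_approx_trig[OF trig_poly_const[of 0]] by simp
next
  case c: False
  show ?thesis unfolding torus_approx_def
  proof (intro conjI allI impI)
    show "(\<lambda>x. c * f x) \<in> L2" using assms by (auto simp: torus_approx_def L2_cmult)
    fix e :: real assume "e > 0"
    then have "e / cmod c > 0" using c by simp
    then obtain t where t: "trig_poly t" "L2_norm (\<lambda>x. f x - indicator torus x * t x) < e / cmod c"
      using assms unfolding torus_approx_def by blast
    have "L2_norm (\<lambda>x. c * f x - indicator torus x * (c * t x)) = cmod c * L2_norm (\<lambda>x. f x - indicator torus x * t x)"
      by (subst L2_norm_cmult[symmetric]) (simp add: algebra_simps)
    also have "\<dots> < e" using t(2) c by (simp add: field_simps)
    finally show "\<exists>t. trig_poly t \<and> L2_norm (\<lambda>x. c * f x - indicator torus x * t x) < e"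
      using trig_poly_cmult[OF t(1)] by blast
  qed
qed

lemma torus_approx_limit:
  assumes F: "\<And>m. torus_approx (F m)" and f: "f \<in> L2" and lim: "L2_tendsto F f"
  shows "torus_approx f"
  unfolding torus_approx_def
proof (intro conjI allI impI f)
  fix e :: real assume e: "e > 0"
  have FL: "F m \<in> L2" for m using F by (auto simp: torus_approx_def)
  have "\<forall>\<^sub>F m in sequentially. L2_norm (\<lambda>x. F m x - f x) < e / 2"
    using e by (intro order_tendstoD(2)[OF L2_tendsto_norm_diff[OF FL f lim]]) auto
  from eventually_happens'[OF sequentially_bot this]
  obtain m where m: "L2_norm (\<lambda>x. F m x - f x) < e / 2" by blast
  have "e / 2 > 0" using e by simp
  then obtain t where t: "trig_poly t" "L2_norm (\<lambda>x. F m x - indicator torus x * t x) < e / 2"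
    using F[of m] unfolding torus_approx_def by blast
  have "L2_norm (\<lambda>x. (F m x - indicator torus x * t x) + (-1) * (F m x - f x)) \<le>
      L2_norm (\<lambda>x. F m x - indicator torus x * t x) + cmod (-1) * L2_norm (\<lambda>x. F m x - f x)"
    unfolding L2_norm_cmult[symmetric]
    by (rule L2_norm_triangle[OF L2_diff[OF FL trig_poly_torus_L2[OF t(1)]] L2_cmult[OF L2_diff[OF FL f]]])
  also have "\<dots> < e" using m t(2) by simp
  finally have "L2_norm (\<lambda>x. f x - indicator torus x * t x) < e" by (simp add: algebra_simps)
  then show "\<exists>t. trig_poly t \<and> L2_norm (\<lambda>x. f x - indicator torus x * t x) < e" using t(1) by blast
qed

text \<open>
  An interval on the circle is where a cosine centred at its midpoint exceeds the value at the
  endpoints. So its indicator is a limit of polynomials in a shifted cosine.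
\<close>

lemma interval_iff_cos:
  assumes "0 \<le> a" "a < b" "b \<le> 2 * pi" "0 < x" "x < 2 * pi"
  shows "a < x \<and> x < b \<longleftrightarrow> cos ((b - a) / 2) < cos (x - (a + b) / 2)"
proof -
  define h where "h = (b - a) / 2"
  define y where "y = \<bar>x - (a + b) / 2\<bar>"
  have h: "0 < h" "h \<le> pi" using assms by (auto simp: h_def)
  have y: "0 \<le> y" "y < 2 * pi - h" using assms by (auto simp: y_def h_def abs_if field_simps)
  have "a < x \<and> x < b \<longleftrightarrow> y < h" by (auto simp: y_def h_def abs_if field_simps)
  also have "\<dots> \<longleftrightarrow> cos h < cos y"
  proof (cases "y \<le> pi")
    case True
    then show ?thesis using cos_mono_less_eq[of h y] h y by auto
  next
    case False
    then have "cos (2 * pi - y) < cos h" using cos_monotone_0_pi[of h "2 * pi - y"] h y by auto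
    moreover have "cos (2 * pi - y) = cos y" by (simp add: cos_diff)
    ultimately show ?thesis using False h by auto
  qed
  also have "cos y = cos (x - (a + b) / 2)" unfolding y_def by (rule cos_abs_real)
  finally show ?thesis by (simp add: h_def)
qed

lemma AE_torus_box: "AE x in lebesgue. x \<in> torus \<longleftrightarrow> x \<in> box 0 (vec (2*pi) :: real^'n)"
proof -
  have "negligible (cbox 0 (vec (2*pi)) - box 0 (vec (2*pi)) :: (real^'n) set)"
    by (rule negligible_frontier_interval)
  then have "cbox 0 (vec (2*pi)) - box 0 (vec (2*pi)) \<in> null_sets (lebesgue :: (real^'n) measure)"
    by (simp only: negligible_iff_null_sets)
  then have "AE x in lebesgue. x \<notin> (cbox 0 (vec (2*pi)) - box 0 (vec (2*pi)) :: (real^'n) set)"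
    by (rule AE_not_in)
  then show ?thesis
    using cube_subset[of "2*pi", where 'a='n] box_subset_cube[of "2*pi", where 'a='n]
    by (auto elim!: eventually_mono)
qed

text \<open>
  The products \<open>\<Phi> N\<close> of piecewise linear cut-offs, evaluated at shifted cosines, tend to the
  indicator of the box. Replacing \<open>\<Phi> N\<close> by polynomials that are uniformly close on the range of
  the cosines keeps the limit and a uniform bound, and gives trigonometric polynomials.
\<close>

lemma torus_approx_box:
  fixes a b :: "real^'n"
  assumes ab: "\<And>i. 0 \<le> a $ i" "\<And>i. a $ i < b $ i" "\<And>i. b $ i \<le> 2 * pi"
  shows "torus_approx (\<lambda>x. indicator (box a b) x)"
proof -
  define m where "m = (\<chi> i. (a $ i + b $ i) / 2)"
  define h where "h i = cos ((b $ i - a $ i) / 2)" for i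
  define P where "P x = (\<chi> i. cos (x $ i - m $ i))" for x :: "real^'n"
  define \<Phi> where "\<Phi> N y = (\<Prod>i\<in>UNIV. min 1 (max 0 (real N * (y $ i - h i))))" for N and y :: "real^'n"
  have Phi_bound: "\<bar>\<Phi> N y\<bar> \<le> 1" for N y
    unfolding \<Phi>_def abs_prod by (intro prod_le_1) auto
  have box: "box a b \<subseteq> box 0 (vec (2*pi))"
    using ab(1,3) by (auto simp: mem_box_cart) (meson le_less_trans less_le_trans)+
  have Phi_lim: "(\<lambda>N. \<Phi> N (P x)) \<longlonglongrightarrow> indicator (box a b) x" if x: "x \<in> box 0 (vec (2*pi))" for x
  proof -
    have iff: "a $ i < x $ i \<and> x $ i < b $ i \<longleftrightarrow> h i < P x $ i" for i
      using interval_iff_cos[of "a $ i" "b $ i" "x $ i"] ab x by (auto simp: h_def P_def m_def mem_box_cart)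
    have "(\<lambda>N. min 1 (max 0 (real N * (P x $ i - h i)))) \<longlonglongrightarrow> (if h i < P x $ i then 1 else 0)" for i
    proof (cases "h i < P x $ i")
      case True
      then have "filterlim (\<lambda>N. (P x $ i - h i) * real N) at_top sequentially"
        by (intro filterlim_tendsto_pos_mult_at_top[OF tendsto_const]) (auto simp: filterlim_real_sequentially)
      then have "\<forall>\<^sub>F N in sequentially. 1 \<le> (P x $ i - h i) * real N"
        by (simp add: filterlim_at_top)
      then have "\<forall>\<^sub>F N in sequentially. min 1 (max 0 (real N * (P x $ i - h i))) = 1"
        by eventually_elim (auto simp: mult.commute)
      then show ?thesis using True by (simp add: tendsto_eventually)
    next
      case False
      then have "real N * (P x $ i - h i) \<le> 0" for N by (simp add: mult_nonneg_nonpos)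
      then have "min 1 (max 0 (real N * (P x $ i - h i))) = 0" for N by (simp add: max_absorb1)
      then show ?thesis using False by simp
    qed
    then have "(\<lambda>N. \<Phi> N (P x)) \<longlonglongrightarrow> (\<Prod>i\<in>UNIV. if h i < P x $ i then 1 else 0)"
      unfolding \<Phi>_def by (intro tendsto_prod) auto
    also have "(\<Prod>i\<in>UNIV. if h i < P x $ i then 1 else 0 :: real) = indicator (box a b) x"
      using iff by (auto simp: indicator_def mem_box_cart)
    finally show ?thesis .
  qed
  have "\<exists>g. real_polynomial_function g \<and> (\<forall>y\<in>cbox (vec (-1)) (vec 1). \<bar>\<Phi> N y - g y\<bar> < inverse (real (Suc N)))" for N
  proof -
    have "continuous_on (cbox (vec (-1)) (vec 1)) (\<Phi> N)"
      unfolding \<Phi>_def by (intro continuous_intros)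
    moreover have "0 < inverse (real (Suc N))" by simp
    ultimately obtain q where "real_polynomial_function q"
      "\<And>y. y \<in> cbox (vec (-1)) (vec 1) \<Longrightarrow> \<bar>\<Phi> N y - q y\<bar> < inverse (real (Suc N))"
      using Stone_Weierstrass_real_polynomial_function[OF compact_cbox] by metis
    then show ?thesis by blast
  qed
  then obtain g where g: "\<And>N. real_polynomial_function (g N)"
    and close: "\<And>N y. y \<in> cbox (vec (-1)) (vec 1) \<Longrightarrow> \<bar>\<Phi> N y - g N y\<bar> < inverse (real (Suc N))"
    by metis
  have P_in: "P x \<in> cbox (vec (-1)) (vec 1)" for x by (simp add: P_def mem_box_cart)
  define t where "t N x = complex_of_real (g N (P x))" for N x
  have t: "trig_poly (t N)" for N
    unfolding t_def[abs_def] P_def using trig_poly_real_polynomial[OF g] by simp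
  have ibm: "(indicator (box a b) :: _ \<Rightarrow> complex) \<in> borel_measurable lebesgue"
    by (intro borel_measurable_indicator sets_completionI_sets) simp
  have ib: "indicator (box a b) \<in> L2"
    by (rule L2_bound[OF ibm indicator_torus_L2, of 1])
      (use box box_subset_cube[of "2*pi", where 'a='n] in \<open>auto simp: indicator_def\<close>)
  have "L2_tendsto (\<lambda>N x. indicator torus x * t N x) (indicator (box a b))"
  proof (rule L2_tendsto_dominated[OF _ _ indicator_torus_L2])
    show "(\<lambda>x. indicator torus x * t N x) \<in> borel_measurable lebesgue" for N
      using L2_measurable[OF trig_poly_torus_L2[OF t]] .
    show "(indicator (box a b) :: _ \<Rightarrow> complex) \<in> borel_measurable lebesgue" by (rule ibm)
    show "AE x in lebesgue. (\<lambda>N. indicator torus x * t N x) \<longlonglongrightarrow> indicator (box a b) x"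
      using AE_torus_box
    proof eventually_elim
      case (elim x)
      show ?case
      proof (cases "x \<in> torus")
        case True
        then have x: "x \<in> box 0 (vec (2*pi))" using elim by simp
        have "(\<lambda>N. g N (P x) - \<Phi> N (P x)) \<longlonglongrightarrow> 0"
        proof (rule Lim_null_comparison[OF _ LIMSEQ_inverse_real_of_nat])
          show "\<forall>\<^sub>F N in sequentially. norm (g N (P x) - \<Phi> N (P x)) \<le> inverse (real (Suc N))"
            using close[OF P_in, of _ x] by (auto simp: abs_minus_commute less_imp_le)
        qed
        from tendsto_add[OF this Phi_lim[OF x]]
        have "(\<lambda>N. complex_of_real (g N (P x))) \<longlonglongrightarrow> complex_of_real (indicator (box a b) x)"
          by (intro tendsto_of_real) simp
        then show ?thesis using True by (cases "x \<in> box a b") (simp_all add: t_def)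
      next
        case False
        then have "x \<notin> box a b" using elim box by auto
        then show ?thesis using False by simp
      qed
    qed
    show "AE x in lebesgue. cmod (indicator torus x * t N x - indicator (box a b) x) \<le> 3 * cmod (indicator torus x)" for N
    proof (rule AE_I2)
      fix x :: "real^'n"
      have "inverse (real (Suc N)) \<le> 1" by (simp add: inverse_eq_divide)
      then have "cmod (t N x) \<le> 2"
        using close[OF P_in, of N x] Phi_bound[of N "P x"] unfolding t_def norm_of_real by linarith
      then have "cmod (t N x - 1) \<le> 3" using norm_triangle_ineq4[of "t N x" 1] by simp
      with \<open>cmod (t N x) \<le> 2\<close> show "cmod (indicator torus x * t N x - indicator (box a b) x) \<le> 3 * cmod (indicator torus x)"
        using box box_subset_cube[of "2*pi", where 'a='n] by (auto simp: indicator_def)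
    qed
  qed
  from torus_approx_limit[OF torus_approx_trig[OF t] ib this] show ?thesis by simp
qed

lemma torus_approx_cong_AE:
  assumes f: "torus_approx f" and [measurable]: "g \<in> borel_measurable lebesgue"
    and eq: "AE x in lebesgue. f x = g x"
  shows "torus_approx g"
proof -
  have fL: "f \<in> L2" using f by (simp add: torus_approx_def)
  note [measurable] = L2_measurable[OF fL]
  have g: "g \<in> L2" by (rule L2_bound[OF _ fL, of _ 1]) (use eq in auto)
  have "sq_integral (\<lambda>x. f x - g x) = (\<integral>\<^sup>+x. 0 \<partial>(lebesgue :: (real^'a) measure))"
    by (rule nn_integral_cong_AE) (use eq in auto)
  then have "L2_tendsto (\<lambda>_. f) g" by (simp add: L2_tendsto_def)
  from torus_approx_limit[OF f g this] show ?thesis .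
qed

text \<open>
  Dynkin's argument: boxes form a generator that is stable under intersection, complements use the
  constant polynomial, and disjoint unions are dominated limits of finite ones.
\<close>

lemma torus_approx_borel:
  fixes A :: "(real^'n) set"
  assumes "A \<in> sets borel"
  shows "torus_approx (\<lambda>x. indicator (A \<inter> torus) x)"
proof -
  have one: "torus_approx (\<lambda>x. indicator torus x)"
    using torus_approx_trig[OF trig_poly_const[of 1]] by simp
  have zero: "torus_approx (\<lambda>x. 0)"
    using torus_approx_trig[OF trig_poly_const[of 0]] by simp
  let ?G = "range (\<lambda>(a, b). box a b) :: (real^'n) set set"
  have "Int_stable ?G"
    by (auto simp: Int_stable_def box_Int_box)
  moreover have "?G \<subseteq> Pow UNIV" by simp
  moreover have "A \<in> sigma_sets UNIV ?G"
    using assms by (subst (asm) borel_eq_box) simp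
  ultimately show ?thesis
  proof (induction rule: sigma_sets_induct_disjoint)
    case (basic A)
    then obtain a b where A: "A = box a b" by auto
    \<comment> \<open>The box clipped to the open torus, which differs from the torus by a null set.\<close>
    define a' :: "real^'n" where "a' = (\<chi> i. max (a $ i) 0)"
    define b' :: "real^'n" where "b' = (\<chi> i. min (b $ i) (2*pi))"
    have eq: "box a b \<inter> box 0 (vec (2*pi)) = box a' b'"
      by (auto simp: a'_def b'_def mem_box_cart)
    have ae: "AE x in lebesgue. indicator (box a' b') x = (indicator (A \<inter> torus) x :: complex)"
      using AE_torus_box by eventually_elim (simp add: A indicator_def flip: eq)
    have mA: "(\<lambda>x. indicator (A \<inter> torus) x :: complex) \<in> borel_measurable lebesgue"
      unfolding A by (intro borel_measurable_indicator sets_completionI_sets) simp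
    show ?case
    proof (cases "\<forall>i. a' $ i < b' $ i")
      case True
      have "torus_approx (\<lambda>x. indicator (box a' b') x)"
        by (rule torus_approx_box) (use True in \<open>auto simp: a'_def b'_def\<close>)
      then show ?thesis by (rule torus_approx_cong_AE[OF _ mA ae])
    next
      case False
      then have "box a' b' = {}" by (auto simp: mem_box_cart) (meson less_trans)
      then show ?thesis using ae by (intro torus_approx_cong_AE[OF zero mA]) simp
    qed
  next
    case empty
    then show ?case using zero by simp
  next
    case (compl A)
    have eq: "(\<lambda>x. indicator torus x + (-1) * indicator (A \<inter> torus) x :: complex) = indicator ((UNIV - A) \<inter> torus)"
      by (auto simp: indicator_def)
    show ?case
      using torus_approx_add[OF one torus_approx_cmult[OF compl.IH, of "-1"]] unfolding eq by simp
  next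
    case (union A)
    have A_borel: "A i \<in> sets borel" for i
      using union.hyps(2) by (subst borel_eq_box) auto
    have part: "torus_approx (\<lambda>x. indicator ((\<Union>i<N. A i) \<inter> torus) x)" for N
    proof (induction N)
      case (Suc N)
      have "A N \<inter> A i = {}" if "i < N" for i
        by (rule disjoint_family_onD[OF union.hyps(1)]) (use that in auto)
      then have "x \<in> A N \<Longrightarrow> x \<notin> (\<Union>i<N. A i)" for x by blast
      then have eq: "(\<lambda>x. indicator ((\<Union>i<N. A i) \<inter> torus) x + indicator (A N \<inter> torus) x :: complex)
          = (\<lambda>x. indicator ((\<Union>i<Suc N. A i) \<inter> torus) x)"
        by (intro ext) (simp add: indicator_def lessThan_Suc)
      show ?case using torus_approx_add[OF Suc union.IH[of N]] unfolding eq .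
    qed (simp add: zero)
    have lim_set: "(\<lambda>N. indicator ((\<Union>i<N. A i) \<inter> torus) x :: complex) \<longlonglongrightarrow> indicator ((\<Union>i. A i) \<inter> torus) x" for x
    proof (cases "x \<in> (\<Union>i. A i) \<inter> torus")
      case True
      then obtain i where "x \<in> A i" "x \<in> torus" by auto
      then have "\<forall>\<^sub>F N in sequentially. indicator ((\<Union>i<N. A i) \<inter> torus) x = (1::complex)"
        by (intro eventually_sequentiallyI[of "Suc i"]) (auto simp: indicator_def)
      then show ?thesis using True by (simp add: tendsto_eventually)
    qed (auto simp: indicator_def)
    have mA [measurable]: "(\<Union>i. A i) \<inter> torus \<in> sets borel" "(\<Union>i<N. A i) \<inter> torus \<in> sets borel" for N
      using A_borel by auto
    have mi: "(\<lambda>x. indicator ((\<Union>i. A i) \<inter> torus) x :: complex) \<in> borel_measurable lebesgue"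
      using mA(1) by (intro borel_measurable_indicator) (simp add: sets_completionI_sets)
    have "L2_tendsto (\<lambda>N x. indicator ((\<Union>i<N. A i) \<inter> torus) x) (\<lambda>x. indicator ((\<Union>i. A i) \<inter> torus) x)"
    proof (rule L2_tendsto_dominated[OF _ _ indicator_torus_L2, of _ _ 1])
      show "(\<lambda>x. indicator ((\<Union>i<N. A i) \<inter> torus) x :: complex) \<in> borel_measurable lebesgue" for N
        using L2_measurable part unfolding torus_approx_def by blast
      show "(\<lambda>x. indicator ((\<Union>i. A i) \<inter> torus) x :: complex) \<in> borel_measurable lebesgue"
        by (rule mi)
    qed (use lim_set in \<open>auto simp: indicator_def\<close>)
    moreover have "(\<lambda>x. indicator ((\<Union>i. A i) \<inter> torus) x :: complex) \<in> L2"
      by (rule L2_bound[OF mi indicator_torus_L2, of 1]) (auto simp: indicator_def)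
    ultimately show ?case by (intro torus_approx_limit[OF part])
  qed
qed

lemma torus_approx_lebesgue:
  fixes A :: "(real^'n) set"
  assumes "A \<in> sets lebesgue"
  shows "torus_approx (\<lambda>x. indicator (A \<inter> torus) x)"
proof -
  obtain B N where B: "B \<in> sets borel" "negligible N" "B \<union> N = A"
    using sets_lebesgue_almost_borel[OF assms] .
  have "AE x in lebesgue. x \<notin> N" using B(2) unfolding negligible_iff_null_sets by (rule AE_not_in)
  then have "AE x in lebesgue. indicator (B \<inter> torus) x = (indicator (A \<inter> torus) x :: complex)"
    by eventually_elim (use B(3) in \<open>auto simp: indicator_def\<close>)
  then show ?thesis
    using assms by (intro torus_approx_cong_AE[OF torus_approx_borel[OF B(1)]]) auto
qed

lemma torus_approx_sum:
  "finite S \<Longrightarrow> (\<And>i. i \<in> S \<Longrightarrow> torus_approx (f i)) \<Longrightarrow> torus_approx (\<lambda>x. \<Sum>i\<in>S. f i x)"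
proof (induction S rule: finite_induct)
  case empty
  then show ?case using torus_approx_trig[OF trig_poly_const[of 0]] by simp
qed (auto intro: torus_approx_add)

lemma torus_approx_L2:
  fixes f :: "real^'n \<Rightarrow> complex"
  assumes f: "f \<in> L2" and off: "\<And>x. x \<notin> torus \<Longrightarrow> f x = 0"
  shows "torus_approx f"
proof -
  note [measurable] = L2_measurable[OF f]
  obtain F where sF: "\<And>i. simple_function lebesgue (F i)"
    and lim: "\<And>x. (\<lambda>i. F i x) \<longlonglongrightarrow> f x" and bd: "\<And>i x. dist (F i x) 0 \<le> 2 * dist (f x) 0"
    using borel_measurable_implies_sequence_metric[OF L2_measurable[OF f], of 0] by auto
  have F_off: "F i x = 0" if "x \<notin> torus" for i x
    using bd[of i x] off[OF that] by simp
  have "torus_approx (F i)" for i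
  proof -
    have "finite (F i ` UNIV)" using simple_functionD(1)[OF sF[of i]] by simp
    moreover have "torus_approx (\<lambda>x. y * indicator ((F i -` {y}) \<inter> torus) x)" for y
      using simple_functionD(2)[OF sF[of i], of "{y}"]
      by (intro torus_approx_cmult torus_approx_lebesgue) simp
    ultimately have "torus_approx (\<lambda>x. \<Sum>y\<in>F i ` UNIV. y * indicator ((F i -` {y}) \<inter> torus) x)"
      by (rule torus_approx_sum)
    moreover have "(\<Sum>y\<in>F i ` UNIV. y * indicator ((F i -` {y}) \<inter> torus) x) = F i x" for x
    proof -
      have "(\<Sum>y\<in>F i ` UNIV. y * indicator ((F i -` {y}) \<inter> torus) x) =
          (\<Sum>y\<in>{F i x}. y * indicator ((F i -` {y}) \<inter> torus) x)"
        using \<open>finite (F i ` UNIV)\<close> by (intro sum.mono_neutral_right) (auto simp: indicator_def)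
      then show ?thesis using F_off[of x i] by (auto simp: indicator_def)
    qed
    ultimately show ?thesis by simp
  qed
  moreover have "L2_tendsto F f"
  proof (rule L2_tendsto_dominated[OF _ _ f, of _ _ 3])
    show "F i \<in> borel_measurable lebesgue" for i using sF by (rule borel_measurable_simple_function)
    show "AE x in lebesgue. cmod (F i x - f x) \<le> 3 * cmod (f x)" for i
    proof (rule AE_I2)
      fix x show "cmod (F i x - f x) \<le> 3 * cmod (f x)"
        using bd[of i x] norm_triangle_ineq4[of "F i x" "f x"] by simp
    qed
  qed (use lim in auto)
  ultimately show ?thesis by (intro torus_approx_limit[OF _ f])
qed

lemma has_sum_nonnegI:
  fixes f :: "'a \<Rightarrow> real"
  assumes nn: "\<And>x. x \<in> A \<Longrightarrow> 0 \<le> f x"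
    and up: "\<And>F. finite F \<Longrightarrow> F \<subseteq> A \<Longrightarrow> sum f F \<le> s"
    and low: "\<And>e. e > 0 \<Longrightarrow> \<exists>F. finite F \<and> F \<subseteq> A \<and> s - e \<le> sum f F"
  shows "(f has_sum s) A"
  unfolding has_sum_def
proof (rule order_tendstoI)
  fix a assume "a < s"
  then obtain F where F: "finite F" "F \<subseteq> A" "s - (s - a) / 2 \<le> sum f F" using low[of "(s - a) / 2"] by auto
  have "a < sum f Y" if "finite Y" "F \<subseteq> Y" "Y \<subseteq> A" for Y
  proof -
    have "sum f F \<le> sum f Y" using that nn by (intro sum_mono2) auto
    then show ?thesis using F(3) \<open>a < s\<close> by (simp add: field_simps)
  qed
  then show "\<forall>\<^sub>F Y in finite_subsets_at_top A. a < sum f Y"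
    unfolding eventually_finite_subsets_at_top using F by blast
next
  fix a assume "s < a"
  then show "\<forall>\<^sub>F Y in finite_subsets_at_top A. sum f Y < a"
    using up by (intro eventually_finite_subsets_at_top_weakI) (meson le_less_trans)
qed

text \<open>
  Bessel's inequality bounds the partial sums from above; density and Bessel's identity bring them
  within any \<open>e\<close> of the norm.
\<close>

lemma Parseval_torus:
  fixes g :: "real^'n \<Rightarrow> complex"
  assumes g: "g \<in> L2" and off: "\<And>x. x \<notin> torus \<Longrightarrow> g x = 0"
  shows "((\<lambda>k. (cmod (fourier_L1 g k))\<^sup>2) has_sum (2*pi) ^ CARD('n) * (L2_norm g)\<^sup>2) int_lattice"
proof (rule has_sum_nonnegI)
  define N where "N = (2*pi) ^ CARD('n)"
  have N: "N > 0" by (simp add: N_def)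
  have ft: "fourier_L1 g k = L2_inner g (mode k)" for k by (rule fourier_torus) (rule off)
  note Bessel = Bessel_identity[OF _ _ g, folded N_def, THEN conjunct2]
  fix F :: "(real^'n) set" assume F: "finite F" "F \<subseteq> int_lattice"
  have "0 \<le> (L2_norm g)\<^sup>2 - (\<Sum>k\<in>F. (cmod (L2_inner g (mode k)))\<^sup>2) / N"
    using Bessel[OF F, of "\<lambda>k. L2_inner g (mode k) / N"] 
      zero_le_power2[of "L2_norm (\<lambda>x. g x - (\<Sum>k\<in>F. L2_inner g (mode k) / N * mode k x))"] by simp
  then show "(\<Sum>k\<in>F. (cmod (fourier_L1 g k))\<^sup>2) \<le> (2*pi) ^ CARD('n) * (L2_norm g)\<^sup>2"
    unfolding ft N_def[symmetric] using N by (simp add: field_simps)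
next
  define N where "N = (2*pi) ^ CARD('n)"
  have N: "N > 0" by (simp add: N_def)
  have ft: "fourier_L1 g k = L2_inner g (mode k)" for k by (rule fourier_torus) (rule off)
  note Bessel = Bessel_identity[OF _ _ g, folded N_def, THEN conjunct2]
  fix e :: real assume e: "e > 0"
  have "sqrt (e / N) > 0" using e N by simp
  then obtain t where t: "trig_poly t" "L2_norm (\<lambda>x. g x - indicator torus x * t x) < sqrt (e / N)"
    using torus_approx_L2[of g, OF g] off unfolding torus_approx_def by blast
  obtain S c where S: "finite S" "S \<subseteq> int_lattice"
    and eq: "\<And>x. indicator torus x * t x = (\<Sum>k\<in>S. c k * mode k x)"
    using trig_poly_sum_modes[OF t(1)] by blast
  have "(L2_norm (\<lambda>x. g x - indicator torus x * t x))\<^sup>2 \<le> e / N"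
    using power_mono[OF less_imp_le[OF t(2)], of 2] e N by simp
  then have "(L2_norm g)\<^sup>2 - (\<Sum>k\<in>S. (cmod (L2_inner g (mode k)))\<^sup>2) / N
      + N * (\<Sum>k\<in>S. (cmod (c k - L2_inner g (mode k) / N))\<^sup>2) \<le> e / N"
    unfolding eq Bessel[OF S] .
  moreover have "0 \<le> N * (\<Sum>k\<in>S. (cmod (c k - L2_inner g (mode k) / N))\<^sup>2)"
    using N by (intro mult_nonneg_nonneg sum_nonneg) auto
  ultimately have "(L2_norm g)\<^sup>2 - (\<Sum>k\<in>S. (cmod (L2_inner g (mode k)))\<^sup>2) / N \<le> e / N" by linarith
  from mult_left_mono[OF this, of N]
  have "N * (L2_norm g)\<^sup>2 - e \<le> (\<Sum>k\<in>S. (cmod (L2_inner g (mode k)))\<^sup>2)"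
    using N by (simp add: right_diff_distrib)
  then show "\<exists>F. finite F \<and> F \<subseteq> int_lattice \<and>
      (2*pi) ^ CARD('n) * (L2_norm g)\<^sup>2 - e \<le> (\<Sum>k\<in>F. (cmod (fourier_L1 g k))\<^sup>2)"
    unfolding ft N_def[symmetric] using S by blast
qed simp

lemma periodize_L2:
  fixes g :: "real^'n \<Rightarrow> complex"
  assumes E: "translation_free E" and off: "\<And>x. x \<notin> E \<Longrightarrow> g x = 0" and g: "g \<in> L2"
  shows "periodize g \<in> L2" "L2_norm (periodize g) = L2_norm g"
proof -
  have gm [measurable]: "g \<in> borel_measurable lebesgue" using g by (rule L2_measurable)
  have pn: "ennreal ((cmod (periodize g x))\<^sup>2) =
     (\<integral>\<^sup>+k. ennreal ((cmod (g (x + (2*pi) *\<^sub>R k)))\<^sup>2) \<partial>count_space int_lattice) * indicator torus x" for x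
    by (rule periodize_norm_square[OF E]) (rule off)
  have eq: "sq_integral (periodize g) = sq_integral g"
    unfolding pn by (rule nn_integral_lattice_tiling[symmetric]) auto
  show p: "periodize g \<in> L2"
    by (rule L2I_nn) (use eq nn_integral_L2[OF g] measurable_periodize[OF gm] in auto)
  show "L2_norm (periodize g) = L2_norm g"
    using eq unfolding nn_integral_L2[OF g] nn_integral_L2[OF p] by (simp add: power2_eq_iff_nonneg)
qed

text \<open>
  Folding \<open>E\<close> into the torus is injective, so \<open>E\<close> has finite measure.
\<close>

lemma translation_free_integrable:
  fixes g :: "real^'n \<Rightarrow> complex"
  assumes E: "translation_free E" and off: "\<And>x. x \<notin> E \<Longrightarrow> g x = 0" and g: "g \<in> L2"
    and mE: "E \<in> sets lebesgue"
  shows "integrable lebesgue g"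
proof -
  have gm [measurable]: "g \<in> borel_measurable lebesgue" using g by (rule L2_measurable)
  let ?u = "\<lambda>x. indicator E x :: complex"
  have off': "\<And>x. x \<notin> E \<Longrightarrow> ?u x = 0" by simp
  have p: "cmod (periodize ?u x) \<le> 1 * cmod (indicator torus x)" for x
  proof -
    obtain m0 where m0: "\<And>m. m \<noteq> m0 \<Longrightarrow> ?u (x + (2*pi) *\<^sub>R lat m) = 0"
      using translation_free_single[of E ?u, OF E off'] by blast
    have "periodize ?u x = indicator torus x * ?u (x + (2*pi) *\<^sub>R lat m0)"
      unfolding periodize_def by (rule suminf_single) (simp add: m0)
    then show ?thesis by (simp add: norm_mult indicator_def)
  qed
  have pn: "ennreal ((cmod (periodize ?u x))\<^sup>2) =
     (\<integral>\<^sup>+k. ennreal ((cmod (?u (x + (2*pi) *\<^sub>R k)))\<^sup>2) \<partial>count_space int_lattice) * indicator torus x" for x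
    by (rule periodize_norm_square[OF E]) (rule off')
  have mE' [measurable]: "?u \<in> borel_measurable lebesgue" using mE by auto
  have "sq_integral ?u = sq_integral (periodize ?u)"
    unfolding pn by (rule nn_integral_lattice_tiling) auto
  also have "\<dots> < \<infinity>"
  proof -
    have "periodize ?u \<in> L2"
      by (rule L2_bound[OF measurable_periodize[OF mE'] indicator_torus_L2 AE_I2[OF p]])
    then show ?thesis by (simp add: nn_integral_L2)
  qed
  finally have "?u \<in> L2" by (intro L2I_nn mE')
  from L2_inner_integrable[OF g this] show ?thesis
    by (rule Bochner_Integration.integrable_cong[THEN iffD1, rotated -1]) (auto simp: indicator_def off)
qed

text \<open>
  Folding into the torus changes neither the norm, since no two points of \<open>E\<close> meet, nor the Fourier
  coefficients at lattice points, since the characters are periodic.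
\<close>

lemma Parseval_translation_free:
  fixes g :: "real^'n \<Rightarrow> complex"
  assumes E: "translation_free E" and mE: "E \<in> sets lebesgue"
    and off: "\<And>x. x \<notin> E \<Longrightarrow> g x = 0" and g: "g \<in> L2"
  shows "((\<lambda>k. (cmod (fourier_L1 g k))\<^sup>2) has_sum (2*pi) ^ CARD('n) * (L2_norm g)\<^sup>2) int_lattice"
proof -
  have ig: "integrable lebesgue g" by (rule translation_free_integrable[OF E _ g mE]) (rule off)
  have pL: "periodize g \<in> L2" "L2_norm (periodize g) = L2_norm g"
    by (rule periodize_L2[OF E _ g]; rule off; assumption)+
  have ft: "fourier_L1 (periodize g) k = fourier_L1 g k" if k: "k \<in> int_lattice" for k
  proof -
    let ?u = "\<lambda>x. g x * cnj (wave k x)"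
    have "periodize ?u x = periodize g x * cnj (wave k x)" for x
    proof -
      obtain m0 where m0: "\<And>m. m \<noteq> m0 \<Longrightarrow> g (x + (2*pi) *\<^sub>R lat m) = 0"
        using translation_free_single[of E g, OF E off] by blast
      have "periodize g x = indicator torus x * g (x + (2*pi) *\<^sub>R lat m0)"
        unfolding periodize_def by (rule suminf_single) (simp add: m0)
      moreover have "periodize ?u x = indicator torus x * ?u (x + (2*pi) *\<^sub>R lat m0)"
        unfolding periodize_def by (rule suminf_single) (simp add: m0)
      ultimately show ?thesis by (simp add: wave_periodic[OF k])
    qed
    moreover have "integrable lebesgue ?u"
    proof (rule Bochner_Integration.integrable_bound[OF ig])
      show "?u \<in> borel_measurable lebesgue" using ig by measurable
    qed (simp add: norm_mult)
    ultimately show ?thesis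
      using integral_periodize[of E ?u, OF E] by (simp add: fourier_L1_wave off)
  qed
  moreover have "periodize g x = 0" if "x \<notin> torus" for x using that by (simp add: periodize_def)
  ultimately have "((\<lambda>k. (cmod (fourier_L1 (periodize g) k))\<^sup>2) has_sum (2*pi) ^ CARD('n) * (L2_norm (periodize g))\<^sup>2) int_lattice"
    by (intro Parseval_torus pL(1))
  then show ?thesis
    unfolding pL(2) by (rule has_sum_cong[THEN iffD1, rotated]) (simp add: ft)
qed

section \<open>The Plancherel theorem\<close>

lemma has_sum_imp_nn_integral:
  fixes f :: "'a \<Rightarrow> real"
  assumes nn: "\<And>x. x \<in> A \<Longrightarrow> 0 \<le> f x" and s: "(f has_sum s) A"
  shows "(\<integral>\<^sup>+x. ennreal (f x) \<partial>count_space A) = ennreal s"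
proof -
  have "f summable_on A" using s by (auto simp: summable_on_def)
  then have "(\<lambda>x. norm (f x)) summable_on A"
    by (rule summable_on_cong[THEN iffD1, rotated]) (simp add: nn)
  then have a: "Infinite_Set_Sum.abs_summable_on f A" using abs_summable_equivalent by blast
  have "(\<integral>\<^sup>+x. ennreal (f x) \<partial>count_space A) = ennreal (infsetsum f A)"
    by (rule nn_integral_conv_infsetsum[OF a nn])
  then show ?thesis using infsetsum_infsum[OF a] infsumI[OF s] by simp
qed

lemma nn_integral_imp_has_sum:
  fixes f :: "'a \<Rightarrow> real"
  assumes nn: "\<And>x. x \<in> A \<Longrightarrow> 0 \<le> f x" and s: "0 \<le> s"
    and eq: "(\<integral>\<^sup>+x. ennreal (f x) \<partial>count_space A) = ennreal s"
  shows "(f has_sum s) A"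
proof -
  have "(\<integral>\<^sup>+x. ennreal (norm (f x)) \<partial>count_space A) = (\<integral>\<^sup>+x. ennreal (f x) \<partial>count_space A)"
    by (rule nn_integral_cong) (simp add: nn)
  then have "integrable (count_space A) f"
    by (intro integrableI_bounded) (auto simp: eq)
  then have a: "Infinite_Set_Sum.abs_summable_on f A" by (simp add: abs_summable_on_def)
  have "ennreal (infsetsum f A) = ennreal s"
    using nn_integral_conv_infsetsum[OF a nn] eq by simp
  then have "infsetsum f A = s"
    using infsetsum_nonneg[of A f] nn s by simp
  then have i: "infsum f A = s" using infsetsum_infsum[OF a] by simp
  have "(\<lambda>x. norm (f x)) summable_on A" using a abs_summable_equivalent by blast
  then have "f summable_on A"
    by (rule summable_on_cong[THEN iffD1, rotated]) (simp add: nn)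
  then have "(f has_sum infsum f A) A" by (rule has_sum_infsum)
  then show ?thesis by (simp only: i)
qed

lemma sigma_finite_lebesgue: "sigma_finite_measure (lebesgue :: 'a::euclidean_space measure)"
proof
  obtain A :: "'a set set" where A: "countable A" "A \<subseteq> sets lborel" "\<Union>A = space lborel" "\<forall>a\<in>A. emeasure lborel a \<noteq> \<infinity>"
    using lborel.sigma_finite_countable by blast
  then show "\<exists>A::'a set set. countable A \<and> A \<subseteq> sets lebesgue \<and> \<Union>A = space lebesgue \<and> (\<forall>a\<in>A. emeasure lebesgue a \<noteq> \<infinity>)"
    by (intro exI[of _ A]) (auto simp: sets_completionI_sets)
qed

interpretation lebesgue: sigma_finite_measure "lebesgue :: 'a::euclidean_space measure"
  by (rule sigma_finite_lebesgue)

interpretation lebesgue_pair: pair_sigma_finite "lebesgue :: 'a::euclidean_space measure" "lebesgue :: 'b::euclidean_space measure"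
  by (rule pair_sigma_finite.intro[OF sigma_finite_lebesgue sigma_finite_lebesgue])

lemma wave_pair_measurable:
  "(\<lambda>p :: (real^'n) \<times> (real^'n). wave (fst p) (snd p)) \<in> borel_measurable (lebesgue \<Otimes>\<^sub>M lebesgue)"
proof -
  have id: "(\<lambda>x. x) \<in> borel_measurable (lebesgue :: (real^'n) measure)"
    using id_borel_measurable_lebesgue by (simp add: id_def)
  have [measurable]: "fst \<in> borel_measurable (lebesgue \<Otimes>\<^sub>M lebesgue :: ((real^'n) \<times> (real^'n)) measure)"
    "snd \<in> borel_measurable (lebesgue \<Otimes>\<^sub>M lebesgue :: ((real^'n) \<times> (real^'n)) measure)"
    using measurable_compose[OF measurable_fst id] measurable_compose[OF measurable_snd id]
    by auto
  show ?thesis unfolding wave_def by measurable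
qed

lemma fourier_L1_measurable [measurable]:
  fixes f :: "real^'n \<Rightarrow> complex"
  assumes f: "f \<in> borel_measurable lebesgue"
  shows "fourier_L1 f \<in> borel_measurable lebesgue"
proof -
  have f': "(\<lambda>p :: (real^'n) \<times> (real^'n). f (snd p)) \<in> borel_measurable (lebesgue \<Otimes>\<^sub>M lebesgue)"
    using measurable_compose[OF measurable_snd f] .
  have "(\<lambda>p :: (real^'n) \<times> (real^'n). f (snd p) * cnj (wave (fst p) (snd p))) \<in> borel_measurable (lebesgue \<Otimes>\<^sub>M lebesgue)"
    by (intro borel_measurable_times f' borel_measurable_cnj wave_pair_measurable)
  then have "(\<lambda>\<xi>. LINT x|lebesgue. f x * cnj (wave \<xi> x)) \<in> borel_measurable lebesgue"
    by (intro lebesgue.borel_measurable_lebesgue_integral) (simp add: case_prod_beta')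
  then show ?thesis by (simp add: fourier_L1_wave[abs_def])
qed

lemma integrable_wave:
  assumes f: "integrable lebesgue f"
  shows "integrable lebesgue (\<lambda>x. f x * wave \<xi> x)" "integrable lebesgue (\<lambda>x. f x * cnj (wave \<xi> x))"
proof -
  have fm: "f \<in> borel_measurable lebesgue" using f by auto
  show "integrable lebesgue (\<lambda>x. f x * wave \<xi> x)"
    by (rule Bochner_Integration.integrable_bound[OF f])
      (auto simp: norm_mult intro!: borel_measurable_times fm measurable_wave)
  show "integrable lebesgue (\<lambda>x. f x * cnj (wave \<xi> x))"
    by (rule Bochner_Integration.integrable_bound[OF f])
      (auto simp: norm_mult intro!: borel_measurable_times fm borel_measurable_cnj measurable_wave)
qed

lemma fourier_L1_diff:
  assumes "integrable lebesgue f" "integrable lebesgue g"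
  shows "fourier_L1 (\<lambda>x. f x - g x) \<xi> = fourier_L1 f \<xi> - fourier_L1 g \<xi>"
  unfolding fourier_L1_wave left_diff_distrib
  by (rule Bochner_Integration.integral_diff; rule integrable_wave; fact)

lemma fourier_L1_add:
  assumes "integrable lebesgue f" "integrable lebesgue g"
  shows "fourier_L1 (\<lambda>x. f x + g x) \<xi> = fourier_L1 f \<xi> + fourier_L1 g \<xi>"
  unfolding fourier_L1_wave distrib_right
  by (rule Bochner_Integration.integral_add; rule integrable_wave; fact)

lemma fourier_L1_cmult: "fourier_L1 (\<lambda>x. c * f x) \<xi> = c * fourier_L1 f \<xi>"
  unfolding fourier_L1_wave mult.assoc by simp

lemma fourier_L1_bound: "cmod (fourier_L1 f \<xi>) \<le> (LINT x|lebesgue. cmod (f x))"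
  unfolding fourier_L1_wave
  using integral_norm_bound[of lebesgue "\<lambda>x. f x * cnj (wave \<xi> x)"] by (simp add: norm_mult)

lemma fourier_L1_modulate: "fourier_L1 (\<lambda>x. f x * cnj (wave \<theta> x)) \<xi> = fourier_L1 f (\<theta> + \<xi>)"
  unfolding fourier_L1_wave by (simp add: wave_add_freq mult.assoc)

lemma fourier_L1_affine:
  fixes B :: "real^'n^'n"
  assumes B: "det B \<noteq> 0" and f: "f \<in> borel_measurable lebesgue"
  shows "of_real \<bar>det B\<bar> * fourier_L1 (\<lambda>x. f (B *v x + v)) (transpose B *v \<eta>) = wave \<eta> v * fourier_L1 f \<eta>"
proof -
  have "(\<lambda>y. f y * cnj (wave \<eta> y)) \<in> borel_measurable lebesgue"
    by (intro borel_measurable_times f borel_measurable_cnj measurable_wave)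
  from integral_lebesgue_affine[OF B this, of v]
  have "fourier_L1 f \<eta> = of_real \<bar>det B\<bar> * (LINT x|lebesgue. f (B *v x + v) * cnj (wave \<eta> (B *v x + v)))"
    by (simp add: fourier_L1_wave scaleR_conv_of_real)
  also have "(\<lambda>x. f (B *v x + v) * cnj (wave \<eta> (B *v x + v))) =
      (\<lambda>x. cnj (wave \<eta> v) * (f (B *v x + v) * cnj (wave (transpose B *v \<eta>) x)))"
  proof
    fix x
    have "(B *v x) \<bullet> \<eta> = x \<bullet> (transpose B *v \<eta>)" by (metis dot_lmul_matrix inner_commute vector_transpose_matrix)
    then have "wave \<eta> (B *v x) = wave (transpose B *v \<eta>) x" by (simp add: wave_def)
    then show "f (B *v x + v) * cnj (wave \<eta> (B *v x + v)) =
        cnj (wave \<eta> v) * (f (B *v x + v) * cnj (wave (transpose B *v \<eta>) x))"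
      by (simp add: wave_add)
  qed
  finally have "fourier_L1 f \<eta> = cnj (wave \<eta> v) * (of_real \<bar>det B\<bar> * fourier_L1 (\<lambda>x. f (B *v x + v)) (transpose B *v \<eta>))"
    by (simp add: fourier_L1_wave mult_ac)
  then have "wave \<eta> v * fourier_L1 f \<eta> = (wave \<eta> v * cnj (wave \<eta> v)) * (of_real \<bar>det B\<bar> * fourier_L1 (\<lambda>x. f (B *v x + v)) (transpose B *v \<eta>))"
    by (simp add: mult_ac)
  then show ?thesis by (simp add: wave_cnj_cancel)
qed

lemma nn_integral_norm_affine:
  fixes B :: "real^'n^'n"
  assumes B: "det B \<noteq> 0" and f: "f \<in> borel_measurable lebesgue"
  shows "sq_integral f =
    ennreal \<bar>det B\<bar> * sq_integral (\<lambda>x. f (B *v x + v))"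
  by (rule nn_integral_lebesgue_affine[OF B]) (use f in measurable)

lemma L2_affine:
  fixes B :: "real^'n^'n"
  assumes B: "det B \<noteq> 0" and f: "f \<in> L2"
  shows "(\<lambda>x. f (B *v x + v)) \<in> L2"
    and "\<bar>det B\<bar> * (L2_norm (\<lambda>x. f (B *v x + v)))\<^sup>2 = (L2_norm f)\<^sup>2"
proof -
  note fm = L2_measurable[OF f]
  show L: "(\<lambda>x. f (B *v x + v)) \<in> L2"
  proof (rule L2I_nn)
    show "(\<lambda>x. f (B *v x + v)) \<in> borel_measurable lebesgue" by (rule measurable_lebesgue_affine[OF B fm])
    have "ennreal \<bar>det B\<bar> * sq_integral (\<lambda>x. f (B *v x + v)) < \<infinity>"
      by (subst nn_integral_norm_affine[OF B fm, of v, symmetric]) (simp add: nn_integral_L2[OF f])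
    then show "sq_integral (\<lambda>x. f (B *v x + v)) < \<infinity>"
      using B by (auto simp: ennreal_mult_less_top)
  qed
  have "ennreal ((L2_norm f)\<^sup>2) = ennreal (\<bar>det B\<bar> * (L2_norm (\<lambda>x. f (B *v x + v)))\<^sup>2)"
    using nn_integral_norm_affine[OF B fm, of v] unfolding nn_integral_L2[OF f] nn_integral_L2[OF L]
    by (simp add: ennreal_mult)
  then show "\<bar>det B\<bar> * (L2_norm (\<lambda>x. f (B *v x + v)))\<^sup>2 = (L2_norm f)\<^sup>2" by simp
qed

lemma mat_mult_vec: "mat c *v x = c *\<^sub>R (x :: real^'n)"
proof -
  have "(\<Sum>j\<in>UNIV. (if i = j then c else 0) * x $ j) = c * x $ i" for i
    by (simp add: if_distrib[of "\<lambda>u. u * _"] cong: if_cong)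
  then show ?thesis by (simp add: vec_eq_iff matrix_vector_mult_def mat_def)
qed

lemma det_mat_const: "det (mat c :: real^'n^'n) = c ^ CARD('n)"
  by (subst det_diagonal) (auto simp: mat_def)

definition centred_cube :: "real \<Rightarrow> (real^'n) set" where
  "centred_cube R = {x. \<forall>i. - (pi * R) \<le> x $ i \<and> x $ i < pi * R}"

lemma centred_cube_eq: "centred_cube R = (\<lambda>x. x + vec (pi * R)) -` cube (2 * pi * R)"
proof -
  have "- (pi * R) \<le> t \<and> t < pi * R \<longleftrightarrow> 0 \<le> t + pi * R \<and> t + pi * R < 2 * pi * R" for t
  proof -
    have "2 * pi * R = pi * R + pi * R" by simp
    then show ?thesis by linarith
  qed
  then show ?thesis by (simp add: centred_cube_def cube_def vimage_def)
qed

lemma centred_cube_borel [measurable]: "centred_cube R \<in> sets borel"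
  unfolding centred_cube_eq by (intro measurable_sets_borel[OF _ cube_borel]) measurable

lemma centred_cube_lebesgue [measurable]: "centred_cube R \<in> sets lebesgue"
  by (simp add: sets_completionI_sets)

lemma translation_free_centred_cube: "translation_free (centred_cube 1 :: (real^'n) set)"
  unfolding translation_free_def
proof safe
  fix x l :: "real^'n" assume x: "x \<in> centred_cube 1" and xl: "x + (2*pi) *\<^sub>R l \<in> centred_cube 1" and l: "l \<in> int_lattice" "l \<notin> {}"
  let ?y = "x + vec pi"
  have "cell (2*pi) ?y = 0" using mem_cube_shift_iff[of "2*pi" 0 ?y] x by (simp add: centred_cube_eq)
  moreover have "?y - (2*pi) *\<^sub>R (- l) \<in> torus" using xl by (simp add: centred_cube_eq algebra_simps)
  then have "- l = cell (2*pi) ?y" using mem_cube_shift_iff[of "2*pi" "- l" ?y] l by (simp add: lattice_minus)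
  ultimately show "l = 0" by simp
qed

lemma centred_cube_L2: "(\<lambda>x. indicator (centred_cube R :: (real^'n) set) x :: complex) \<in> L2"
proof (rule L2I_nn)
  let ?S = "centred_cube R :: (real^'n) set"
  show "(\<lambda>x. indicator ?S x :: complex) \<in> borel_measurable lebesgue"
    by (intro borel_measurable_indicator centred_cube_lebesgue)
  have "sq_integral (\<lambda>x. indicator ?S x) = (\<integral>\<^sup>+x. indicator ?S x \<partial>lebesgue)"
    by (intro nn_integral_cong) (auto simp: indicator_def)
  also have "\<dots> = emeasure lebesgue ?S" by (rule nn_integral_indicator) (rule centred_cube_lebesgue)
  also have "\<dots> \<le> emeasure lebesgue (cbox (vec (- (pi * R))) (vec (pi * R)) :: (real^'n) set)"
    by (intro emeasure_mono) (auto simp: centred_cube_def mem_box_cart less_imp_le)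
  also have "\<dots> < \<infinity>" using emeasure_lborel_cbox_finite by (simp add: less_top)
  finally show "sq_integral (\<lambda>x. indicator ?S x) < \<infinity>" .
qed

lemma cnj_indicator [simp]: "cnj (indicator S x) = indicator S x"
  by (simp add: indicator_def)

lemma L2_compact_integrable:
  assumes f: "f \<in> L2"
  shows "integrable lebesgue (\<lambda>x. indicator (centred_cube R) x * f x)"
  using L2_inner_integrable[OF f centred_cube_L2[of R]] by (simp add: mult.commute)

text \<open>
  For each \<open>\<theta>\<close> the Parseval identity for \<open>g\<close> times the conjugate of the character of frequency
  \<open>\<theta>\<close> sums the squared transform over the shifted lattice \<open>\<theta> + \<int>\<^sup>n\<close>. Integration over \<open>\<theta>\<close> in
  the unit cube covers all of frequency space once.
\<close>

lemma Plancherel_unit: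
  fixes g :: "real^'n \<Rightarrow> complex"
  assumes g: "g \<in> L2" and off: "\<And>x. x \<notin> centred_cube 1 \<Longrightarrow> g x = 0"
  shows "sq_integral (fourier_L1 g) = ennreal ((2*pi) ^ CARD('n) * (L2_norm g)\<^sup>2)"
proof -
  let ?C = "(2*pi) ^ CARD('n) * (L2_norm g)\<^sup>2"
  note gm = L2_measurable[OF g]
  have fiber: "(\<integral>\<^sup>+k. ennreal ((cmod (fourier_L1 g (\<theta> + 1 *\<^sub>R k)))\<^sup>2) \<partial>count_space int_lattice) = ennreal ?C" for \<theta>
  proof -
    let ?g = "\<lambda>x. g x * cnj (wave \<theta> x)"
    have gm': "?g \<in> borel_measurable lebesgue"
      by (intro borel_measurable_times gm borel_measurable_cnj measurable_wave)
    have L: "?g \<in> L2" by (rule L2_bound[OF gm' g, of 1]) (simp add: norm_mult)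
    have "((\<lambda>k. (cmod (fourier_L1 ?g k))\<^sup>2) has_sum (2*pi) ^ CARD('n) * (L2_norm ?g)\<^sup>2) int_lattice"
      by (rule Parseval_translation_free[OF translation_free_centred_cube centred_cube_lebesgue _ L]) (simp add: off)
    then have "((\<lambda>k. (cmod (fourier_L1 g (\<theta> + k)))\<^sup>2) has_sum ?C) int_lattice"
      by (simp add: fourier_L1_modulate L2_norm_def norm_mult)
    from has_sum_imp_nn_integral[OF _ this] show ?thesis by simp
  qed
  have "(\<lambda>\<xi>. ennreal ((cmod (fourier_L1 g \<xi>))\<^sup>2)) \<in> borel_measurable lebesgue"
    using fourier_L1_measurable[OF gm] by measurable
  from nn_integral_lattice_tiling[OF _ this, of 1]
  have "sq_integral (fourier_L1 g) = (\<integral>\<^sup>+\<theta>. ennreal ?C * indicator (cube 1 :: (real^'n) set) \<theta> \<partial>lebesgue)"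
    by (simp only: fiber zero_less_one simp_thms)
  also have "\<dots> = ennreal ?C * emeasure lebesgue (cube 1 :: (real^'n) set)"
    by (rule nn_integral_cmult_indicator) (rule cube_lebesgue)
  also have "\<dots> = ennreal ?C" using emeasure_cube[of 1, where 'n='n] by simp
  finally show ?thesis .
qed

lemma Plancherel_compact:
  fixes f :: "real^'n \<Rightarrow> complex"
  assumes R: "R > 0" and f: "f \<in> L2" and off: "\<And>x. x \<notin> centred_cube R \<Longrightarrow> f x = 0"
  shows "sq_integral (fourier_L1 f) = ennreal ((2*pi) ^ CARD('n) * (L2_norm f)\<^sup>2)"
proof -
  note fm = L2_measurable[OF f]
  let ?B = "mat R :: real^'n^'n"
  define d where "d = R ^ CARD('n)"
  have d: "d > 0" "\<bar>det ?B\<bar> = d" "det ?B \<noteq> 0" using R by (auto simp: d_def det_mat_const)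
  define g where "g x = f (?B *v x + 0)" for x
  have g: "g \<in> L2" unfolding g_def[abs_def] by (rule L2_affine[OF d(3) f])
  have gn: "d * (L2_norm g)\<^sup>2 = (L2_norm f)\<^sup>2"
    using L2_affine(2)[OF d(3) f, of 0] unfolding g_def[abs_def] d(2) .
  have goff: "g x = 0" if "x \<notin> centred_cube 1" for x
    unfolding g_def
  proof (rule off, rule notI)
    assume "?B *v x + 0 \<in> centred_cube R"
    moreover have "- (pi * R) \<le> R * x $ i \<longleftrightarrow> - pi \<le> x $ i" "R * x $ i < pi * R \<longleftrightarrow> x $ i < pi" for i
      using mult_le_cancel_left_pos[OF R, of "- pi" "x $ i"] mult_less_cancel_left_pos[OF R, of "x $ i" pi]
      by (simp_all add: mult.commute)
    ultimately have "x \<in> centred_cube 1"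
      by (simp add: centred_cube_def mat_mult_vec)
    with that show False by simp
  qed
  have ft: "fourier_L1 f \<xi> = of_real d * fourier_L1 g (?B *v \<xi> + 0)" for \<xi>
    using fourier_L1_affine[OF d(3) fm, of 0 \<xi>] unfolding d(2) transpose_mat
    by (simp add: g_def[abs_def] wave_commute[of _ 0])
  have "sq_integral (fourier_L1 f)
      = (\<integral>\<^sup>+\<xi>. ennreal d * (ennreal d * ennreal ((cmod (fourier_L1 g (?B *v \<xi> + 0)))\<^sup>2)) \<partial>lebesgue)"
    unfolding ft using d(1) by (intro nn_integral_cong) (simp add: norm_mult power_mult_distrib power2_eq_square ennreal_mult mult_ac)
  also have "\<dots> = ennreal d * (ennreal d * sq_integral (\<lambda>\<xi>. fourier_L1 g (?B *v \<xi> + 0)))"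
  proof -
    have m: "(\<lambda>\<xi>. ennreal ((cmod (fourier_L1 g (?B *v \<xi> + 0)))\<^sup>2)) \<in> borel_measurable lebesgue"
      using measurable_lebesgue_affine[OF d(3) fourier_L1_measurable[OF L2_measurable[OF g]], of 0] by measurable
    show ?thesis using m by (simp only: nn_integral_cmult borel_measurable_times_ennreal borel_measurable_const)
  qed
  also have "ennreal d * sq_integral (\<lambda>\<xi>. fourier_L1 g (?B *v \<xi> + 0))
      = sq_integral (fourier_L1 g)"
    using nn_integral_norm_affine[OF d(3) fourier_L1_measurable[OF L2_measurable[OF g]], of 0] unfolding d(2) by simp
  also have "\<dots> = ennreal ((2*pi) ^ CARD('n) * (L2_norm g)\<^sup>2)"
    by (rule Plancherel_unit[OF g]) (rule goff)
  also have "ennreal d * \<dots> = ennreal ((2*pi) ^ CARD('n) * (L2_norm f)\<^sup>2)"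
    using d(1) by (simp add: ennreal_mult[symmetric] mult.left_commute flip: gn)
  finally show ?thesis .
qed

definition trunc :: "(real^'n \<Rightarrow> complex) \<Rightarrow> nat \<Rightarrow> real^'n \<Rightarrow> complex" where
  "trunc f m x = indicator (centred_cube (real (Suc m))) x * f x"

lemma centred_cube_mono: "R \<le> S \<Longrightarrow> centred_cube R \<subseteq> centred_cube S"
  by (auto simp: centred_cube_def) 
    (meson mult_le_cancel_left_pos neg_le_iff_le order_trans pi_gt_zero, meson less_le_trans mult_le_cancel_left_pos pi_gt_zero)

lemma trunc_L2: "f \<in> L2 \<Longrightarrow> trunc f m \<in> L2"
  unfolding trunc_def[abs_def] by (rule L2_mult_indicator) auto

lemma trunc_integrable: "f \<in> L2 \<Longrightarrow> integrable lebesgue (trunc f m)"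
  unfolding trunc_def[abs_def] by (rule L2_compact_integrable)

lemma trunc_tendsto: "(\<lambda>m. trunc f m x) \<longlonglongrightarrow> f x"
proof -
  obtain N :: nat where N: "norm x < pi * real N"
    using ex_less_of_nat_mult[of pi "norm x"] by (auto simp: mult.commute)
  have "trunc f m x = f x" if "m \<ge> N" for m
  proof -
    have "pi * real N \<le> pi * real (Suc m)" using that by simp
    then have "\<bar>x $ i\<bar> < pi * real (Suc m)" for i
      using component_le_norm_cart[of x i] N by linarith
    then have "x \<in> centred_cube (real (Suc m))"
      unfolding centred_cube_def by (auto simp: abs_less_iff less_imp_le minus_le_iff)
    then show ?thesis by (simp add: trunc_def)
  qed
  then show ?thesis by (intro tendsto_eventually eventually_sequentiallyI[of N])
qed

lemma trunc_L2_tendsto: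
  assumes f: "f \<in> L2"
  shows "L2_tendsto (trunc f) f"
proof (rule L2_tendsto_dominated[OF _ _ f, of _ _ 1])
  show "trunc f m \<in> borel_measurable lebesgue" for m using L2_measurable[OF trunc_L2[OF f]] .
  show "f \<in> borel_measurable lebesgue" using L2_measurable[OF f] .
  show "AE x in lebesgue. (\<lambda>m. trunc f m x) \<longlonglongrightarrow> f x" by (intro AE_I2 trunc_tendsto)
  show "AE x in lebesgue. cmod (trunc f m x - f x) \<le> 1 * cmod (f x)" for m
    by (rule AE_I2) (simp add: trunc_def indicator_def)
qed

text \<open>
  The compactly supported case applies to differences of truncations. Fatou's lemma transports the
  resulting bound to the difference between a truncation and \<open>f\<close>; this shows both that the transform of
  \<open>f\<close> is square integrable and that the transforms of the truncations converge to it.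
\<close>

theorem Plancherel:
  fixes f :: "real^'n \<Rightarrow> complex"
  assumes f: "f \<in> L2" and i: "integrable lebesgue f"
  shows fourier_L1_L2: "fourier_L1 f \<in> L2"
    and fourier_L1_norm: "(L2_norm (fourier_L1 f))\<^sup>2 = (2*pi) ^ CARD('n) * (L2_norm f)\<^sup>2"
proof -
  define N where "N = (2*pi) ^ CARD('n)"
  have N: "N > 0" by (simp add: N_def)
  note fm = L2_measurable[OF f]
  let ?F = "trunc f"
  have FL: "?F m \<in> L2" and FI: "integrable lebesgue (?F m)" for m
    using trunc_L2[OF f] trunc_integrable[OF f] by auto
  have pw: "(\<lambda>m. fourier_L1 (?F m) \<xi>) \<longlonglongrightarrow> fourier_L1 f \<xi>" for \<xi>
    unfolding fourier_L1_wave
  proof (rule integral_dominated_convergence)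
    show "integrable lebesgue (\<lambda>x. cmod (f x))" using i by (rule integrable_norm)
    show "(\<lambda>x. f x * cnj (wave \<xi> x)) \<in> borel_measurable lebesgue"
      using integrable_wave(2)[OF i] by auto
    show "(\<lambda>x. ?F m x * cnj (wave \<xi> x)) \<in> borel_measurable lebesgue" for m
      using integrable_wave(2)[OF FI] by auto
    show "AE x in lebesgue. (\<lambda>m. ?F m x * cnj (wave \<xi> x)) \<longlonglongrightarrow> f x * cnj (wave \<xi> x)"
      by (intro AE_I2 tendsto_mult trunc_tendsto tendsto_const)
    show "AE x in lebesgue. norm (?F m x * cnj (wave \<xi> x)) \<le> cmod (f x)" for m
      by (simp add: norm_mult trunc_def indicator_def)
  qed
  have diff: "sq_integral (\<lambda>\<xi>. fourier_L1 (?F l) \<xi> - fourier_L1 (?F m) \<xi>)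
      = ennreal (N * (L2_norm (\<lambda>x. ?F l x - ?F m x))\<^sup>2)" for l m
  proof -
    have "sq_integral (\<lambda>\<xi>. fourier_L1 (\<lambda>x. ?F l x - ?F m x) \<xi>)
      = ennreal (N * (L2_norm (\<lambda>x. ?F l x - ?F m x))\<^sup>2)"
      unfolding N_def
    proof (rule Plancherel_compact)
      show "0 < real (Suc (max l m))" by simp
      show "(\<lambda>x. ?F l x - ?F m x) \<in> L2" by (rule L2_diff[OF FL FL])
      fix x :: "real^'n" assume "x \<notin> centred_cube (real (Suc (max l m)))"
      moreover have "centred_cube (real (Suc l)) \<subseteq> (centred_cube (real (Suc (max l m))) :: (real^'n) set)"
        "centred_cube (real (Suc m)) \<subseteq> (centred_cube (real (Suc (max l m))) :: (real^'n) set)"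
        by (intro centred_cube_mono; simp)+
      ultimately have "x \<notin> centred_cube (real (Suc l))" "x \<notin> centred_cube (real (Suc m))" by blast+
      then show "?F l x - ?F m x = 0" by (simp add: trunc_def del: of_nat_Suc)
    qed
    then show ?thesis by (simp add: fourier_L1_diff[OF FI FI])
  qed
  have fatou: "sq_integral (\<lambda>\<xi>. fourier_L1 f \<xi> - fourier_L1 (?F m) \<xi>)
      \<le> ennreal (N * (L2_norm (\<lambda>x. f x - ?F m x))\<^sup>2)" for m
  proof -
    have "sq_integral (\<lambda>\<xi>. fourier_L1 f \<xi> - fourier_L1 (?F m) \<xi>)
      = (\<integral>\<^sup>+\<xi>. liminf (\<lambda>l. ennreal ((cmod (fourier_L1 (?F l) \<xi> - fourier_L1 (?F m) \<xi>))\<^sup>2)) \<partial>lebesgue)"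
    proof (intro nn_integral_cong lim_imp_Liminf[symmetric])
      fix \<xi>
      show "(\<lambda>l. ennreal ((cmod (fourier_L1 (?F l) \<xi> - fourier_L1 (?F m) \<xi>))\<^sup>2)) \<longlonglongrightarrow>
          ennreal ((cmod (fourier_L1 f \<xi> - fourier_L1 (?F m) \<xi>))\<^sup>2)"
        by (intro tendsto_ennrealI tendsto_power tendsto_norm tendsto_diff pw tendsto_const)
    qed simp
    also have "\<dots> \<le> liminf (\<lambda>l. \<integral>\<^sup>+\<xi>. ennreal ((cmod (fourier_L1 (?F l) \<xi> - fourier_L1 (?F m) \<xi>))\<^sup>2) \<partial>lebesgue)"
    proof (rule nn_integral_liminf)
      fix l
      have "fourier_L1 (?F l) \<in> borel_measurable lebesgue" "fourier_L1 (?F m) \<in> borel_measurable lebesgue"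
        using fourier_L1_measurable[OF L2_measurable[OF FL]] by auto
      then show "(\<lambda>\<xi>. ennreal ((cmod (fourier_L1 (?F l) \<xi> - fourier_L1 (?F m) \<xi>))\<^sup>2)) \<in> borel_measurable lebesgue"
        by measurable
    qed
    also have "\<dots> = ennreal (N * (L2_norm (\<lambda>x. f x - ?F m x))\<^sup>2)"
    proof (rule lim_imp_Liminf)
      have "L2_tendsto (\<lambda>l x. ?F l x - ?F m x) (\<lambda>x. f x - ?F m x)"
        using trunc_L2_tendsto[OF f] by (simp add: L2_tendsto_def)
      from L2_tendsto_norm[OF L2_diff[OF FL FL] L2_diff[OF f FL] this]
      show "(\<lambda>l. \<integral>\<^sup>+\<xi>. ennreal ((cmod (fourier_L1 (?F l) \<xi> - fourier_L1 (?F m) \<xi>))\<^sup>2) \<partial>lebesgue)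
          \<longlonglongrightarrow> ennreal (N * (L2_norm (\<lambda>x. f x - ?F m x))\<^sup>2)"
        unfolding diff by (intro tendsto_ennrealI tendsto_mult tendsto_power tendsto_const)
    qed simp
    finally show ?thesis .
  qed
  have hm: "fourier_L1 f \<in> borel_measurable lebesgue" "fourier_L1 (?F m) \<in> borel_measurable lebesgue" for m
    using fourier_L1_measurable[OF L2_measurable[OF FL]] fourier_L1_measurable[OF fm] by auto
  have dL: "(\<lambda>\<xi>. fourier_L1 f \<xi> - fourier_L1 (?F m) \<xi>) \<in> L2" for m
  proof (rule L2I_nn)
    show "(\<lambda>\<xi>. fourier_L1 f \<xi> - fourier_L1 (?F m) \<xi>) \<in> borel_measurable lebesgue"
      by (intro borel_measurable_diff hm)
    show "sq_integral (\<lambda>\<xi>. fourier_L1 f \<xi> - fourier_L1 (?F m) \<xi>) < \<infinity>"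
      using fatou[of m] by (rule le_less_trans) simp
  qed
  have pc: "sq_integral (\<lambda>\<xi>. fourier_L1 (?F m) \<xi>) = ennreal (N * (L2_norm (?F m))\<^sup>2)" for m
    unfolding N_def by (rule Plancherel_compact[OF _ FL, of "real (Suc m)"]) (auto simp: trunc_def)
  have FL': "fourier_L1 (?F m) \<in> L2" for m
    by (rule L2I_nn[OF hm(2)]) (simp add: pc)
  have Fn: "(L2_norm (fourier_L1 (?F m)))\<^sup>2 = N * (L2_norm (?F m))\<^sup>2" for m
    using pc[of m] N unfolding nn_integral_L2[OF FL'] by simp
  show L: "fourier_L1 f \<in> L2"
    using L2_add[OF dL[of 0] FL'[of 0]] by simp
  have dn: "(L2_norm (\<lambda>\<xi>. fourier_L1 f \<xi> - fourier_L1 (?F m) \<xi>))\<^sup>2 \<le> N * (L2_norm (\<lambda>x. f x - ?F m x))\<^sup>2" for m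
    using fatou[of m] N unfolding nn_integral_L2[OF dL] by simp
  have "L2_tendsto (\<lambda>m. fourier_L1 (?F m)) (fourier_L1 f)"
    unfolding L2_tendsto_def
  proof (rule tendsto_sandwich[OF _ _ tendsto_const])
    have z: "(\<lambda>m. L2_norm (\<lambda>x. f x - ?F m x)) \<longlonglongrightarrow> 0"
      using L2_tendsto_norm_diff[OF FL f trunc_L2_tendsto[OF f]] by (simp add: L2_norm_def norm_minus_commute)
    have "(\<lambda>m. ennreal (N * (L2_norm (\<lambda>x. f x - ?F m x))\<^sup>2)) \<longlonglongrightarrow> ennreal (N * 0\<^sup>2)"
      by (intro tendsto_ennrealI tendsto_mult tendsto_power tendsto_const z)
    then show "(\<lambda>m. ennreal (N * (L2_norm (\<lambda>x. f x - ?F m x))\<^sup>2)) \<longlonglongrightarrow> 0" by simp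
    show "\<forall>\<^sub>F m in sequentially. sq_integral (\<lambda>\<xi>. fourier_L1 (?F m) \<xi> - fourier_L1 f \<xi>)
        \<le> ennreal (N * (L2_norm (\<lambda>x. f x - ?F m x))\<^sup>2)"
      using fatou by (simp add: norm_minus_commute)
  qed simp
  from L2_tendsto_norm[OF FL' L this]
  have "(\<lambda>m. (L2_norm (fourier_L1 (?F m)))\<^sup>2) \<longlonglongrightarrow> (L2_norm (fourier_L1 f))\<^sup>2" by (intro tendsto_power)
  moreover have "(\<lambda>m. (L2_norm (fourier_L1 (?F m)))\<^sup>2) \<longlonglongrightarrow> N * (L2_norm f)\<^sup>2"
    unfolding Fn by (intro tendsto_mult tendsto_power tendsto_const L2_tendsto_norm[OF FL f trunc_L2_tendsto[OF f]])
  ultimately show "(L2_norm (fourier_L1 f))\<^sup>2 = (2*pi) ^ CARD('n) * (L2_norm f)\<^sup>2"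
    unfolding N_def by (rule LIMSEQ_unique)
qed

lemma Plancherel_inner:
  fixes f g :: "real^'n \<Rightarrow> complex"
  assumes f: "f \<in> L2" "integrable lebesgue f" and g: "g \<in> L2" "integrable lebesgue g"
  shows "L2_inner (fourier_L1 f) (fourier_L1 g) = (2*pi) ^ CARD('n) * L2_inner f g"
proof -
  define N where "N = (2*pi) ^ CARD('n)"
  have re: "Re (L2_inner (fourier_L1 u) (fourier_L1 g)) = N * Re (L2_inner u g)"
    if u: "u \<in> L2" "integrable lebesgue u" for u
  proof -
    have i: "integrable lebesgue (\<lambda>x. u x + g x)" using u g by auto
    have "(L2_norm (fourier_L1 (\<lambda>x. u x + g x)))\<^sup>2 = N * (L2_norm (\<lambda>x. u x + g x))\<^sup>2"
      unfolding N_def by (rule fourier_L1_norm[OF L2_add[OF u(1) g(1)] i])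
    also have "fourier_L1 (\<lambda>x. u x + g x) = (\<lambda>\<xi>. fourier_L1 u \<xi> + fourier_L1 g \<xi>)"
      by (rule ext) (rule fourier_L1_add[OF u(2) g(2)])
    finally show ?thesis
      unfolding L2_norm_square_add[OF u(1) g(1)] L2_norm_square_add[OF fourier_L1_L2[OF u] fourier_L1_L2[OF g]]
        fourier_L1_norm[OF u] fourier_L1_norm[OF g] N_def[symmetric] by (simp add: ring_distribs)
  qed
  have im: "Re (L2_inner (\<lambda>x. \<i> * u x) v) = - Im (L2_inner u v)" for u v :: "real^'n \<Rightarrow> complex"
    by (simp add: L2_inner_cmult)
  have "fourier_L1 (\<lambda>x. \<i> * f x) = (\<lambda>\<xi>. \<i> * fourier_L1 f \<xi>)" by (rule ext) (rule fourier_L1_cmult)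
  then have "- Im (L2_inner (fourier_L1 f) (fourier_L1 g)) = N * (- Im (L2_inner f g))"
    using re[of "\<lambda>x. \<i> * f x"] L2_cmult[OF f(1), of \<i>] f(2) unfolding im[symmetric] by simp
  then show ?thesis using re[OF f] by (intro complex_eqI) (simp_all add: N_def)
qed

text \<open>
  The approximating sequence behind \<^const>\<open>has_fourier\<close> consists of functions to which
  the polarized Plancherel identity applies, and both sides are continuous in \<open>L\<^sup>2\<close>.
\<close>

lemma has_fourier_inner:
  fixes f :: "real^'n \<Rightarrow> complex"
  assumes F: "has_fourier f g" and h: "h \<in> L2" "integrable lebesgue h"
  shows "L2_inner g (fourier_L1 h) = (2*pi) ^ CARD('n) * L2_inner f h"
proof -
  obtain F where FL: "\<And>m. F m \<in> L2" and FI: "\<And>m. integrable lebesgue (F m)"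
    and l1: "L2_tendsto F f" and l2: "L2_tendsto (\<lambda>m. fourier_L1 (F m)) g" and f: "f \<in> L2" and g: "g \<in> L2"
    using F unfolding has_fourier_def by blast
  have "(\<lambda>m. L2_inner (fourier_L1 (F m)) (fourier_L1 h)) \<longlonglongrightarrow> L2_inner g (fourier_L1 h)"
    by (rule L2_tendsto_inner[OF fourier_L1_L2[OF FL FI] g l2 fourier_L1_L2[OF h]])
  moreover have "(\<lambda>m. L2_inner (fourier_L1 (F m)) (fourier_L1 h)) \<longlonglongrightarrow> (2*pi) ^ CARD('n) * L2_inner f h"
    unfolding Plancherel_inner[OF FL FI h] by (intro tendsto_mult tendsto_const L2_tendsto_inner[OF FL f l1 h(1)])
  ultimately show ?thesis by (rule LIMSEQ_unique)
qed

lemma fourier_multiplication_formula: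
  fixes h g :: "real^'n \<Rightarrow> complex"
  assumes h: "integrable lebesgue h" and g: "integrable lebesgue g"
  shows "L2_inner (fourier_L1 h) g = L2_inner h (\<lambda>x. fourier_L1 g (- x))"
proof -
  have hm: "h \<in> borel_measurable lebesgue" and gm: "g \<in> borel_measurable lebesgue" using h g by auto
  define u where "u \<xi> x = cnj (g \<xi>) * (h x * cnj (wave \<xi> x))" for \<xi> x
  have um: "case_prod u \<in> borel_measurable (lebesgue \<Otimes>\<^sub>M lebesgue)"
    unfolding u_def case_prod_beta'
    by (intro borel_measurable_times borel_measurable_cnj wave_pair_measurable
        measurable_compose[OF measurable_fst gm] measurable_compose[OF measurable_snd hm])
  have nu: "norm (u \<xi> x) = cmod (g \<xi>) * cmod (h x)" for \<xi> x by (simp add: u_def norm_mult)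
  have iu: "integrable (lebesgue \<Otimes>\<^sub>M lebesgue) (case_prod u)"
  proof (rule lebesgue_pair.Fubini_integrable[OF um])
    show "integrable lebesgue (\<lambda>\<xi>. LINT x|lebesgue. norm (case_prod u (\<xi>, x)))"
      using integrable_norm[OF g] by (simp add: nu)
    show "AE \<xi> in lebesgue. integrable lebesgue (\<lambda>x. case_prod u (\<xi>, x))"
      using integrable_wave(2)[OF h] by (simp add: u_def)
  qed
  have "L2_inner (fourier_L1 h) g = (LINT \<xi>|lebesgue. (LINT x|lebesgue. u \<xi> x))"
    unfolding L2_inner_def u_def by (simp add: fourier_L1_wave mult.commute)
  also have "\<dots> = (LINT x|lebesgue. (LINT \<xi>|lebesgue. u \<xi> x))"
    by (rule lebesgue_pair.Fubini_integral[OF iu, symmetric])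
  also have "\<dots> = L2_inner h (\<lambda>x. fourier_L1 g (- x))"
    unfolding L2_inner_def
  proof (rule Bochner_Integration.integral_cong[OF refl])
    fix x
    have "(LINT \<xi>|lebesgue. u \<xi> x) = (LINT \<xi>|lebesgue. h x * cnj (g \<xi> * cnj (wave (- x) \<xi>)))"
      by (intro Bochner_Integration.integral_cong[OF refl])
        (simp add: u_def cnj_wave wave_commute[of x] wave_minus wave_commute[of "- x"] mult_ac)
    also have "\<dots> = h x * cnj (fourier_L1 g (- x))"
      unfolding fourier_L1_wave by (simp only: integral_mult_right_zero Bochner_Integration.integral_cnj)
    finally show "(LINT \<xi>|lebesgue. u \<xi> x) = h x * cnj (fourier_L1 g (- x))" .
  qed
  finally show ?thesis .
qed

text \<open>
  By the multiplication formula the reflected transform is adjoint to the transform, and by Plancherel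
  both multiply norms by the same constant. An isometry whose adjoint is an isometry is onto: with
  \<open>f\<close> the normalized reflected transform of \<open>g\<close>, the squared distance of the transform of a truncation
  of \<open>f\<close> to \<open>g\<close> expands into three terms that cancel in the limit. Integrability of \<open>g\<close> makes its
  reflected transform an actual integral rather than a limit.
\<close>

theorem fourier_surjective:
  fixes g :: "real^'n \<Rightarrow> complex"
  assumes g: "g \<in> L2" "integrable lebesgue g"
  shows "\<exists>f. has_fourier f g"
proof -
  define N where "N = (2*pi) ^ CARD('n)"
  have N: "N > 0" by (simp add: N_def)
  define r where "r x = fourier_L1 g (- x)" for x
  define f where "f x = of_real (1 / N) * r x" for x
  have d1: "\<bar>det (mat (-1) :: real^'n^'n)\<bar> = 1" by (simp add: det_mat_const power_abs)
  then have d0: "det (mat (-1) :: real^'n^'n) \<noteq> 0" by auto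
  have r_eq: "r = (\<lambda>x. fourier_L1 g (mat (-1) *v x + 0))" by (auto simp: r_def mat_mult_vec)
  have r: "r \<in> L2" unfolding r_eq by (rule L2_affine(1)[OF d0 fourier_L1_L2[OF g]])
  have rn: "(L2_norm r)\<^sup>2 = N * (L2_norm g)\<^sup>2"
    using L2_affine(2)[OF d0 fourier_L1_L2[OF g], of 0] fourier_L1_norm[OF g] unfolding r_eq d1 N_def by simp
  have f: "f \<in> L2" unfolding f_def[abs_def] by (rule L2_cmult[OF r])
  have fn: "(L2_norm g)\<^sup>2 = N * (L2_norm f)\<^sup>2"
    unfolding f_def[abs_def] L2_norm_cmult power_mult_distrib rn using N
    by (simp add: norm_divide power2_eq_square)
  let ?F = "trunc f"
  have FL: "?F m \<in> L2" and FI: "integrable lebesgue (?F m)" for m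
    using trunc_L2[OF f] trunc_integrable[OF f] by auto
  have FfL: "fourier_L1 (?F m) \<in> L2" for m by (rule fourier_L1_L2[OF FL FI])
  have inner: "L2_inner (fourier_L1 (?F m)) g = N * L2_inner (?F m) f" for m
  proof -
    have "L2_inner (fourier_L1 (?F m)) g = L2_inner (?F m) r"
      unfolding r_def[abs_def] by (rule fourier_multiplication_formula[OF FI g(2)])
    also have "\<dots> = N * L2_inner (?F m) f"
    proof -
      have "L2_inner f u = of_real (1 / N) * L2_inner r u" for u
        unfolding f_def[abs_def] by (rule L2_inner_cmult)
      then have "L2_inner (?F m) f = of_real (1 / N) * L2_inner (?F m) r"
        using L2_inner_cnj[of "?F m" f] L2_inner_cnj[of "?F m" r] by simp
      then show ?thesis using N by simp
    qed
    finally show ?thesis .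
  qed
  have nd: "(L2_norm (\<lambda>\<xi>. fourier_L1 (?F m) \<xi> - g \<xi>))\<^sup>2 =
      N * (L2_norm (?F m))\<^sup>2 + N * (L2_norm f)\<^sup>2 - 2 * (N * Re (L2_inner (?F m) f))" for m
    unfolding L2_norm_square_diff[OF FfL g(1)] inner fourier_L1_norm[OF FL FI] N_def[symmetric] fn by simp
  have "(\<lambda>m. N * (L2_norm (?F m))\<^sup>2 + N * (L2_norm f)\<^sup>2 - 2 * (N * Re (L2_inner (?F m) f))) \<longlonglongrightarrow>
      N * (L2_norm f)\<^sup>2 + N * (L2_norm f)\<^sup>2 - 2 * (N * Re (L2_inner f f))"
    by (intro tendsto_intros L2_tendsto_norm[OF FL f trunc_L2_tendsto[OF f]] L2_tendsto_inner[OF FL f trunc_L2_tendsto[OF f] f])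
  then have "(\<lambda>m. (L2_norm (\<lambda>\<xi>. fourier_L1 (?F m) \<xi> - g \<xi>))\<^sup>2) \<longlonglongrightarrow> 0"
    unfolding nd by (simp add: L2_inner_self del: of_real_power)
  from tendsto_ennrealI[OF this] have "L2_tendsto (\<lambda>m. fourier_L1 (?F m)) g"
    unfolding L2_tendsto_def nn_integral_L2[OF L2_diff[OF FfL g(1)]] by simp
  then have hf: "has_fourier f g"
    unfolding has_fourier_def using f g(1) FL FI trunc_L2_tendsto[OF f] by blast
  show ?thesis using exI[where P="\<lambda>f. has_fourier f g", OF hf] .
qed

section \<open>Partitions into translation-free sets\<close>

lemma lat_inj: "lat m = (lat m' :: real^'n) \<longleftrightarrow> m = m'"
  using bij_lat[where 'a = 'n] by (auto simp: bij_betw_def dest: injD)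

lemma lat_surj:
  assumes "k \<in> int_lattice" obtains m where "lat m = k"
  using bij_lat assms unfolding bij_betw_def by (metis imageE)

lemma card_le_Per:
  fixes K :: "(real^'n) set"
  assumes B: "Per (indicator K) \<xi> \<le> ennreal B" and M: "finite M"
    and K: "\<And>m. m \<in> M \<Longrightarrow> \<xi> + (2*pi) *\<^sub>R lat m \<in> K"
  shows "real (card M) \<le> max B 0"
proof -
  have inj: "inj_on lat M" by (auto simp: inj_on_def lat_inj)
  have "ennreal (real (card M)) = (\<Sum>k\<in>lat ` M. indicator K (\<xi> + (2*pi) *\<^sub>R k))"
    using K by (simp add: sum.reindex[OF inj] ennreal_of_nat_eq_real_of_nat)
  also have "\<dots> \<le> (SUP F\<in>{F. finite F \<and> F \<subseteq> int_lattice}. \<Sum>k\<in>F. indicator K (\<xi> + (2*pi) *\<^sub>R k))"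
    by (rule SUP_upper) (use M in auto)
  also have "\<dots> = Per (indicator K) \<xi>"
    unfolding Per_def by (rule nonneg_infsum_complete[symmetric]) simp
  also note B
  finally have "ennreal (real (card M)) \<le> ennreal (max B 0)"
    by (rule order_trans) (simp add: ennreal_leI)
  then show ?thesis by simp
qed

text \<open>
  Meant for a point in the cell of index \<open>n\<close>: it counts the points of its orbit modulo
  \<open>2 \<pi> \<int>\<^sup>n\<close> that lie in \<open>K\<close> and in an earlier cell. Points of \<open>K\<close> in the same orbit thus
  have different ranks.
\<close>

definition orbit_rank :: "(real^'n) set \<Rightarrow> nat \<Rightarrow> real^'n \<Rightarrow> nat" where
  "orbit_rank K n \<xi> = card {m. m < n \<and> \<xi> + (2*pi) *\<^sub>R (lat m - lat n) \<in> K}"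

definition rank_piece :: "(real^'n) set \<Rightarrow> nat \<Rightarrow> (real^'n) set" where
  "rank_piece K r = (\<Union>n. {\<xi>\<in>K. cell (2*pi) \<xi> = lat n \<and> orbit_rank K n \<xi> = r})"

lemma rank_piece_measurable:
  fixes K :: "(real^'n) set"
  assumes K: "K \<in> sets lebesgue"
  shows "rank_piece K r \<in> sets lebesgue"
proof -
  have "{\<xi>\<in>K. cell (2*pi) \<xi> = lat n \<and> orbit_rank K n \<xi> = r} \<in> sets lebesgue" for n
  proof -
    have "orbit_rank K n \<xi> = (\<Sum>m<n. indicator K (\<xi> + (2*pi) *\<^sub>R (lat m - lat n)))" for \<xi>
    proof -
      have "(\<Sum>m<n. indicator K (\<xi> + (2*pi) *\<^sub>R (lat m - lat n))) = (\<Sum>m | m < n \<and> \<xi> + (2*pi) *\<^sub>R (lat m - lat n) \<in> K. 1::nat)"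
        by (rule sum.mono_neutral_cong_right) (auto simp: indicator_def)
      then show ?thesis by (simp add: orbit_rank_def)
    qed
    then have r: "real (orbit_rank K n \<xi>) = (\<Sum>m<n. indicator K (\<xi> + (2*pi) *\<^sub>R (lat m - lat n)))" for \<xi>
      by (simp add: indicator_def of_nat_sum of_bool_def if_distrib cong: if_cong)
    have "(\<lambda>\<xi>. indicator K (\<xi> + (2*pi) *\<^sub>R (lat m - lat n)) :: real) \<in> borel_measurable lebesgue" for m
      by (intro measurable_lebesgue_shift(1) borel_measurable_indicator K)
    then have "(\<lambda>\<xi>. real (orbit_rank K n \<xi>)) \<in> borel_measurable lebesgue"
      unfolding r by (intro borel_measurable_sum)
    then have 1: "{\<xi>. real (orbit_rank K n \<xi>) = real r} \<in> sets lebesgue"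
      using measurable_sets[of "\<lambda>\<xi>. real (orbit_rank K n \<xi>)" lebesgue borel "{real r}"]
      by (simp add: vimage_def)
    have "(\<lambda>\<xi>::real^'n. indicator torus (\<xi> - (2*pi) *\<^sub>R lat n) :: real) \<in> borel_measurable lebesgue"
      by (intro measurable_lebesgue_shift(2) borel_measurable_indicator cube_lebesgue)
    then have t: "{\<xi>::real^'n. (indicator torus (\<xi> - (2*pi) *\<^sub>R lat n) :: real) = 1} \<in> sets lebesgue"
      using measurable_sets[of "\<lambda>\<xi>::real^'n. indicator torus (\<xi> - (2*pi) *\<^sub>R lat n) :: real" lebesgue borel "{1}"]
      by (simp add: vimage_def)
    have ce: "\<xi> - (2*pi) *\<^sub>R lat n \<in> torus \<longleftrightarrow> cell (2*pi) \<xi> = lat n" for \<xi> :: "real^'n"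
      by (subst mem_cube_shift_iff) auto
    have 2: "{\<xi>::real^'n. cell (2*pi) \<xi> = lat n} \<in> sets lebesgue"
      using t unfolding indicator_eq_1_iff ce .
    have "{\<xi>\<in>K. cell (2*pi) \<xi> = lat n \<and> orbit_rank K n \<xi> = r} =
        K \<inter> ({\<xi>. cell (2*pi) \<xi> = lat n} \<inter> {\<xi>. real (orbit_rank K n \<xi>) = real r})"
      by (auto simp only: of_nat_eq_iff)
    then show ?thesis using sets.Int[OF K sets.Int[OF 2 1]] by (simp only:)
  qed
  then show ?thesis unfolding rank_piece_def by (intro sets.countable_UN) auto
qed

lemma orbit_rank_less:
  assumes x: "\<xi> \<in> K" and less: "n < n'" and eq: "\<eta> = \<xi> + (2*pi) *\<^sub>R (lat n' - lat n)"
  shows "orbit_rank K n \<xi> < orbit_rank K n' \<eta>"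
  unfolding orbit_rank_def
proof (rule psubset_card_mono)
  have *: "\<eta> + (2*pi) *\<^sub>R (lat m - lat n') = \<xi> + (2*pi) *\<^sub>R (lat m - lat n)" for m
    by (simp add: eq scaleR_diff_right)
  show "finite {m. m < n' \<and> \<eta> + (2*pi) *\<^sub>R (lat m - lat n') \<in> K}" by simp
  have "n \<in> {m. m < n' \<and> \<eta> + (2*pi) *\<^sub>R (lat m - lat n') \<in> K}"
    using less x unfolding * by simp
  moreover have "n \<notin> {m. m < n \<and> \<xi> + (2*pi) *\<^sub>R (lat m - lat n) \<in> K}" by simp
  moreover have "{m. m < n \<and> \<xi> + (2*pi) *\<^sub>R (lat m - lat n) \<in> K} \<subseteq> {m. m < n' \<and> \<eta> + (2*pi) *\<^sub>R (lat m - lat n') \<in> K}"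
    unfolding * using less by auto
  ultimately show "{m. m < n \<and> \<xi> + (2*pi) *\<^sub>R (lat m - lat n) \<in> K} \<subset> {m. m < n' \<and> \<eta> + (2*pi) *\<^sub>R (lat m - lat n') \<in> K}"
    by blast
qed

lemma translation_free_rank_piece: "translation_free (rank_piece K r)"
  unfolding translation_free_def
proof safe
  fix \<xi> k assume x: "\<xi> \<in> rank_piece K r" and y: "\<xi> + (2*pi) *\<^sub>R k \<in> rank_piece K r"
    and k: "k \<in> int_lattice" "k \<notin> {}"
  let ?\<eta> = "\<xi> + (2*pi) *\<^sub>R k"
  obtain n where n: "\<xi> \<in> K" "cell (2*pi) \<xi> = lat n" "orbit_rank K n \<xi> = r"
    using x by (auto simp: rank_piece_def)
  obtain n' where n': "?\<eta> \<in> K" "cell (2*pi) ?\<eta> = lat n'" "orbit_rank K n' ?\<eta> = r"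
    using y by (auto simp: rank_piece_def)
  have kk: "k = lat n' - lat n" using cell_add[of "2*pi" k \<xi>] k n n' by simp
  then have e1: "?\<eta> = \<xi> + (2*pi) *\<^sub>R (lat n' - lat n)" and e2: "\<xi> = ?\<eta> + (2*pi) *\<^sub>R (lat n - lat n')"
    by (simp_all add: scaleR_diff_right)
  have "n = n'"
    using orbit_rank_less[OF n(1) _ e1] orbit_rank_less[OF n'(1) _ e2] n(3) n'(3) by (metis linorder_neqE_nat less_irrefl)
  then show "k = 0" using kk by simp
qed

text \<open>
  The pieces consist of the points of \<open>K\<close> of equal rank. A bound on the number of points of \<open>K\<close>
  in an orbit bounds the ranks, so finitely many pieces suffice.
\<close>

lemma translation_free_partition_exists:
  fixes K :: "(real^'n) set"
  assumes K: "K \<in> sets lebesgue" and B: "\<And>\<xi>. Per (indicator K) \<xi> \<le> ennreal B"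
  shows "\<exists>p Ks. translation_free_partition K p Ks \<and> (\<forall>i\<in>{1..p}. Ks i \<noteq> {})"
proof -
  define M where "M = nat \<lceil>max B 0\<rceil>"
  define S where "S = rank_piece K ` {..M} - {{}}"
  have "finite S" by (simp add: S_def)
  then obtain h where h: "bij_betw h {1..card S} S" using ex_bij_betw_nat_finite_1 by blast
  have hS: "h i \<in> S" if "i \<in> {1..card S}" for i using h that by (auto simp: bij_betw_def)
  have cover: "K \<subseteq> \<Union>S"
  proof
    fix \<xi> assume x: "\<xi> \<in> K"
    obtain n where n: "lat n = cell (2*pi) \<xi>" using lat_surj[OF cell_lattice] .
    \<comment> \<open>Measured from \<open>\<xi> - 2 \<pi> lat n\<close>, the orbit point in cell \<open>m\<close> is the translate by \<open>2 \<pi> lat m\<close>.\<close>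
    let ?M = "{m. m < n \<and> \<xi> + (2*pi) *\<^sub>R (lat m - lat n) \<in> K}"
    have "real (card ?M) \<le> max B 0"
      by (rule card_le_Per[OF B[of "\<xi> - (2*pi) *\<^sub>R lat n"]]) (auto simp: scaleR_diff_right algebra_simps)
    then have "orbit_rank K n \<xi> \<le> M" unfolding orbit_rank_def M_def by linarith
    moreover have "\<xi> \<in> rank_piece K (orbit_rank K n \<xi>)"
      unfolding rank_piece_def using x n by (intro UN_I[of n]) auto
    ultimately show "\<xi> \<in> \<Union>S" by (auto simp: S_def)
  qed
  have disj: "r = r'" if "\<xi> \<in> rank_piece K r" "\<xi> \<in> rank_piece K r'" for \<xi> r r'
    using that by (auto simp: rank_piece_def lat_inj)
  have "translation_free_partition K (card S) h"
    unfolding translation_free_partition_def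
  proof (intro conjI ballI)
    fix i assume i: "i \<in> {1..card S}"
    from hS[OF i] obtain r where "h i = rank_piece K r" by (auto simp: S_def)
    then show "h i \<in> sets lebesgue" "translation_free (h i)"
      using rank_piece_measurable[OF K] translation_free_rank_piece by auto
  next
    show "disjoint_family_on h {1..card S}"
      unfolding disjoint_family_on_def
    proof (intro ballI impI)
      fix i j assume i: "i \<in> {1..card S}" and j: "j \<in> {1..card S}" and ne: "i \<noteq> j"
      then have "h i \<noteq> h j" using inj_onD[OF bij_betw_imp_inj_on[OF h]] by blast
      moreover obtain r r' where "h i = rank_piece K r" "h j = rank_piece K r'"
        using hS[OF i] hS[OF j] by (auto simp: S_def)
      ultimately show "h i \<inter> h j = {}" using disj by blast
    qed
  next
    have "(\<Union>i\<in>{1..card S}. h i) = \<Union>S" using bij_betw_imp_surj_on[OF h] by (simp only:)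
    also have "\<dots> = K" using cover by (auto simp: S_def rank_piece_def)
    finally show "(\<Union>i\<in>{1..card S}. h i) = K" .
  qed
  moreover have "\<forall>i\<in>{1..card S}. h i \<noteq> {}" using hS by (auto simp: S_def)
  ultimately show ?thesis by blast
qed

section \<open>Integer powers of the dilation\<close>

lemma dilation_dilation: "dilation A (dilation B f) = dilation (B ** A) f"
  by (rule ext) (simp add: dilation_def matrix_vector_mul_assoc det_mul abs_mult real_sqrt_mult)

lemma dilation_one: "dilation (mat 1) f = f"
  by (rule ext) (simp add: dilation_def)

lemma mat_pow_commute: "mat_pow A n ** A = A ** mat_pow A n"
  by (induction n) (simp_all add: matrix_mul_assoc[symmetric])

lemma dilation_funpow: "(dilation A ^^ n) f = dilation (mat_pow A n) f"
  by (induction n) (simp_all add: dilation_one dilation_dilation mat_pow_commute)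

text \<open>
  The matrix for which \<open>D\<^sub>A\<^sup>j\<close> is a single dilation.
\<close>

definition mat_zpow :: "real^'n^'n \<Rightarrow> int \<Rightarrow> real^'n^'n" where
  "mat_zpow A j = (if 0 \<le> j then mat_pow A (nat j) else mat_pow (matrix_inv A) (nat (- j)))"

lemma inv_dilation:
  assumes "invertible A"
  shows "inv (dilation A) = dilation (matrix_inv A)"
  by (rule inv_unique_comp)
    (simp_all add: fun_eq_iff dilation_dilation matrix_inv_left[OF assms] matrix_inv_right[OF assms] dilation_one)

lemma dilation_pow_eq:
  assumes "invertible A"
  shows "dilation_pow A j f = dilation (mat_zpow A j) f"
  by (simp add: dilation_pow_def mat_zpow_def inv_dilation[OF assms] dilation_funpow)

lemma invertible_matrix_inv: "invertible A \<Longrightarrow> invertible (matrix_inv A)"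
  for A :: "real^'n^'n"
  using matrix_inv_left[of A] matrix_inv_right[of A] unfolding invertible_def by blast

lemma det_mat_pow: "det (mat_pow A n) = det A ^ n"
  by (induction n) (simp_all add: det_mul)

lemma det_mat_zpow_nz:
  assumes "invertible A"
  shows "det (mat_zpow A j) \<noteq> 0"
  using assms invertible_matrix_inv[OF assms] by (auto simp: mat_zpow_def det_mat_pow invertible_det_nz)

lemma mat_pow_inverse:
  assumes "invertible A"
  shows "mat_pow (matrix_inv A) n ** mat_pow A n = mat 1" "mat_pow A n ** mat_pow (matrix_inv A) n = mat 1"
proof -
  show "mat_pow (matrix_inv A) n ** mat_pow A n = mat 1"
  proof (induction n)
    case (Suc n)
    have "mat_pow (matrix_inv A) (Suc n) ** mat_pow A (Suc n) =
        mat_pow (matrix_inv A) n ** (matrix_inv A ** A) ** mat_pow A n"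
      by (simp add: mat_pow_commute[of "matrix_inv A", symmetric] matrix_mul_assoc)
    then show ?case using Suc by (simp add: matrix_inv_left[OF assms])
  qed simp
  then show "mat_pow A n ** mat_pow (matrix_inv A) n = mat 1"
    by (rule matrix_left_right_inverse[THEN iffD1])
qed

lemma mat_zpow_inverse:
  assumes "invertible A"
  shows "mat_zpow A j ** mat_zpow A (- j) = mat 1"
  using mat_pow_inverse[OF assms] by (auto simp: mat_zpow_def)

lemma matrix_inv_unique: "invertible A \<Longrightarrow> A ** B = mat 1 \<Longrightarrow> matrix_inv A = B"
  for A B :: "real^'n^'n"
  by (metis matrix_inv_left matrix_mul_assoc matrix_mul_lid matrix_mul_rid)

lemma transpose_matrix_inv: "invertible A \<Longrightarrow> transpose (matrix_inv A) = matrix_inv (transpose A)"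
  for A :: "real^'n^'n"
proof -
  assume A: "invertible A"
  then have "transpose A ** transpose (matrix_inv A) = mat 1"
    by (simp add: matrix_transpose_mul[symmetric] matrix_inv_left transpose_mat)
  moreover have "invertible (transpose A)" using A by (simp add: invertible_det_nz)
  ultimately show ?thesis using matrix_inv_unique by metis
qed

lemma transpose_mat_pow: "transpose (mat_pow A n) = mat_pow (transpose A) n"
  by (induction n) (simp_all add: matrix_transpose_mul transpose_mat mat_pow_commute)

lemma transpose_mat_zpow:
  assumes "invertible A"
  shows "transpose (mat_zpow A j) = mat_zpow (transpose A) j"
  by (simp add: mat_zpow_def transpose_mat_pow transpose_matrix_inv[OF assms])

lemma mat_zpow_step:
  assumes A: "invertible A"
  shows "matrix_inv A ** mat_zpow A (- j) = mat_zpow A (- (j + 1))"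
proof (cases "j \<ge> 0")
  case True
  then have "nat (1 + j) = Suc (nat j)" by simp
  then show ?thesis using True by (auto simp: mat_zpow_def add.commute[of j])
next
  case False
  then have "nat (- j) = Suc (nat (- (j + 1)))" by simp
  then have "mat_zpow A (- j) = A ** mat_pow A (nat (- (j + 1)))" using False by (simp add: mat_zpow_def)
  then show ?thesis using False by (simp add: mat_zpow_def matrix_mul_assoc matrix_inv_left[OF A])
qed

section \<open>Tight frames and the Calderon condition\<close>

text \<open>
  Bessel's inequality passes to limits of truncations because only finitely many coefficients enter.
  Conversely, by the triangle inequality for the coefficient sequences, the coefficients of \<open>f\<close> lose
  at most the norm of \<open>trunc f m - f\<close> compared with those of \<open>trunc f m\<close>.
\<close>

lemma tight_frame_from_dense:
  fixes e :: "'i \<Rightarrow> real^'n \<Rightarrow> complex"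
  assumes e: "\<And>i. i \<in> I \<Longrightarrow> e i \<in> L2"
    and dense: "\<And>f. f \<in> L2 \<Longrightarrow> integrable lebesgue f \<Longrightarrow>
      ((\<lambda>i. (cmod (L2_inner f (e i)))\<^sup>2) has_sum (L2_norm f)\<^sup>2) I"
  shows "normalized_tight_frame I e"
  unfolding normalized_tight_frame_def
proof (intro conjI ballI e)
  have bessel: "(\<Sum>i\<in>S. (cmod (L2_inner f (e i)))\<^sup>2) \<le> (L2_norm f)\<^sup>2"
    if f: "f \<in> L2" and S: "finite S" "S \<subseteq> I" for f S
  proof (rule LIMSEQ_le)
    note F = trunc_L2[OF f]
    show "(\<lambda>m. \<Sum>i\<in>S. (cmod (L2_inner (trunc f m) (e i)))\<^sup>2) \<longlonglongrightarrow> (\<Sum>i\<in>S. (cmod (L2_inner f (e i)))\<^sup>2)"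
      using S e by (intro tendsto_sum tendsto_power tendsto_norm L2_tendsto_inner[OF F f trunc_L2_tendsto[OF f]]) auto
    show "(\<lambda>m. (L2_norm (trunc f m))\<^sup>2) \<longlonglongrightarrow> (L2_norm f)\<^sup>2"
      by (intro tendsto_power L2_tendsto_norm[OF F f trunc_L2_tendsto[OF f]])
    have "(\<Sum>i\<in>S. (cmod (L2_inner (trunc f m) (e i)))\<^sup>2) \<le> (L2_norm (trunc f m))\<^sup>2" for m
      by (rule finite_sum_le_has_sum[OF dense[OF F trunc_integrable[OF f]] S]) simp
    then show "\<exists>N. \<forall>m\<ge>N. (\<Sum>i\<in>S. (cmod (L2_inner (trunc f m) (e i)))\<^sup>2) \<le> (L2_norm (trunc f m))\<^sup>2" by blast
  qed
  fix f :: "real^'n \<Rightarrow> complex" assume f: "f \<in> L2"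
  note F = trunc_L2[OF f]
  let ?c = "\<lambda>i. (cmod (L2_inner f (e i)))\<^sup>2"
  have summ: "?c summable_on I"
    by (rule nonneg_bdd_above_summable_on) (auto intro!: bdd_aboveI[of _ "(L2_norm f)\<^sup>2"] bessel[OF f])
  define s where "s = infsum ?c I"
  have s: "(?c has_sum s) I" unfolding s_def using summ by (rule has_sum_infsum)
  have s_le: "s \<le> (L2_norm f)\<^sup>2"
    using has_sum_le_finite_sums[OF s] bessel[OF f] by blast
  have s0: "0 \<le> s" using s by (rule has_sum_nonneg) simp
  have approx: "L2_norm (trunc f m) \<le> sqrt s + L2_norm (\<lambda>x. trunc f m x - f x)" for m
  proof -
    let ?\<delta> = "L2_norm (\<lambda>x. trunc f m x - f x)"
    have "(L2_norm (trunc f m))\<^sup>2 \<le> (sqrt s + ?\<delta>)\<^sup>2"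
    proof (rule has_sum_le_finite_sums[OF dense[OF F trunc_integrable[OF f]]])
      fix S assume S: "finite S" "S \<subseteq> I"
      let ?L = "\<lambda>h. L2_set (\<lambda>i. cmod (L2_inner h (e i))) S"
      have "?L (trunc f m) \<le> L2_set (\<lambda>i. cmod (L2_inner f (e i)) + cmod (L2_inner (\<lambda>x. trunc f m x - f x) (e i))) S"
      proof (rule L2_set_mono)
        fix i assume "i \<in> S"
        then have "L2_inner (trunc f m) (e i) = L2_inner f (e i) + L2_inner (\<lambda>x. trunc f m x - f x) (e i)"
          using S e by (subst L2_inner_diff[OF F f]) auto
        then show "cmod (L2_inner (trunc f m) (e i)) \<le> cmod (L2_inner f (e i)) + cmod (L2_inner (\<lambda>x. trunc f m x - f x) (e i))"
          by (metis norm_triangle_ineq)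
      qed simp
      also have "\<dots> \<le> ?L f + ?L (\<lambda>x. trunc f m x - f x)" by (rule L2_set_triangle_ineq)
      also have "?L f \<le> sqrt s"
        unfolding L2_set_def using finite_sum_le_has_sum[OF s S] by (intro real_sqrt_le_mono) simp
      also have "?L (\<lambda>x. trunc f m x - f x) \<le> ?\<delta>"
        unfolding L2_set_def using bessel[OF L2_diff[OF F f] S] by (intro real_le_lsqrt) (auto intro: sum_nonneg)
      finally have "(?L (trunc f m))\<^sup>2 \<le> (sqrt s + ?\<delta>)\<^sup>2"
        by (intro power_mono) (auto simp: L2_set_nonneg)
      then show "(\<Sum>i\<in>S. (cmod (L2_inner (trunc f m) (e i)))\<^sup>2) \<le> (sqrt s + ?\<delta>)\<^sup>2"
        by (simp add: L2_set_def sum_nonneg)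
    qed
    then show ?thesis using s0 by (intro power2_le_imp_le[of "L2_norm (trunc f m)"]) auto
  qed
  have "L2_norm f \<le> sqrt s + 0"
  proof (rule LIMSEQ_le)
    show "(\<lambda>m. L2_norm (trunc f m)) \<longlonglongrightarrow> L2_norm f" by (rule L2_tendsto_norm[OF F f trunc_L2_tendsto[OF f]])
    show "(\<lambda>m. sqrt s + L2_norm (\<lambda>x. trunc f m x - f x)) \<longlonglongrightarrow> sqrt s + 0"
      by (intro tendsto_add tendsto_const L2_tendsto_norm_diff[OF F f trunc_L2_tendsto[OF f]])
  qed (use approx in blast)
  then have "(L2_norm f)\<^sup>2 \<le> (sqrt s)\<^sup>2" by (intro power_mono) auto
  then have "s = (L2_norm f)\<^sup>2" using s_le s0 by simp
  then show "(?c has_sum (L2_norm f)\<^sup>2) I" using s by simp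
qed

lemma translation_dilation_L2:
  assumes B: "det B \<noteq> 0" and \<psi>: "\<psi> \<in> L2"
  shows "dilation B (translation k \<psi>) \<in> L2"
proof -
  have "(\<lambda>x. \<psi> (B *v x + (- k))) \<in> L2" by (rule L2_affine(1)[OF B \<psi>])
  from L2_cmult[OF this] show ?thesis unfolding dilation_def translation_def by simp
qed

text \<open>
  Plancherel and the substitution \<open>\<xi> = B\<^sup>T \<eta>\<close> turn the coefficients into the Fourier coefficients
  at lattice points of \<open>G \<eta> = \<psi>h \<eta> * cnj (fourier_L1 f (B\<^sup>T \<eta>))\<close>. It vanishes off the translation-free set
  \<open>E\<close>, and is square integrable since the transform of \<open>f\<close> is bounded; so the Parseval identity
  sums the squares.
\<close>

lemma lattice_translates_sum:
  fixes f \<psi> \<psi>h :: "real^'n \<Rightarrow> complex"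
  assumes B: "invertible B" and f: "f \<in> L2" "integrable lebesgue f"
    and F: "has_fourier \<psi> \<psi>h" and E: "translation_free E" "E \<in> sets lebesgue"
    and off: "AE x in lebesgue. x \<notin> E \<longrightarrow> \<psi>h x = 0"
  shows "(\<integral>\<^sup>+k. ennreal ((cmod (L2_inner f (dilation B (translation k \<psi>))))\<^sup>2) \<partial>count_space int_lattice)
    = ennreal (inverse ((2*pi) ^ CARD('n))) *
      (\<integral>\<^sup>+\<xi>. ennreal ((cmod (fourier_L1 f \<xi>))\<^sup>2 * (cmod (\<psi>h (transpose (matrix_inv B) *v \<xi>)))\<^sup>2) \<partial>lebesgue)"
proof -
  define N where "N = (2*pi) ^ CARD('n)"
  have N: "N > 0" by (simp add: N_def)
  define Bi where "Bi = matrix_inv B"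
  define d where "d = \<bar>det B\<bar>"
  have \<psi>: "\<psi> \<in> L2" and \<psi>h: "\<psi>h \<in> L2" using F by (auto simp: has_fourier_def)
  have dB: "det B \<noteq> 0" using B by (simp add: invertible_det_nz)
  then have d: "d > 0" by (simp add: d_def)
  have BBi: "B ** Bi = mat 1" "Bi ** B = mat 1"
    using matrix_inv_left[OF B] matrix_inv_right[OF B] by (simp_all add: Bi_def)
  have "det B * det Bi = 1" using BBi(1) by (metis det_I det_mul)
  then have dBi: "det Bi \<noteq> 0" "\<bar>det Bi\<bar> = 1 / d"
    using d by (auto simp: d_def field_simps simp flip: abs_mult)
  have TB: "transpose Bi *v (transpose B *v \<eta>) = \<eta>" for \<eta>
  proof -
    have "transpose Bi ** transpose B = mat 1" by (simp only: matrix_transpose_mul[symmetric] BBi transpose_mat)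
    then show ?thesis by (simp only: matrix_vector_mul_assoc matrix_vector_mul_lid)
  qed
  have dT: "det (transpose B) \<noteq> 0" "\<bar>det (transpose B)\<bar> = d" and dTi: "det (transpose Bi) \<noteq> 0"
    using dB dBi by (simp_all add: d_def)
  note fm = L2_measurable[OF f(1)] and \<psi>hm = L2_measurable[OF \<psi>h]
  define G where "G \<eta> = \<psi>h \<eta> * cnj (fourier_L1 f (transpose B *v \<eta>))" for \<eta>
  have fBm: "(\<lambda>\<eta>. fourier_L1 f (transpose B *v \<eta> + 0)) \<in> borel_measurable lebesgue"
    by (rule measurable_lebesgue_affine[OF dT(1) fourier_L1_measurable[OF fm]])
  have Gm: "G \<in> borel_measurable lebesgue"
    unfolding G_def[abs_def] using fBm by (intro borel_measurable_times \<psi>hm borel_measurable_cnj) simp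
  have G: "G \<in> L2"
    by (rule L2_bound[OF Gm \<psi>h, of "LINT x|lebesgue. cmod (f x)"])
      (auto simp: G_def norm_mult mult.commute intro!: mult_left_mono fourier_L1_bound)
  define G' where "G' = (\<lambda>\<eta>. indicator E \<eta> * G \<eta>)"
  have G': "G' \<in> L2" unfolding G'_def by (rule L2_mult_indicator[OF G E(2)])
  have GG': "AE \<eta> in lebesgue. G \<eta> = G' \<eta>"
    using off by eventually_elim (auto simp: G_def G'_def indicator_def)
  have G'n: "ennreal ((L2_norm G')\<^sup>2) = sq_integral G"
    unfolding nn_integral_L2[OF G', symmetric] by (rule nn_integral_cong_AE) (use GG' in auto)
  have fG: "fourier_L1 G k = fourier_L1 G' k" for k
    unfolding fourier_L1_wave
  proof (rule integral_cong_AE)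
    show "(\<lambda>x. G x * cnj (wave k x)) \<in> borel_measurable lebesgue"
      by (intro borel_measurable_times Gm borel_measurable_cnj measurable_wave)
    show "(\<lambda>x. G' x * cnj (wave k x)) \<in> borel_measurable lebesgue"
      by (intro borel_measurable_times L2_measurable[OF G'] borel_measurable_cnj measurable_wave)
  qed (use GG' in auto)
  have coeff: "(cmod (L2_inner f (dilation B (translation k \<psi>))))\<^sup>2 = d / N\<^sup>2 * (cmod (fourier_L1 G' k))\<^sup>2" for k
  proof -
    define h where "h y = f (Bi *v y + Bi *v k)" for y
    have hL: "h \<in> L2" unfolding h_def[abs_def] by (rule L2_affine(1)[OF dBi(1) f(1)])
    have hI: "integrable lebesgue h"
      unfolding h_def[abs_def] using integrable_lebesgue_affine_iff[OF dBi(1) fm] f(2) by blast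
    have um: "(\<lambda>x. f x * cnj (dilation B (translation k \<psi>) x)) \<in> borel_measurable lebesgue"
      by (intro borel_measurable_times fm borel_measurable_cnj L2_measurable translation_dilation_L2[OF dB \<psi>])
    have "L2_inner f (dilation B (translation k \<psi>)) =
        (1 / d) *\<^sub>R (LINT y|lebesgue. f (Bi *v y + Bi *v k) * cnj (dilation B (translation k \<psi>) (Bi *v y + Bi *v k)))"
      unfolding L2_inner_def by (subst integral_lebesgue_affine[OF dBi(1) um, of "Bi *v k"]) (simp only: dBi(2))
    also have "(\<lambda>y. f (Bi *v y + Bi *v k) * cnj (dilation B (translation k \<psi>) (Bi *v y + Bi *v k)))
        = (\<lambda>y. of_real (sqrt d) * (h y * cnj (\<psi> y)))"
    proof
      fix y
      have "B *v (Bi *v y + Bi *v k) - k = y"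
        by (simp add: matrix_vector_right_distrib matrix_vector_mul_assoc BBi)
      then show "f (Bi *v y + Bi *v k) * cnj (dilation B (translation k \<psi>) (Bi *v y + Bi *v k))
          = of_real (sqrt d) * (h y * cnj (\<psi> y))"
        by (simp add: dilation_def translation_def h_def d_def)
    qed
    also have "(1 / d) *\<^sub>R (LINT y|lebesgue. of_real (sqrt d) * (h y * cnj (\<psi> y))) = of_real (sqrt d / d) * L2_inner h \<psi>"
      by (simp add: L2_inner_def scaleR_conv_of_real)
    finally have 1: "L2_inner f (dilation B (translation k \<psi>)) = of_real (sqrt d / d) * L2_inner h \<psi>" .
    have ft: "fourier_L1 h \<eta> = of_real d * (wave k \<eta> * fourier_L1 f (transpose B *v \<eta>))" for \<eta>
    proof -
      have "of_real (1 / d) * fourier_L1 h \<eta> = wave (transpose B *v \<eta>) (Bi *v k) * fourier_L1 f (transpose B *v \<eta>)"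
        using fourier_L1_affine[OF dBi(1) fm, of "Bi *v k" "transpose B *v \<eta>"] unfolding TB dBi(2)
        by (simp add: h_def[abs_def])
      moreover have "(Bi *v k) \<bullet> (transpose B *v \<eta>) = k \<bullet> \<eta>"
      proof -
        have "(Bi *v k) \<bullet> (transpose B *v \<eta>) = (B *v (Bi *v k)) \<bullet> \<eta>"
          by (metis dot_lmul_matrix inner_commute vector_transpose_matrix)
        then show ?thesis by (simp add: matrix_vector_mul_assoc BBi)
      qed
      then have "wave (transpose B *v \<eta>) (Bi *v k) = wave k \<eta>"
        by (simp add: wave_def inner_commute)
      ultimately show ?thesis using d by (simp add: field_simps)
    qed
    have "of_real N * L2_inner \<psi> h = L2_inner \<psi>h (fourier_L1 h)"
      unfolding N_def using has_fourier_inner[OF F hL hI] by simp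
    also have "\<dots> = of_real d * fourier_L1 G k"
    proof -
      have "\<psi>h x * cnj (fourier_L1 h x) = of_real d * (G x * cnj (wave k x))" for x
        unfolding ft G_def by (simp only: complex_cnj_mult complex_cnj_complex_of_real mult_ac)
      then show ?thesis unfolding L2_inner_def fourier_L1_wave[of G] by simp
    qed
    finally have "cmod (of_real N * L2_inner \<psi> h) = cmod (of_real d * fourier_L1 G' k)" by (simp add: fG)
    then have "N * cmod (L2_inner \<psi> h) = d * cmod (fourier_L1 G' k)" using N d by (simp add: norm_mult)
    then have 2: "cmod (L2_inner h \<psi>) = d / N * cmod (fourier_L1 G' k)"
      using N by (subst L2_inner_cnj) (simp add: field_simps)
    have "(cmod (L2_inner f (dilation B (translation k \<psi>))))\<^sup>2 = (sqrt d / d)\<^sup>2 * (d / N * cmod (fourier_L1 G' k))\<^sup>2"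
      unfolding 1 norm_mult 2 norm_of_real power_mult_distrib power2_abs ..
    also have "\<dots> = d / N\<^sup>2 * (cmod (fourier_L1 G' k))\<^sup>2"
      using d N by (simp add: power_mult_distrib power_divide)
    finally show ?thesis .
  qed
  have "((\<lambda>k. (cmod (fourier_L1 G' k))\<^sup>2) has_sum N * (L2_norm G')\<^sup>2) int_lattice"
    unfolding N_def by (rule Parseval_translation_free[OF E _ G']) (simp add: G'_def)
  from has_sum_cmult_right[OF this, of "d / N\<^sup>2"]
  have "((\<lambda>k. (cmod (L2_inner f (dilation B (translation k \<psi>))))\<^sup>2) has_sum d / N\<^sup>2 * (N * (L2_norm G')\<^sup>2)) int_lattice"
    unfolding coeff .
  from has_sum_imp_nn_integral[OF _ this]
  have "(\<integral>\<^sup>+k. ennreal ((cmod (L2_inner f (dilation B (translation k \<psi>))))\<^sup>2) \<partial>count_space int_lattice)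
      = ennreal (d / N\<^sup>2 * (N * (L2_norm G')\<^sup>2))" by simp
  also have "d / N\<^sup>2 * (N * (L2_norm G')\<^sup>2) = inverse N * (d * (L2_norm G')\<^sup>2)"
    using N by (simp add: power2_eq_square field_simps)
  also have "ennreal \<dots> = ennreal (inverse N) * (ennreal d * sq_integral G)"
    using N d by (simp add: ennreal_mult G'n[symmetric])
  also have "ennreal d * sq_integral G =
      (\<integral>\<^sup>+\<xi>. ennreal ((cmod (fourier_L1 f \<xi>))\<^sup>2 * (cmod (\<psi>h (transpose Bi *v \<xi>)))\<^sup>2) \<partial>lebesgue)"
  proof -
    have "(\<lambda>\<xi>. \<psi>h (transpose Bi *v \<xi> + 0)) \<in> borel_measurable lebesgue"
      by (rule measurable_lebesgue_affine[OF dTi \<psi>hm])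
    then have m: "(\<lambda>\<xi>. ennreal ((cmod (fourier_L1 f \<xi>))\<^sup>2 * (cmod (\<psi>h (transpose Bi *v \<xi>)))\<^sup>2)) \<in> borel_measurable lebesgue"
      using fourier_L1_measurable[OF fm] by simp
    have "(\<integral>\<^sup>+\<xi>. ennreal ((cmod (fourier_L1 f \<xi>))\<^sup>2 * (cmod (\<psi>h (transpose Bi *v \<xi>)))\<^sup>2) \<partial>lebesgue)
       = ennreal d * (\<integral>\<^sup>+\<eta>. ennreal ((cmod (fourier_L1 f (transpose B *v \<eta> + 0)))\<^sup>2 * (cmod (\<psi>h (transpose Bi *v (transpose B *v \<eta> + 0))))\<^sup>2) \<partial>lebesgue)"
      using nn_integral_lebesgue_affine[OF dT(1) m, of 0] unfolding dT(2) .
    then show ?thesis by (simp only: add_0_right TB G_def norm_mult power_mult_distrib complex_mod_cnj mult.commute)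
  qed
  finally show ?thesis unfolding N_def Bi_def .
qed

lemma sum_telescope_int:
  fixes s :: "int \<Rightarrow> real"
  shows "(\<Sum>j\<in>{- int n..<int n}. s (j + 1) - s j) = s (int n) - s (- int n)"
proof (induction n)
  case (Suc n)
  have "{- int (Suc n)..<int (Suc n)} = insert (int n) (insert (- 1 - int n) {- int n..<int n})" by auto
  then show ?case using Suc by (simp add: algebra_simps)
qed simp

lemma has_sum_telescope_int:
  fixes s :: "int \<Rightarrow> real"
  assumes mono: "\<And>j. s j \<le> s (j + 1)"
    and top: "(\<lambda>n. s (int n)) \<longlonglongrightarrow> b" and bot: "(\<lambda>n. s (- int n)) \<longlonglongrightarrow> a"
  shows "((\<lambda>j. s (j + 1) - s j) has_sum (b - a)) UNIV"
proof (rule has_sum_nonnegI)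
  have up: "s (int n) \<le> b" for n
  proof (rule incseq_le[OF _ top])
    show "incseq (\<lambda>n. s (int n))" by (rule incseq_SucI) (use mono[of "int _"] in \<open>simp add: add.commute\<close>)
  qed
  have low: "a \<le> s (- int n)" for n
  proof (rule decseq_ge[OF _ bot])
    show "decseq (\<lambda>n. s (- int n))"
    proof (rule decseq_SucI)
      fix n show "s (- int (Suc n)) \<le> s (- int n)" using mono[of "- int (Suc n)"] by simp
    qed
  qed
  show "0 \<le> s (j + 1) - s j" for j using mono[of j] by simp
  fix F :: "int set" assume F: "finite F"
  have "F \<subseteq> {- int n..<int n}" if n: "n = Suc (nat (Max (insert 0 (abs ` F))))" for n
  proof
    fix j assume "j \<in> F"
    then have "\<bar>j\<bar> \<le> Max (insert 0 (abs ` F))" using F by (intro Max_ge) auto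
    then show "j \<in> {- int n..<int n}" using n by auto
  qed
  then obtain n where "F \<subseteq> {- int n..<int n}" by blast
  then have "(\<Sum>j\<in>F. s (j + 1) - s j) \<le> (\<Sum>j\<in>{- int n..<int n}. s (j + 1) - s j)"
    using mono by (intro sum_mono2) (auto simp: algebra_simps)
  also have "\<dots> \<le> b - a" unfolding sum_telescope_int using up[of n] low[of n] by simp
  finally show "(\<Sum>j\<in>F. s (j + 1) - s j) \<le> b - a" .
next
  fix e :: real assume "e > 0"
  then have "\<forall>\<^sub>F n in sequentially. b - a - e < s (int n) - s (- int n)"
    by (intro order_tendstoD(1)[OF tendsto_diff[OF top bot]]) simp
  from eventually_happens'[OF sequentially_bot this]
  obtain n where "b - a - e < s (int n) - s (- int n)" by blast
  then show "\<exists>F. finite F \<and> F \<subseteq> UNIV \<and> b - a - e \<le> (\<Sum>j\<in>F. s (j + 1) - s j)"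
    by (intro exI[of _ "{- int n..<int n}"]) (simp add: sum_telescope_int)
qed

lemma nn_integral_count_space_Times:
  "(\<integral>\<^sup>+p. f p \<partial>count_space (A \<times> B)) = (\<integral>\<^sup>+x. (\<integral>\<^sup>+y. f (x, y) \<partial>count_space B) \<partial>count_space A)"
proof -
  have "(\<integral>\<^sup>+p. f p \<partial>count_space (A \<times> B)) = (\<integral>\<^sup>+p. f p * indicator (A \<times> B) p \<partial>count_space UNIV)"
    by (rule nn_integral_count_space_indicator) simp
  also have "\<dots> = (\<integral>\<^sup>+x. (\<integral>\<^sup>+y. f (x, y) * indicator (A \<times> B) (x, y) \<partial>count_space UNIV) \<partial>count_space UNIV)"
    by (rule nn_integral_fst_count_space[symmetric])
  also have "\<dots> = (\<integral>\<^sup>+x. (\<integral>\<^sup>+y. f (x, y) * indicator B y \<partial>count_space UNIV) * indicator A x \<partial>count_space UNIV)"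
    by (intro nn_integral_cong) (auto simp: indicator_def)
  finally show ?thesis
    by (simp add: nn_integral_count_space_indicator[of A] nn_integral_count_space_indicator[of B])
qed

lemma expansive_invertible:
  fixes A :: "real^'n^'n"
  assumes "\<And>l. complex_eigenvalue A l \<Longrightarrow> cmod l > 1"
  shows "invertible A"
proof (rule ccontr)
  assume "\<not> invertible A"
  then obtain x where x: "x \<noteq> 0" "A *v x = 0"
    unfolding invertible_left_inverse matrix_left_invertible_ker by blast
  define v :: "complex^'n" where "v = (\<chi> i. of_real (x $ i))"
  have "v \<noteq> 0" using x(1) by (auto simp: v_def vec_eq_iff)
  moreover have "(\<chi> i j. complex_of_real (A $ i $ j)) *v v = 0 *s v"
  proof -
    have "((\<chi> i j. complex_of_real (A $ i $ j)) *v v) $ i = of_real ((A *v x) $ i)" for i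
      by (simp add: matrix_vector_mult_def v_def)
    then show ?thesis by (simp add: vec_eq_iff x(2))
  qed
  ultimately have "complex_eigenvalue A 0" unfolding complex_eigenvalue_def by blast
  from assms[OF this] show False by simp
qed

lemma L2_inner_AE_zero:
  assumes "AE x in lebesgue. g x = 0"
  shows "L2_inner f g = 0"
  unfolding L2_inner_def
proof (rule integral_eq_zero_AE)
  show "AE x in lebesgue. f x * cnj (g x) = 0" using assms by eventually_elim simp
qed

lemma transpose_inv_zpow:
  assumes A: "invertible A"
  shows "transpose (matrix_inv (mat_zpow A j)) = mat_zpow (transpose A) (- j)"
proof -
  have "matrix_inv (mat_zpow A j) = mat_zpow A (- j)"
    using det_mat_zpow_nz[OF A, of j] mat_zpow_inverse[OF A, of j]
    by (intro matrix_inv_unique) (simp_all add: invertible_det_nz)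
  then show ?thesis by (simp add: transpose_mat_zpow[OF A])
qed

text \<open>
  The sums over the lattice turn the coefficient sum into
  \<open>(2 \<pi>)\<^sup>-\<^sup>n\<close> times the integral of \<open>\<bar>fourier_L1 f\<bar>\<^sup>2\<close> against the function that the
  Calderon condition says to be 1.
\<close>

lemma multiwavelet_criterion:
  fixes A :: "real^'n^'n" and \<psi> \<psi>h :: "nat \<Rightarrow> real^'n \<Rightarrow> complex"
  assumes A: "invertible A" and J: "finite J"
    and F: "\<And>i. i \<in> J \<Longrightarrow> has_fourier (\<psi> i) (\<psi>h i)"
    and E: "\<And>i. i \<in> J \<Longrightarrow> translation_free (E i)" "\<And>i. i \<in> J \<Longrightarrow> E i \<in> sets lebesgue"
    and off: "\<And>i. i \<in> J \<Longrightarrow> AE x in lebesgue. x \<notin> E i \<longrightarrow> \<psi>h i x = 0"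
    and calderon: "AE \<xi> in lebesgue. ((\<lambda>j. \<Sum>i\<in>J. (cmod (\<psi>h i (mat_zpow (transpose A) (- j) *v \<xi>)))\<^sup>2) has_sum 1) UNIV"
  shows "NTF_multiwavelet A {i\<in>J. \<not> (AE x in lebesgue. \<psi> i x = 0)} \<psi>"
  unfolding NTF_multiwavelet_def
proof (rule tight_frame_from_dense)
  define I where "I = {i\<in>J. \<not> (AE x in lebesgue. \<psi> i x = 0)}"
  have I: "I \<subseteq> J" "finite I" using J by (auto simp: I_def)
  define N where "N = (2*pi) ^ CARD('n)"
  have N: "N > 0" by (simp add: N_def)
  have det: "det (mat_zpow A j) \<noteq> 0" for j by (rule det_mat_zpow_nz[OF A])
  have inv: "invertible (mat_zpow A j)" for j using det by (simp add: invertible_det_nz)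
  let ?Z = "\<lambda>j. mat_zpow (transpose A) (- j)"
  have detZ: "det (?Z j) \<noteq> 0" for j
    using A by (intro det_mat_zpow_nz) (simp add: invertible_det_nz)
  show "(case q of (j, k, i) \<Rightarrow> dilation_pow A j (translation k (\<psi> i))) \<in> L2"
    if "q \<in> UNIV \<times> int_lattice \<times> {i\<in>J. \<not> (AE x in lebesgue. \<psi> i x = 0)}" for q
    using that F by (auto simp: dilation_pow_eq[OF A] has_fourier_def intro!: translation_dilation_L2[OF det])
  fix f :: "real^'n \<Rightarrow> complex" assume f: "f \<in> L2" "integrable lebesgue f"
  note fhm = fourier_L1_measurable[OF L2_measurable[OF f(1)]]
  define c where "c j k i = (cmod (L2_inner f (dilation (mat_zpow A j) (translation k (\<psi> i)))))\<^sup>2" for j k i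
  define X where "X j i \<xi> = (cmod (fourier_L1 f \<xi>))\<^sup>2 * (cmod (\<psi>h i (?Z j *v \<xi>)))\<^sup>2" for j i \<xi>
  have \<psi>hm: "(\<lambda>\<xi>. \<psi>h i (?Z j *v \<xi>)) \<in> borel_measurable lebesgue" if "i \<in> J" for i j
  proof -
    have "\<psi>h i \<in> borel_measurable lebesgue" using F[OF that] by (auto simp: has_fourier_def L2_measurable)
    from measurable_lebesgue_affine[OF detZ this, of j 0] show ?thesis by simp
  qed
  have Xm: "(\<lambda>\<xi>. ennreal (X j i \<xi>)) \<in> borel_measurable lebesgue" if "i \<in> J" for i j
    unfolding X_def using \<psi>hm[OF that, of j] fhm by measurable
  have lattice: "(\<integral>\<^sup>+k. ennreal (c j k i) \<partial>count_space int_lattice) = ennreal (inverse N) * (\<integral>\<^sup>+\<xi>. ennreal (X j i \<xi>) \<partial>lebesgue)"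
    if "i \<in> J" for i j
    unfolding c_def X_def N_def
    using lattice_translates_sum[OF inv f F[OF that] E(1)[OF that] E(2)[OF that] off[OF that], of j]
    unfolding transpose_inv_zpow[OF A] .
  \<comment> \<open>Discarded generators have only zero coefficients, so the sums may run over all of \<open>J\<close>.\<close>
  have zero: "c j k i = 0" if "i \<in> J - I" for j k i
  proof -
    have "AE x in lebesgue. \<psi> i x = 0" using that by (auto simp: I_def)
    then have "AE x in lebesgue. \<psi> i (mat_zpow A j *v x + (- k)) = 0" by (rule AE_lebesgue_affine[OF det])
    then have "AE x in lebesgue. dilation (mat_zpow A j) (translation k (\<psi> i)) x = 0"
      by eventually_elim (simp add: dilation_def translation_def)
    then show ?thesis unfolding c_def by (simp add: L2_inner_AE_zero)
  qed
  have scale: "(\<integral>\<^sup>+k. (\<integral>\<^sup>+i. ennreal (c j k i) \<partial>count_space I) \<partial>count_space int_lattice)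
      = ennreal (inverse N) * (\<integral>\<^sup>+\<xi>. ennreal (\<Sum>i\<in>J. X j i \<xi>) \<partial>lebesgue)" for j
  proof -
    have "(\<integral>\<^sup>+k. (\<integral>\<^sup>+i. ennreal (c j k i) \<partial>count_space I) \<partial>count_space int_lattice)
        = (\<integral>\<^sup>+k. (\<Sum>i\<in>J. ennreal (c j k i)) \<partial>count_space int_lattice)"
      unfolding nn_integral_count_space_finite[OF I(2)]
      using J I(1) zero by (intro nn_integral_cong sum.mono_neutral_left) auto
    also have "\<dots> = (\<Sum>i\<in>J. \<integral>\<^sup>+k. ennreal (c j k i) \<partial>count_space int_lattice)"
      by (rule nn_integral_sum) simp
    also have "\<dots> = (\<Sum>i\<in>J. ennreal (inverse N) * (\<integral>\<^sup>+\<xi>. ennreal (X j i \<xi>) \<partial>lebesgue))"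
      by (intro sum.cong refl lattice)
    also have "\<dots> = ennreal (inverse N) * (\<integral>\<^sup>+\<xi>. (\<Sum>i\<in>J. ennreal (X j i \<xi>)) \<partial>lebesgue)"
      using Xm by (subst nn_integral_sum) (auto simp: sum_distrib_left)
    also have "(\<integral>\<^sup>+\<xi>. (\<Sum>i\<in>J. ennreal (X j i \<xi>)) \<partial>lebesgue) = (\<integral>\<^sup>+\<xi>. ennreal (\<Sum>i\<in>J. X j i \<xi>) \<partial>lebesgue)"
      by (intro nn_integral_cong sum_ennreal) (simp add: X_def)
    finally show ?thesis .
  qed
  have Xsm: "(\<lambda>\<xi>. ennreal (\<Sum>i\<in>J. X j i \<xi>)) \<in> borel_measurable lebesgue" for j
  proof -
    have "(\<lambda>\<xi>. X j i \<xi>) \<in> borel_measurable lebesgue" if "i \<in> J" for i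
      unfolding X_def using \<psi>hm[OF that, of j] fhm by measurable
    then have "(\<lambda>\<xi>. \<Sum>i\<in>J. X j i \<xi>) \<in> borel_measurable lebesgue" by (rule borel_measurable_sum)
    then show ?thesis by measurable
  qed
  have "(\<integral>\<^sup>+q. ennreal (case q of (j, k, i) \<Rightarrow> c j k i) \<partial>count_space (UNIV \<times> int_lattice \<times> I))
      = (\<integral>\<^sup>+j. (\<integral>\<^sup>+k. (\<integral>\<^sup>+i. ennreal (c j k i) \<partial>count_space I) \<partial>count_space int_lattice) \<partial>count_space UNIV)"
    by (simp add: nn_integral_count_space_Times)
  also have "\<dots> = ennreal (inverse N) * (\<integral>\<^sup>+j. (\<integral>\<^sup>+\<xi>. ennreal (\<Sum>i\<in>J. X j i \<xi>) \<partial>lebesgue) \<partial>count_space UNIV)"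
    unfolding scale by (rule nn_integral_cmult) simp
  also have "(\<integral>\<^sup>+j. (\<integral>\<^sup>+\<xi>. ennreal (\<Sum>i\<in>J. X j i \<xi>) \<partial>lebesgue) \<partial>count_space UNIV)
      = (\<integral>\<^sup>+\<xi>. (\<integral>\<^sup>+j. ennreal (\<Sum>i\<in>J. X j i \<xi>) \<partial>count_space UNIV) \<partial>lebesgue)"
    by (rule nn_integral_count_space_nn_integral[symmetric]) (simp_all add: Xsm)
  also have "\<dots> = sq_integral (fourier_L1 f)"
  proof (rule nn_integral_cong_AE)
    show "AE \<xi> in lebesgue. (\<integral>\<^sup>+j. ennreal (\<Sum>i\<in>J. X j i \<xi>) \<partial>count_space UNIV) = ennreal ((cmod (fourier_L1 f \<xi>))\<^sup>2)"
      using calderon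
    proof eventually_elim
      case (elim \<xi>)
      from has_sum_cmult_right[OF this, of "(cmod (fourier_L1 f \<xi>))\<^sup>2"]
      have "((\<lambda>j. \<Sum>i\<in>J. X j i \<xi>) has_sum (cmod (fourier_L1 f \<xi>))\<^sup>2) UNIV"
        by (simp add: X_def sum_distrib_left)
      then show ?case by (intro has_sum_imp_nn_integral) (auto simp: X_def intro: sum_nonneg)
    qed
  qed
  also have "ennreal (inverse N) * \<dots> = ennreal ((L2_norm f)\<^sup>2)"
    unfolding nn_integral_L2[OF fourier_L1_L2[OF f]] fourier_L1_norm[OF f] N_def[symmetric]
    using N by (simp flip: ennreal_mult)
  finally have eq: "(\<integral>\<^sup>+q. ennreal (case q of (j, k, i) \<Rightarrow> c j k i) \<partial>count_space (UNIV \<times> int_lattice \<times> I)) = ennreal ((L2_norm f)\<^sup>2)" .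
  have "((\<lambda>q. case q of (j, k, i) \<Rightarrow> c j k i) has_sum (L2_norm f)\<^sup>2) (UNIV \<times> int_lattice \<times> I)"
    by (rule nn_integral_imp_has_sum[OF _ _ eq]) (auto simp: c_def)
  also have "(\<lambda>q. case q of (j, k, i) \<Rightarrow> c j k i) =
      (\<lambda>q. (cmod (L2_inner f (case q of (j, k, i) \<Rightarrow> dilation_pow A j (translation k (\<psi> i)))))\<^sup>2)"
    by (auto simp: c_def dilation_pow_eq[OF A])
  finally show "((\<lambda>q. (cmod (L2_inner f (case q of (j, k, i) \<Rightarrow> dilation_pow A j (translation k (\<psi> i)))))\<^sup>2)
      has_sum (L2_norm f)\<^sup>2) (UNIV \<times> int_lattice \<times> {i\<in>J. \<not> (AE x in lebesgue. \<psi> i x = 0)})"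
    unfolding I_def .
qed

section \<open>Multiwavelets from a scaling function\<close>

text \<open>
  The closed cubes overlap only in their boundaries, a null set.
\<close>

lemma AE_closed_cell_unique:
  "AE \<xi> in lebesgue. \<forall>k\<in>int_lattice.
     \<xi> \<in> (\<lambda>x. x + (2 * pi) *\<^sub>R k) ` cbox (vec (- pi)) (vec pi) \<longleftrightarrow> k = cell (2*pi) (\<xi> + vec pi :: real^'n)"
proof -
  have "cbox (vec (- pi)) (vec pi) - box (vec (- pi)) (vec pi) \<in> null_sets (lebesgue :: (real^'n) measure)"
    using negligible_frontier_interval unfolding negligible_iff_null_sets .
  then have ae: "AE x in lebesgue. x \<notin> cbox (vec (- pi)) (vec pi) - (box (vec (- pi)) (vec pi) :: (real^'n) set)"
    by (rule AE_not_in)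
  have d: "det (mat 1 :: real^'n^'n) \<noteq> 0" by simp
  have "AE \<xi> in lebesgue. \<xi> - (2*pi) *\<^sub>R k \<notin> cbox (vec (- pi)) (vec pi) - (box (vec (- pi)) (vec pi) :: (real^'n) set)" for k
    using AE_lebesgue_affine[OF d ae, of "- ((2*pi) *\<^sub>R k)"] by simp
  then have "AE \<xi> in lebesgue. \<forall>k\<in>int_lattice. \<xi> - (2*pi) *\<^sub>R k \<notin> cbox (vec (- pi)) (vec pi) - (box (vec (- pi)) (vec pi) :: (real^'n) set)"
    by (subst AE_ball_countable[OF countable_lattice]) blast
  then show ?thesis
  proof eventually_elim
    case (elim \<xi>)
    show ?case
    proof
      fix k :: "real^'n" assume k: "k \<in> int_lattice"
      have im: "\<xi> \<in> (\<lambda>x. x + (2 * pi) *\<^sub>R k) ` cbox (vec (- pi)) (vec pi) \<longleftrightarrow> \<xi> - (2*pi) *\<^sub>R k \<in> cbox (vec (- pi)) (vec pi)"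
        by (force simp: image_iff)
      have sub: "box (vec (- pi)) (vec pi) \<subseteq> (centred_cube 1 :: (real^'n) set)" "centred_cube 1 \<subseteq> (cbox (vec (- pi)) (vec pi) :: (real^'n) set)"
        by (auto simp: centred_cube_def mem_box_cart less_imp_le)
      have "\<xi> - (2*pi) *\<^sub>R k \<in> cbox (vec (- pi)) (vec pi) \<longleftrightarrow> \<xi> - (2*pi) *\<^sub>R k \<in> centred_cube 1"
        using elim k sub by blast
      also have "\<dots> \<longleftrightarrow> (\<xi> + vec pi) - (2*pi) *\<^sub>R k \<in> torus"
        by (simp add: centred_cube_eq algebra_simps)
      also have "\<dots> \<longleftrightarrow> k = cell (2*pi) (\<xi> + vec pi)"
        by (rule mem_cube_shift_iff[OF _ k]) simp
      finally show "\<xi> \<in> (\<lambda>x. x + (2 * pi) *\<^sub>R k) ` cbox (vec (- pi)) (vec pi) \<longleftrightarrow> k = cell (2*pi) (\<xi> + vec pi)"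
        unfolding im .
    qed
  qed
qed

lemma bounded_support_fourier:
  fixes g :: "real^'n \<Rightarrow> complex"
  assumes g: "g \<in> L2" and off: "\<And>x. x \<notin> centred_cube R \<Longrightarrow> g x = 0"
  shows "\<exists>f. has_fourier f g"
proof -
  have "(\<lambda>x. indicator (centred_cube R) x * g x) = g"
    by (rule ext) (use off in \<open>auto simp: indicator_def\<close>)
  then have "integrable lebesgue g" using L2_compact_integrable[OF g, of R] by simp
  then show ?thesis by (rule fourier_surjective[OF g])
qed

theorem mainTheorem4:
  fixes A :: "real^'n^'n"
    and \<sigma> :: "real^'n \<Rightarrow> real"
    and K :: "(real^'n) set"
    and \<phi>hat :: "real^'n \<Rightarrow> real^'n \<Rightarrow> complex"
  assumes A_expansive: "\<And>l. complex_eigenvalue A l \<Longrightarrow> cmod l > 1"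
    and A_lattice: "\<And>k. k \<in> int_lattice \<Longrightarrow> A *v k \<in> int_lattice"
    and \<sigma>_measurable: "\<sigma> \<in> borel_measurable lebesgue"
    and a: "integrable lebesgue \<sigma>" "\<And>\<xi>. \<sigma> \<xi> \<ge> 0"
    and b: "AE \<xi> in lebesgue. \<sigma> (transpose A *v \<xi>) \<le> \<sigma> \<xi>"
    and K_eq: "K = {\<xi>. \<sigma> (matrix_inv (transpose A) *v \<xi>) - \<sigma> \<xi> \<noteq> 0}"
    and c: "\<exists>B::real. \<forall>\<xi>. Per (indicator K) \<xi> \<le> ennreal B"
    and d: "AE \<xi> in lebesgue.
              (\<lambda>J. \<sigma> (mat_pow (matrix_inv (transpose A)) J *v \<xi>)) \<longlonglongrightarrow> 1"
    and e: "AE \<xi> in lebesgue. (\<lambda>J. \<sigma> (mat_pow (transpose A) J *v \<xi>)) \<longlonglongrightarrow> 0"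
    and \<phi>hat_eq: "\<phi>hat = (\<lambda>k \<xi>.
              if \<xi> \<in> (\<lambda>x. x + (2 * pi) *\<^sub>R k) ` cbox (vec (- pi)) (vec pi)
              then complex_of_real (sqrt (\<sigma> \<xi>)) else 0)"
  shows "(\<exists>p Ks. translation_free_partition K p Ks \<and> (\<forall>i\<in>{1..p}. Ks i \<noteq> {})) \<and>
    (\<forall>p Ks. \<forall>\<psi>hat :: nat \<Rightarrow> real^'n \<Rightarrow> complex.
       translation_free_partition K p Ks \<longrightarrow>
       (\<forall>i\<in>{1..p}. \<psi>hat i \<in> borel_measurable lebesgue \<and>
          (AE \<xi> in lebesgue. (cmod (\<psi>hat i \<xi>))\<^sup>2 =
             (if \<xi> \<in> Ks i then \<sigma> (matrix_inv (transpose A) *v \<xi>) - \<sigma> \<xi> else 0))) \<longrightarrow>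
       (\<exists>\<phi>. \<forall>k\<in>int_lattice. \<phi> k \<in> L2 \<and> has_fourier (\<phi> k) (\<phi>hat k)) \<and>
       (\<exists>\<psi>. \<forall>i\<in>{1..p}. \<psi> i \<in> L2 \<and> has_fourier (\<psi> i) (\<psi>hat i)) \<and>
       (AE \<xi> in lebesgue. ((\<lambda>k. (cmod (\<phi>hat k \<xi>))\<^sup>2) has_sum \<sigma> \<xi>) int_lattice) \<and>
       (AE \<xi> in lebesgue.
          ((\<lambda>j. \<Sum>i=1..p. (cmod (\<psi>hat i (mat_pow (transpose A) j *v \<xi>)))\<^sup>2) has_sum \<sigma> \<xi>) {1..}) \<and>
       (\<forall>\<psi>. (\<forall>i\<in>{1..p}. has_fourier (\<psi> i) (\<psi>hat i)) \<longrightarrow>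
          NTF_multiwavelet A {i\<in>{1..p}. \<not> (AE x in lebesgue. \<psi> i x = 0)} \<psi>))"
proof -
  let ?T = "transpose A"
  let ?Ti = "matrix_inv ?T"
  define \<tau> where "\<tau> \<xi> = \<sigma> (?Ti *v \<xi>) - \<sigma> \<xi>" for \<xi>
  have A: "invertible A" using A_expansive by (rule expansive_invertible)
  then have T: "invertible ?T" by (simp add: invertible_det_nz)
  have Ti: "invertible ?Ti" by (rule invertible_matrix_inv[OF T])
  have dTi: "det ?Ti \<noteq> 0" using Ti by (simp add: invertible_det_nz)
  have \<sigma>Ti_m: "(\<lambda>\<xi>. \<sigma> (?Ti *v \<xi>)) \<in> borel_measurable lebesgue"
    using measurable_lebesgue_affine[OF dTi \<sigma>_measurable, of 0] by simp
  have \<sigma>Ti_i: "integrable lebesgue (\<lambda>\<xi>. \<sigma> (?Ti *v \<xi>))"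
    using integrable_lebesgue_affine_iff[OF dTi \<sigma>_measurable, of 0] a(1) by simp
  have \<tau>_i: "integrable lebesgue \<tau>"
    unfolding \<tau>_def[abs_def] by (rule Bochner_Integration.integrable_diff[OF \<sigma>Ti_i a(1)])
  have K_\<tau>: "\<xi> \<in> K \<longleftrightarrow> \<tau> \<xi> \<noteq> 0" for \<xi> by (simp add: K_eq \<tau>_def)
  have K_m: "K \<in> sets lebesgue"
  proof -
    have "\<tau> -` (- {0}) \<inter> space lebesgue \<in> sets lebesgue"
      by (rule measurable_sets[of _ _ borel]) (use \<tau>_i in auto)
    moreover have "\<tau> -` (- {0}) \<inter> space lebesgue = K" using K_\<tau> by auto
    ultimately show ?thesis by simp
  qed
  obtain B where B: "\<And>\<xi>. Per (indicator K) \<xi> \<le> ennreal B" using c by blast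
  \<comment> \<open>The values of \<open>\<sigma>\<close> along the orbit of \<open>\<xi>\<close>, indexed so that they increase with \<open>j\<close>.\<close>
  define t where "t j \<xi> = \<sigma> (mat_zpow ?T (- j) *v \<xi>)" for j \<xi>
  have t_step: "\<sigma> (?Ti *v (mat_zpow ?T (- j) *v \<xi>)) = t (j + 1) \<xi>" for j \<xi>
    unfolding t_def matrix_vector_mul_assoc mat_zpow_step[OF T] ..
  have \<tau>_t: "\<tau> (mat_zpow ?T (- j) *v \<xi>) = t (j + 1) \<xi> - t j \<xi>" for j \<xi>
    unfolding \<tau>_def t_step by (simp add: t_def)
  have orbit: "AE \<xi> in lebesgue. \<forall>j. P (mat_zpow ?T (- j) *v \<xi>)" if P: "AE \<xi> in lebesgue. P \<xi>" for P
    unfolding AE_all_countable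
  proof
    fix j
    show "AE \<xi> in lebesgue. P (mat_zpow ?T (- j) *v \<xi>)"
      using AE_lebesgue_affine[OF det_mat_zpow_nz[OF T, of "- j"] P, of 0] by simp
  qed
  have \<tau>_nonneg: "AE \<xi> in lebesgue. 0 \<le> \<tau> \<xi>"
  proof -
    have "AE \<xi> in lebesgue. \<sigma> (?T *v (?Ti *v \<xi> + 0)) \<le> \<sigma> (?Ti *v \<xi> + 0)"
      by (rule AE_lebesgue_affine[OF dTi b])
    then show ?thesis
      by eventually_elim (simp add: \<tau>_def matrix_vector_mul_assoc matrix_inv_right[OF T])
  qed
  have t_top: "AE \<xi> in lebesgue. (\<lambda>n. t (int n) \<xi>) \<longlonglongrightarrow> 1"
  proof -
    have "t (int n) \<xi> = \<sigma> (mat_pow ?Ti n *v \<xi>)" for n \<xi>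
      by (cases "n = 0") (auto simp: t_def mat_zpow_def)
    then show ?thesis using d by simp
  qed
  have t_bot_eq: "t (- int n) \<xi> = \<sigma> (mat_pow ?T n *v \<xi>)" for n \<xi>
    by (simp add: t_def mat_zpow_def)
  have t_bot: "AE \<xi> in lebesgue. (\<lambda>n. t (- int n) \<xi>) \<longlonglongrightarrow> 0"
    unfolding t_bot_eq by (rule e)
  have t_mono: "AE \<xi> in lebesgue. \<forall>j. t j \<xi> \<le> t (j + 1) \<xi>"
    using orbit[OF \<tau>_nonneg] unfolding \<tau>_t by simp
  have phi_exists: "\<exists>\<phi>. \<forall>k\<in>int_lattice. \<phi> k \<in> L2 \<and> has_fourier (\<phi> k) (\<phi>hat k)"
  proof -
    have "\<exists>f. has_fourier f (\<phi>hat k)" for k :: "real^'n"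
    proof (rule bounded_support_fourier)
      let ?Q = "(\<lambda>x. x + (2 * pi) *\<^sub>R k) ` cbox (vec (- pi)) (vec pi)"
      have "?Q = cbox (vec (- pi) + (2 * pi) *\<^sub>R k) (vec pi + (2 * pi) *\<^sub>R k)"
        using cbox_translation[of "(2 * pi) *\<^sub>R k"] by (simp add: add.commute)
      then have Q: "?Q \<in> sets lebesgue" by simp
      have \<phi>: "\<phi>hat k = (\<lambda>\<xi>. indicator ?Q \<xi> * complex_of_real (sqrt (\<sigma> \<xi>)))"
        unfolding \<phi>hat_eq by (rule ext) (simp add: indicator_def)
      have "(\<lambda>\<xi>. complex_of_real (sqrt (\<sigma> \<xi>))) \<in> L2"
        using a \<sigma>_measurable by (simp add: L2_def)
      then show "\<phi>hat k \<in> L2" unfolding \<phi> by (rule L2_mult_indicator[OF _ Q])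
      \<comment> \<open>A point of the cube at \<open>k\<close> has coordinates of size at most \<open>\<pi> + 2 \<pi> \<bar>k\<bar>\<close>.\<close>
      fix x :: "real^'n" assume x: "x \<notin> centred_cube (2 * norm k + 2)"
      have "x \<notin> ?Q"
      proof
        assume "x \<in> ?Q"
        then obtain y where y: "x = y + (2 * pi) *\<^sub>R k" "y \<in> cbox (vec (- pi)) (vec pi)" by blast
        have "- (pi * (2 * norm k + 2)) \<le> x $ i \<and> x $ i < pi * (2 * norm k + 2)" for i
        proof -
          have "\<bar>2 * pi * k $ i\<bar> \<le> 2 * pi * norm k"
            using component_le_norm_cart[of k i] by (simp add: abs_mult)
          moreover have "- pi \<le> y $ i" "y $ i \<le> pi" using y(2) by (auto simp: mem_box_cart)
          moreover have "x $ i = y $ i + 2 * pi * k $ i" using y(1) by simp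
          moreover have "pi * (2 * norm k + 2) = 2 * pi * norm k + 2 * pi" by (simp add: algebra_simps)
          ultimately show ?thesis using pi_gt_zero by linarith
        qed
        then show False using x by (simp add: centred_cube_def)
      qed
      then show "\<phi>hat k x = 0" unfolding \<phi> by simp
    qed
    then obtain \<phi> where "\<And>k. has_fourier (\<phi> k) (\<phi>hat k)" by metis
    then show ?thesis by (intro exI[of _ \<phi>]) (auto simp: has_fourier_def)
  qed
  have phi_sum: "AE \<xi> in lebesgue. ((\<lambda>k. (cmod (\<phi>hat k \<xi>))\<^sup>2) has_sum \<sigma> \<xi>) int_lattice"
    using AE_closed_cell_unique
  proof eventually_elim
    case (elim \<xi>)
    let ?k = "cell (2*pi) (\<xi> + vec pi)"
    have val: "(cmod (\<phi>hat k \<xi>))\<^sup>2 = (if k = ?k then \<sigma> \<xi> else 0)" if "k \<in> int_lattice" for k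
      using elim that a(2)[of \<xi>] by (simp add: \<phi>hat_eq)
    have "((\<lambda>k. (cmod (\<phi>hat k \<xi>))\<^sup>2) has_sum (\<Sum>k\<in>{?k}. (cmod (\<phi>hat k \<xi>))\<^sup>2)) {?k}"
      by (rule has_sum_finite) simp
    then have "((\<lambda>k. (cmod (\<phi>hat k \<xi>))\<^sup>2) has_sum \<sigma> \<xi>) {?k}" by (simp add: val)
    then show ?case
      by (rule has_sum_cong_neutral[THEN iffD1, rotated -1]) (auto simp: val)
  qed
  have rest: "(\<exists>\<psi>. \<forall>i\<in>{1..p}. \<psi> i \<in> L2 \<and> has_fourier (\<psi> i) (\<psi>hat i)) \<and>
       (AE \<xi> in lebesgue.
          ((\<lambda>j. \<Sum>i=1..p. (cmod (\<psi>hat i (mat_pow ?T j *v \<xi>)))\<^sup>2) has_sum \<sigma> \<xi>) {1..}) \<and>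
       (\<forall>\<psi>. (\<forall>i\<in>{1..p}. has_fourier (\<psi> i) (\<psi>hat i)) \<longrightarrow>
          NTF_multiwavelet A {i\<in>{1..p}. \<not> (AE x in lebesgue. \<psi> i x = 0)} \<psi>)"
    if part: "translation_free_partition K p Ks"
      and \<psi>h: "\<forall>i\<in>{1..p}. \<psi>hat i \<in> borel_measurable lebesgue \<and>
          (AE \<xi> in lebesgue. (cmod (\<psi>hat i \<xi>))\<^sup>2 =
             (if \<xi> \<in> Ks i then \<sigma> (?Ti *v \<xi>) - \<sigma> \<xi> else 0))"
    for p Ks and \<psi>hat :: "nat \<Rightarrow> real^'n \<Rightarrow> complex"
  proof -
    have Ks_m: "Ks i \<in> sets lebesgue" and Ks_tf: "translation_free (Ks i)" if "i \<in> {1..p}" for i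
      using part that by (auto simp: translation_free_partition_def)
    have Ks_disj: "disjoint_family_on Ks {1..p}" and Ks_un: "(\<Union>i\<in>{1..p}. Ks i) = K"
      using part by (auto simp: translation_free_partition_def)
    have \<psi>_m: "\<psi>hat i \<in> borel_measurable lebesgue"
      and \<psi>_ae: "AE \<xi> in lebesgue. (cmod (\<psi>hat i \<xi>))\<^sup>2 = (if \<xi> \<in> Ks i then \<tau> \<xi> else 0)" if "i \<in> {1..p}" for i
      using \<psi>h that unfolding \<tau>_def by auto
    have \<psi>_off: "AE x in lebesgue. x \<notin> Ks i \<longrightarrow> \<psi>hat i x = 0" if "i \<in> {1..p}" for i
      using \<psi>_ae[OF that] by eventually_elim auto
    have \<psi>_L2: "\<psi>hat i \<in> L2" if i: "i \<in> {1..p}" for i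
    proof -
      have "(\<lambda>\<xi>. (cmod (\<psi>hat i \<xi>))\<^sup>2) \<in> borel_measurable lebesgue" using \<psi>_m[OF i] by measurable
      then have "integrable lebesgue (\<lambda>\<xi>. (cmod (\<psi>hat i \<xi>))\<^sup>2)"
        by (rule Bochner_Integration.integrable_bound[OF \<tau>_i])
          (use \<psi>_ae[OF i] in \<open>auto elim!: eventually_mono\<close>)
      then show ?thesis using \<psi>_m[OF i] by (simp add: L2_def)
    qed
    have psi_exists: "\<exists>f. has_fourier f (\<psi>hat i)" if i: "i \<in> {1..p}" for i
    proof (rule fourier_surjective[OF \<psi>_L2[OF i]])
      have "(\<lambda>x. indicator (Ks i) x * \<psi>hat i x) \<in> L2" by (rule L2_mult_indicator[OF \<psi>_L2[OF i] Ks_m[OF i]])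
      then have int: "integrable lebesgue (\<lambda>x. indicator (Ks i) x * \<psi>hat i x)"
        by (intro translation_free_integrable[OF Ks_tf[OF i] _ _ Ks_m[OF i]]) simp
      have "AE x in lebesgue. indicator (Ks i) x * \<psi>hat i x = \<psi>hat i x"
        using \<psi>_off[OF i] by eventually_elim auto
      then show "integrable lebesgue (\<psi>hat i)"
        using integrable_cong_AE[of "\<lambda>x. indicator (Ks i) x * \<psi>hat i x" lebesgue "\<psi>hat i"] int \<psi>_m[OF i]
          borel_measurable_integrable[OF int] by blast
    qed
    have w: "AE \<xi> in lebesgue. (\<Sum>i=1..p. (cmod (\<psi>hat i \<xi>))\<^sup>2) = \<tau> \<xi>"
    proof -
      have "AE \<xi> in lebesgue. \<forall>i\<in>{1..p}. (cmod (\<psi>hat i \<xi>))\<^sup>2 = (if \<xi> \<in> Ks i then \<tau> \<xi> else 0)"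
        using \<psi>_ae by (subst AE_ball_countable) auto
      then show ?thesis
      proof eventually_elim
        case (elim \<xi>)
        then have "(\<Sum>i=1..p. (cmod (\<psi>hat i \<xi>))\<^sup>2) = (\<Sum>i=1..p. if \<xi> \<in> Ks i then \<tau> \<xi> else 0)"
          by (intro sum.cong) auto
        also have "\<dots> = \<tau> \<xi>"
        proof (cases "\<xi> \<in> K")
          case True
          then obtain i0 where i0: "i0 \<in> {1..p}" "\<xi> \<in> Ks i0" using Ks_un by blast
          have "\<xi> \<in> Ks i \<longleftrightarrow> i = i0" if "i \<in> {1..p}" for i
            using disjoint_family_onD[OF Ks_disj that i0(1)] i0(2) by blast
          then have "(\<Sum>i=1..p. if \<xi> \<in> Ks i then \<tau> \<xi> else 0) = (\<Sum>i=1..p. if i = i0 then \<tau> \<xi> else 0)"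
            by (intro sum.cong) auto
          then show ?thesis using i0(1) by simp
        next
          case False
          then show ?thesis using K_\<tau>[of \<xi>] by (simp cong: if_cong)
        qed
        finally show ?case .
      qed
    qed
    have w_orbit: "AE \<xi> in lebesgue. \<forall>j. (\<Sum>i=1..p. (cmod (\<psi>hat i (mat_zpow ?T (- j) *v \<xi>)))\<^sup>2) = t (j + 1) \<xi> - t j \<xi>"
      using orbit[OF w] unfolding \<tau>_t .
    have psi_sum: "AE \<xi> in lebesgue.
        ((\<lambda>j. \<Sum>i=1..p. (cmod (\<psi>hat i (mat_pow ?T j *v \<xi>)))\<^sup>2) has_sum \<sigma> \<xi>) {1..}"
      using w_orbit t_mono t_bot
    proof eventually_elim
      case (elim \<xi>)
      let ?f = "\<lambda>j. \<Sum>i=1..p. (cmod (\<psi>hat i (mat_pow ?T j *v \<xi>)))\<^sup>2"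
      \<comment> \<open>Positive powers of \<open>A\<^sup>T\<close> are negative steps of \<open>t\<close>, starting at \<open>j = 1\<close>.\<close>
      have f: "?f (Suc n) = t (- int n) \<xi> - t (- int (Suc n)) \<xi>" for n
        using elim(1)[rule_format, of "- int (Suc n)"] by (simp add: mat_zpow_def nat_add_distrib)
      have "(\<lambda>n. t (- int n) \<xi> - t (- int (Suc n)) \<xi>) sums (t (- int 0) \<xi> - 0)"
        by (rule telescope_sums'[OF elim(3)])
      moreover have "t (- int 0) \<xi> = \<sigma> \<xi>" unfolding t_bot_eq by simp
      ultimately have "(\<lambda>n. ?f (Suc n)) sums \<sigma> \<xi>" unfolding f by simp
      then have "((\<lambda>n. ?f (Suc n)) has_sum \<sigma> \<xi>) UNIV"
        by (rule sums_nonneg_imp_has_sum) (simp add: sum_nonneg)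
      then have "(?f has_sum \<sigma> \<xi>) (range Suc)"
        by (subst has_sum_reindex) (simp_all add: o_def)
      moreover have "range Suc = {1..}"
        by (auto simp: image_iff Suc_le_eq gr0_conv_Suc)
      ultimately show ?case by simp
    qed
    have calderon: "AE \<xi> in lebesgue.
        ((\<lambda>j. \<Sum>i=1..p. (cmod (\<psi>hat i (mat_zpow ?T (- j) *v \<xi>)))\<^sup>2) has_sum 1) UNIV"
      using w_orbit t_mono t_top t_bot
    proof eventually_elim
      case (elim \<xi>)
      then have "((\<lambda>j. t (j + 1) \<xi> - t j \<xi>) has_sum (1 - 0)) UNIV"
        by (intro has_sum_telescope_int) auto
      then show ?case using elim(1) by simp
    qed
    have "NTF_multiwavelet A {i\<in>{1..p}. \<not> (AE x in lebesgue. \<psi> i x = 0)} \<psi>"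
      if "\<forall>i\<in>{1..p}. has_fourier (\<psi> i) (\<psi>hat i)" for \<psi>
      using that by (intro multiwavelet_criterion[OF A _ _ Ks_tf Ks_m \<psi>_off calderon]) auto
    moreover have "\<exists>\<psi>. \<forall>i\<in>{1..p}. \<psi> i \<in> L2 \<and> has_fourier (\<psi> i) (\<psi>hat i)"
    proof -
      obtain \<psi> where "\<forall>i\<in>{1..p}. has_fourier (\<psi> i) (\<psi>hat i)" using psi_exists by metis
      then show ?thesis by (intro exI[of _ \<psi>]) (auto simp: has_fourier_def)
    qed
    ultimately show ?thesis using psi_sum by blast
  qed
  show ?thesis
  proof (intro conjI allI impI)
    show "\<exists>p Ks. translation_free_partition K p Ks \<and> (\<forall>i\<in>{1..p}. Ks i \<noteq> {})"
      by (rule translation_free_partition_exists[OF K_m B])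
  qed (use phi_exists phi_sum rest in blast)+
qed


end
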